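(* Let $\mathbb{X}$ be a semi-abelian category and consider the torsion theory $\mu_{\geq 1}=(\mathcal{T}_{tr_0},\mathcal{F}_{tr_0})$ in $Simp(\mathbb{X})$. The torsion-free subcategory $\mathcal{F}_{tr_0}$ is equivalent to $Eq(\mathbb{X})$. On the other hand, $Ab(\mathbb{X})\subset\mathcal{T}_{tr_0}$.
   Context: $Simp(\mathbb{X})$ is the category of simplicial objects in $\mathbb{X}$. The functor $tr_0: Simp(\mathbb{X})\to\mathbb{X}$, $X\mapsto X_0$, has right adjoint $cosk_0=Ind$, where $Ind(A)_n=A^{n+1}$ with faces the projections. $\mathcal{T}_{tr_0}$ is the full subcategory of simplicial objects $X$ with $X_0\cong0$; $\mathcal{F}_{tr_0}$ is the full subcategory of simplicial objects $X$ for which the unit $\eta_X: X\to Ind(X_0)$ is a monomorphism. The pair $(\mathcal{T}_{tr_0},\mathcal{F}_{tr_0})$ is a torsion theory: morphisms from $\mathcal{T}_{tr_0}$ to $\mathcal{F}_{tr_0}$ are zero, and each $X$ is an extension of an object of $\mathcal{F}_{tr_0}$ by an object of $\mathcal{T}_{tr_0}$. Internal groupoids in $\mathbb{X}$ are regarded as simplicial objects via the nerve. $Eq(\mathbb{X})$ is the category of internal equivalence relations in $\mathbb{X}$, i.e. internal groupoids for which $(d_0,d_1): X_1\to X_0\times X_0$ is monic. $Ab(\mathbb{X})$ is the category of internal abelian group objects in $\mathbb{X}$, each regarded as an internal groupoid with object of objects $X_0=0$. *)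

theory Defs
  imports "HOL-Library.FuncSet"
begin

section \<open>Categories, functors, natural transformations\<close>

record ('o, 'm) cat =
  Ob :: "'o set"
  Ar :: "'m set"
  Dom :: "'m \<Rightarrow> 'o"
  Cod :: "'m \<Rightarrow> 'o"
  Ident :: "'o \<Rightarrow> 'm"
  Comp :: "'m \<Rightarrow> 'm \<Rightarrow> 'm"  (infixl "\<cdot>\<index>" 70)

definition Hom :: "('o, 'm) cat \<Rightarrow> 'o \<Rightarrow> 'o \<Rightarrow> 'm set" where
  "Hom C a b = {f \<in> Ar C. Dom C f = a \<and> Cod C f = b}"

locale category =
  fixes C :: "('o, 'm) cat" (structure)
  assumes Dom_Ob: "f \<in> Ar C \<Longrightarrow> Dom C f \<in> Ob C"
    and Cod_Ob: "f \<in> Ar C \<Longrightarrow> Cod C f \<in> Ob C"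
    and Ident_Hom: "a \<in> Ob C \<Longrightarrow> Ident C a \<in> Hom C a a"
    and Comp_Hom: "f \<in> Hom C a b \<Longrightarrow> g \<in> Hom C b c \<Longrightarrow> g \<cdot> f \<in> Hom C a c"
    and Comp_Ident: "f \<in> Hom C a b \<Longrightarrow> f \<cdot> Ident C a = f"
    and Ident_Comp: "f \<in> Hom C a b \<Longrightarrow> Ident C b \<cdot> f = f"
    and Comp_assoc: "f \<in> Hom C a b \<Longrightarrow> g \<in> Hom C b c \<Longrightarrow> h \<in> Hom C c d \<Longrightarrow>
      (h \<cdot> g) \<cdot> f = h \<cdot> (g \<cdot> f)"

definition op_cat :: "('o, 'm) cat \<Rightarrow> ('o, 'm) cat" where
  "op_cat C = \<lparr>Ob = Ob C, Ar = Ar C, Dom = Cod C, Cod = Dom C, Ident = Ident C,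
     Comp = (\<lambda>g f. f \<cdot>\<^bsub>C\<^esub> g)\<rparr>"

definition full_subcategory :: "('o, 'm) cat \<Rightarrow> 'o set \<Rightarrow> ('o, 'm) cat" where
  "full_subcategory C S = \<lparr>Ob = Ob C \<inter> S, Ar = {f \<in> Ar C. Dom C f \<in> S \<and> Cod C f \<in> S},
     Dom = Dom C, Cod = Cod C, Ident = Ident C, Comp = Comp C\<rparr>"

record ('o1, 'm1, 'o2, 'm2) func =
  FOb :: "'o1 \<Rightarrow> 'o2"
  FAr :: "'m1 \<Rightarrow> 'm2"

definition is_functor ::
  "('o1, 'm1) cat \<Rightarrow> ('o2, 'm2) cat \<Rightarrow> ('o1, 'm1, 'o2, 'm2) func \<Rightarrow> bool" where
  "is_functor C D F \<longleftrightarrow>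
     (\<forall>a\<in>Ob C. FOb F a \<in> Ob D) \<and>
     (\<forall>f\<in>Ar C. FAr F f \<in> Hom D (FOb F (Dom C f)) (FOb F (Cod C f))) \<and>
     (\<forall>a\<in>Ob C. FAr F (Ident C a) = Ident D (FOb F a)) \<and>
     (\<forall>f\<in>Ar C. \<forall>g\<in>Ar C. Dom C g = Cod C f \<longrightarrow>
        FAr F (g \<cdot>\<^bsub>C\<^esub> f) = FAr F g \<cdot>\<^bsub>D\<^esub> FAr F f)"

definition id_func :: "('o, 'm, 'o, 'm) func" where
  "id_func = \<lparr>FOb = (\<lambda>a. a), FAr = (\<lambda>f. f)\<rparr>"

definition comp_func ::
  "('o2, 'm2, 'o3, 'm3) func \<Rightarrow> ('o1, 'm1, 'o2, 'm2) func \<Rightarrow> ('o1, 'm1, 'o3, 'm3) func" where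
  "comp_func G F = \<lparr>FOb = FOb G \<circ> FOb F, FAr = FAr G \<circ> FAr F\<rparr>"

definition is_nat_trans ::
  "('o1, 'm1) cat \<Rightarrow> ('o2, 'm2) cat \<Rightarrow> ('o1, 'm1, 'o2, 'm2) func \<Rightarrow>
   ('o1, 'm1, 'o2, 'm2) func \<Rightarrow> ('o1 \<Rightarrow> 'm2) \<Rightarrow> bool" where
  "is_nat_trans C D F G \<tau> \<longleftrightarrow>
     (\<forall>a\<in>Ob C. \<tau> a \<in> Hom D (FOb F a) (FOb G a)) \<and>
     (\<forall>f\<in>Ar C. \<tau> (Cod C f) \<cdot>\<^bsub>D\<^esub> FAr F f = FAr G f \<cdot>\<^bsub>D\<^esub> \<tau> (Dom C f))"

definition iso_arr :: "('o, 'm) cat \<Rightarrow> 'm \<Rightarrow> bool" where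
  "iso_arr C f \<longleftrightarrow> f \<in> Ar C \<and>
     (\<exists>g \<in> Hom C (Cod C f) (Dom C f).
        g \<cdot>\<^bsub>C\<^esub> f = Ident C (Dom C f) \<and> f \<cdot>\<^bsub>C\<^esub> g = Ident C (Cod C f))"

definition isomorphic :: "('o, 'm) cat \<Rightarrow> 'o \<Rightarrow> 'o \<Rightarrow> bool" where
  "isomorphic C a b \<longleftrightarrow> (\<exists>f \<in> Hom C a b. iso_arr C f)"

definition naturally_isomorphic ::
  "('o1, 'm1) cat \<Rightarrow> ('o2, 'm2) cat \<Rightarrow> ('o1, 'm1, 'o2, 'm2) func \<Rightarrow>
   ('o1, 'm1, 'o2, 'm2) func \<Rightarrow> bool" where
  "naturally_isomorphic C D F G \<longleftrightarrow>
     (\<exists>\<tau>. is_nat_trans C D F G \<tau> \<and> (\<forall>a\<in>Ob C. iso_arr D (\<tau> a)))"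

definition equivalent_categories :: "('o1, 'm1) cat \<Rightarrow> ('o2, 'm2) cat \<Rightarrow> bool" where
  "equivalent_categories C D \<longleftrightarrow>
     (\<exists>F G. is_functor C D F \<and> is_functor D C G \<and>
        naturally_isomorphic C C id_func (comp_func G F) \<and>
        naturally_isomorphic D D (comp_func F G) id_func)"

definition fully_faithful ::
  "('o1, 'm1) cat \<Rightarrow> ('o2, 'm2) cat \<Rightarrow> ('o1, 'm1, 'o2, 'm2) func \<Rightarrow> bool" where
  "fully_faithful C D F \<longleftrightarrow> is_functor C D F \<and>
     (\<forall>a\<in>Ob C. \<forall>b\<in>Ob C. bij_betw (FAr F) (Hom C a b) (Hom D (FOb F a) (FOb F b)))"

text \<open>Functors and natural transformations are required to be undefined outside their domain, so
  that the objects and arrows of the functor category are determined by their mathematical data.\<close>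

definition functor_category ::
  "('o1, 'm1) cat \<Rightarrow> ('o2, 'm2) cat \<Rightarrow>
   (('o1, 'm1, 'o2, 'm2) func,
    ('o1, 'm1, 'o2, 'm2) func \<times> ('o1, 'm1, 'o2, 'm2) func \<times> ('o1 \<Rightarrow> 'm2)) cat" where
  "functor_category C D =
     (let O' = {F. is_functor C D F \<and> FOb F \<in> extensional (Ob C) \<and> FAr F \<in> extensional (Ar C)}
      in \<lparr>Ob = O',
          Ar = {(F, G, \<tau>). F \<in> O' \<and> G \<in> O' \<and> is_nat_trans C D F G \<tau> \<and> \<tau> \<in> extensional (Ob C)},
          Dom = (\<lambda>(F, G, \<tau>). F),
          Cod = (\<lambda>(F, G, \<tau>). G),
          Ident = (\<lambda>F. (F, F, \<lambda>a\<in>Ob C. Ident D (FOb F a))),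
          Comp = (\<lambda>(G, H, \<sigma>) (F, G', \<tau>). (F, H, \<lambda>a\<in>Ob C. \<sigma> a \<cdot>\<^bsub>D\<^esub> \<tau> a))\<rparr>)"


section \<open>Limits, colimits and special arrows\<close>

definition monic :: "('o, 'm) cat \<Rightarrow> 'm \<Rightarrow> bool" where
  "monic C f \<longleftrightarrow> f \<in> Ar C \<and>
     (\<forall>q. \<forall>g \<in> Hom C q (Dom C f). \<forall>h \<in> Hom C q (Dom C f).
        f \<cdot>\<^bsub>C\<^esub> g = f \<cdot>\<^bsub>C\<^esub> h \<longrightarrow> g = h)"

definition is_cone ::
  "('j, 'u) cat \<Rightarrow> ('o, 'm) cat \<Rightarrow> ('j, 'u, 'o, 'm) func \<Rightarrow> 'o \<Rightarrow> ('j \<Rightarrow> 'm) \<Rightarrow> bool" where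
  "is_cone J C D L p \<longleftrightarrow> L \<in> Ob C \<and>
     (\<forall>j\<in>Ob J. p j \<in> Hom C L (FOb D j)) \<and>
     (\<forall>u\<in>Ar J. FAr D u \<cdot>\<^bsub>C\<^esub> p (Dom J u) = p (Cod J u))"

definition is_limit ::
  "('j, 'u) cat \<Rightarrow> ('o, 'm) cat \<Rightarrow> ('j, 'u, 'o, 'm) func \<Rightarrow> 'o \<Rightarrow> ('j \<Rightarrow> 'm) \<Rightarrow> bool" where
  "is_limit J C D L p \<longleftrightarrow> is_cone J C D L p \<and>
     (\<forall>Q q. is_cone J C D Q q \<longrightarrow> (\<exists>!h. h \<in> Hom C Q L \<and> (\<forall>j\<in>Ob J. p j \<cdot>\<^bsub>C\<^esub> h = q j)))"

text \<open>Every finite category is isomorphic to one whose objects and arrows are natural numbers.\<close>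

definition finitely_complete :: "('o, 'm) cat \<Rightarrow> bool" where
  "finitely_complete C \<longleftrightarrow>
     (\<forall>(J :: (nat, nat) cat) D.
        category J \<and> finite (Ob J) \<and> finite (Ar J) \<and> is_functor J C D \<longrightarrow>
        (\<exists>L p. is_limit J C D L p))"

definition is_zero_object :: "('o, 'm) cat \<Rightarrow> 'o \<Rightarrow> bool" where
  "is_zero_object C z \<longleftrightarrow> z \<in> Ob C \<and>
     (\<forall>a\<in>Ob C. (\<exists>!f. f \<in> Hom C a z) \<and> (\<exists>!f. f \<in> Hom C z a))"

definition pointed :: "('o, 'm) cat \<Rightarrow> bool" where
  "pointed C \<longleftrightarrow> (\<exists>z. is_zero_object C z)"

definition zero_ob :: "('o, 'm) cat \<Rightarrow> 'o" where
  "zero_ob C = (SOME z. is_zero_object C z)"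

definition to_zero :: "('o, 'm) cat \<Rightarrow> 'o \<Rightarrow> 'm" where
  "to_zero C a = (THE f. f \<in> Hom C a (zero_ob C))"

definition is_binary_coproduct ::
  "('o, 'm) cat \<Rightarrow> 'o \<Rightarrow> 'o \<Rightarrow> 'o \<Rightarrow> 'm \<Rightarrow> 'm \<Rightarrow> bool" where
  "is_binary_coproduct C a b s i j \<longleftrightarrow> i \<in> Hom C a s \<and> j \<in> Hom C b s \<and>
     (\<forall>q. \<forall>x \<in> Hom C a q. \<forall>y \<in> Hom C b q.
        \<exists>!h. h \<in> Hom C s q \<and> h \<cdot>\<^bsub>C\<^esub> i = x \<and> h \<cdot>\<^bsub>C\<^esub> j = y)"

definition has_binary_coproducts :: "('o, 'm) cat \<Rightarrow> bool" where
  "has_binary_coproducts C \<longleftrightarrow>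
     (\<forall>a\<in>Ob C. \<forall>b\<in>Ob C. \<exists>s i j. is_binary_coproduct C a b s i j)"

definition is_pullback :: "('o, 'm) cat \<Rightarrow> 'm \<Rightarrow> 'm \<Rightarrow> 'o \<Rightarrow> 'm \<Rightarrow> 'm \<Rightarrow> bool" where
  "is_pullback C f g P a b \<longleftrightarrow>
     f \<in> Ar C \<and> g \<in> Ar C \<and> Cod C f = Cod C g \<and>
     a \<in> Hom C P (Dom C f) \<and> b \<in> Hom C P (Dom C g) \<and> f \<cdot>\<^bsub>C\<^esub> a = g \<cdot>\<^bsub>C\<^esub> b \<and>
     (\<forall>q. \<forall>x \<in> Hom C q (Dom C f). \<forall>y \<in> Hom C q (Dom C g). f \<cdot>\<^bsub>C\<^esub> x = g \<cdot>\<^bsub>C\<^esub> y \<longrightarrow>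
        (\<exists>!h. h \<in> Hom C q P \<and> a \<cdot>\<^bsub>C\<^esub> h = x \<and> b \<cdot>\<^bsub>C\<^esub> h = y))"

definition is_coequalizer :: "('o, 'm) cat \<Rightarrow> 'm \<Rightarrow> 'm \<Rightarrow> 'm \<Rightarrow> bool" where
  "is_coequalizer C f g e \<longleftrightarrow>
     f \<in> Ar C \<and> g \<in> Ar C \<and> e \<in> Ar C \<and> Dom C f = Dom C g \<and>
     Cod C f = Dom C e \<and> Cod C g = Dom C e \<and> e \<cdot>\<^bsub>C\<^esub> f = e \<cdot>\<^bsub>C\<^esub> g \<and>
     (\<forall>q. \<forall>x \<in> Hom C (Dom C e) q. x \<cdot>\<^bsub>C\<^esub> f = x \<cdot>\<^bsub>C\<^esub> g \<longrightarrow>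
        (\<exists>!h. h \<in> Hom C (Cod C e) q \<and> h \<cdot>\<^bsub>C\<^esub> e = x))"

definition regular_epi :: "('o, 'm) cat \<Rightarrow> 'm \<Rightarrow> bool" where
  "regular_epi C e \<longleftrightarrow> (\<exists>f g. is_coequalizer C f g e)"


section \<open>Chosen pullbacks and finite powers\<close>

definition pb :: "('o, 'm) cat \<Rightarrow> 'm \<Rightarrow> 'm \<Rightarrow> 'o \<times> 'm \<times> 'm" where
  "pb C f g = (SOME (P, a, b). is_pullback C f g P a b)"

definition pb_ob :: "('o, 'm) cat \<Rightarrow> 'm \<Rightarrow> 'm \<Rightarrow> 'o" where
  "pb_ob C f g = fst (pb C f g)"

definition pb_fst :: "('o, 'm) cat \<Rightarrow> 'm \<Rightarrow> 'm \<Rightarrow> 'm" where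
  "pb_fst C f g = fst (snd (pb C f g))"

definition pb_snd :: "('o, 'm) cat \<Rightarrow> 'm \<Rightarrow> 'm \<Rightarrow> 'm" where
  "pb_snd C f g = snd (snd (pb C f g))"

definition pb_pair :: "('o, 'm) cat \<Rightarrow> 'm \<Rightarrow> 'm \<Rightarrow> 'm \<Rightarrow> 'm \<Rightarrow> 'm" where
  "pb_pair C f g x y = (THE h. h \<in> Hom C (Dom C x) (pb_ob C f g) \<and>
     pb_fst C f g \<cdot>\<^bsub>C\<^esub> h = x \<and> pb_snd C f g \<cdot>\<^bsub>C\<^esub> h = y)"

definition is_power :: "('o, 'm) cat \<Rightarrow> 'o \<Rightarrow> nat \<Rightarrow> 'o \<Rightarrow> (nat \<Rightarrow> 'm) \<Rightarrow> bool" where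
  "is_power C A k P p \<longleftrightarrow> P \<in> Ob C \<and> (\<forall>i<k. p i \<in> Hom C P A) \<and>
     (\<forall>Q\<in>Ob C. \<forall>x. (\<forall>i<k. x i \<in> Hom C Q A) \<longrightarrow>
        (\<exists>!h. h \<in> Hom C Q P \<and> (\<forall>i<k. p i \<cdot>\<^bsub>C\<^esub> h = x i)))"

definition pow :: "('o, 'm) cat \<Rightarrow> 'o \<Rightarrow> nat \<Rightarrow> 'o \<times> (nat \<Rightarrow> 'm)" where
  "pow C A k = (SOME (P, p). is_power C A k P p)"

definition pow_ob :: "('o, 'm) cat \<Rightarrow> 'o \<Rightarrow> nat \<Rightarrow> 'o" where
  "pow_ob C A k = fst (pow C A k)"

definition pow_proj :: "('o, 'm) cat \<Rightarrow> 'o \<Rightarrow> nat \<Rightarrow> nat \<Rightarrow> 'm" where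
  "pow_proj C A k = snd (pow C A k)"

definition pow_tuple :: "('o, 'm) cat \<Rightarrow> 'o \<Rightarrow> 'o \<Rightarrow> nat \<Rightarrow> (nat \<Rightarrow> 'm) \<Rightarrow> 'm" where
  "pow_tuple C Q A k x =
     (THE h. h \<in> Hom C Q (pow_ob C A k) \<and> (\<forall>i<k. pow_proj C A k i \<cdot>\<^bsub>C\<^esub> h = x i))"

definition pow_pair :: "('o, 'm) cat \<Rightarrow> 'o \<Rightarrow> 'm \<Rightarrow> 'm \<Rightarrow> 'm" where
  "pow_pair C A x y = pow_tuple C (Dom C x) A 2 (\<lambda>i. [x, y] ! i)"


section \<open>Internal groupoids and equivalence relations\<close>

text \<open>As in the nerve, \<open>Gd1\<close> is the source and \<open>Gd0\<close> the target map, and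
  \<open>Gm\<close> sends a pair \<open>(x, y)\<close> with \<open>Gd0 x = Gd1 y\<close> to the composite ``first x, then y''.\<close>

record ('o, 'm) igpd =
  G0 :: 'o
  G1 :: 'o
  Gd0 :: 'm
  Gd1 :: 'm
  Gs :: 'm
  Gm :: 'm
  Gi :: 'm

definition gcomp :: "('o, 'm) cat \<Rightarrow> ('o, 'm) igpd \<Rightarrow> 'm \<Rightarrow> 'm \<Rightarrow> 'm" where
  "gcomp C G x y = Gm G \<cdot>\<^bsub>C\<^esub> pb_pair C (Gd0 G) (Gd1 G) x y"

text \<open>Associativity is stated on generalized elements \<open>x, y, z : q \<rightarrow> G\<^sub>1\<close>; the generic triple
  is given by the projections of the object of composable triples.\<close>

definition internal_groupoid :: "('o, 'm) cat \<Rightarrow> ('o, 'm) igpd \<Rightarrow> bool" where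
  "internal_groupoid C G \<longleftrightarrow>
     (let d0 = Gd0 G; d1 = Gd1 G; s = Gs G; m = Gm G; i = Gi G; one = Ident C (G1 G) in
       G0 G \<in> Ob C \<and> G1 G \<in> Ob C \<and>
       d0 \<in> Hom C (G1 G) (G0 G) \<and> d1 \<in> Hom C (G1 G) (G0 G) \<and> s \<in> Hom C (G0 G) (G1 G) \<and>
       m \<in> Hom C (pb_ob C d0 d1) (G1 G) \<and> i \<in> Hom C (G1 G) (G1 G) \<and>
       d0 \<cdot>\<^bsub>C\<^esub> s = Ident C (G0 G) \<and> d1 \<cdot>\<^bsub>C\<^esub> s = Ident C (G0 G) \<and>
       d1 \<cdot>\<^bsub>C\<^esub> m = d1 \<cdot>\<^bsub>C\<^esub> pb_fst C d0 d1 \<and> d0 \<cdot>\<^bsub>C\<^esub> m = d0 \<cdot>\<^bsub>C\<^esub> pb_snd C d0 d1 \<and>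
       gcomp C G (s \<cdot>\<^bsub>C\<^esub> d1) one = one \<and> gcomp C G one (s \<cdot>\<^bsub>C\<^esub> d0) = one \<and>
       (\<forall>q. \<forall>x \<in> Hom C q (G1 G). \<forall>y \<in> Hom C q (G1 G). \<forall>z \<in> Hom C q (G1 G).
          d0 \<cdot>\<^bsub>C\<^esub> x = d1 \<cdot>\<^bsub>C\<^esub> y \<and> d0 \<cdot>\<^bsub>C\<^esub> y = d1 \<cdot>\<^bsub>C\<^esub> z \<longrightarrow>
          gcomp C G (gcomp C G x y) z = gcomp C G x (gcomp C G y z)) \<and>
       d1 \<cdot>\<^bsub>C\<^esub> i = d0 \<and> d0 \<cdot>\<^bsub>C\<^esub> i = d1 \<and>
       gcomp C G one i = s \<cdot>\<^bsub>C\<^esub> d1 \<and> gcomp C G i one = s \<cdot>\<^bsub>C\<^esub> d0)"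

definition internal_equivalence_relation :: "('o, 'm) cat \<Rightarrow> ('o, 'm) igpd \<Rightarrow> bool" where
  "internal_equivalence_relation C G \<longleftrightarrow>
     internal_groupoid C G \<and> monic C (pow_pair C (G0 G) (Gd0 G) (Gd1 G))"

text \<open>Preservation of inverses is automatic.\<close>

definition internal_functor ::
  "('o, 'm) cat \<Rightarrow> ('o, 'm) igpd \<Rightarrow> ('o, 'm) igpd \<Rightarrow> 'm \<Rightarrow> 'm \<Rightarrow> bool" where
  "internal_functor C G H f0 f1 \<longleftrightarrow>
     f0 \<in> Hom C (G0 G) (G0 H) \<and> f1 \<in> Hom C (G1 G) (G1 H) \<and>
     Gd0 H \<cdot>\<^bsub>C\<^esub> f1 = f0 \<cdot>\<^bsub>C\<^esub> Gd0 G \<and> Gd1 H \<cdot>\<^bsub>C\<^esub> f1 = f0 \<cdot>\<^bsub>C\<^esub> Gd1 G \<and>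
     Gs H \<cdot>\<^bsub>C\<^esub> f0 = f1 \<cdot>\<^bsub>C\<^esub> Gs G \<and>
     f1 \<cdot>\<^bsub>C\<^esub> Gm G =
       gcomp C H (f1 \<cdot>\<^bsub>C\<^esub> pb_fst C (Gd0 G) (Gd1 G)) (f1 \<cdot>\<^bsub>C\<^esub> pb_snd C (Gd0 G) (Gd1 G))"

definition Grpd_cat ::
  "('o, 'm) cat \<Rightarrow>
   (('o, 'm) igpd, ('o, 'm) igpd \<times> ('o, 'm) igpd \<times> 'm \<times> 'm) cat" where
  "Grpd_cat C = \<lparr>Ob = {G. internal_groupoid C G},
     Ar = {(G, H, f0, f1). internal_groupoid C G \<and> internal_groupoid C H \<and>
             internal_functor C G H f0 f1},
     Dom = (\<lambda>(G, H, f0, f1). G),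
     Cod = (\<lambda>(G, H, f0, f1). H),
     Ident = (\<lambda>G. (G, G, Ident C (G0 G), Ident C (G1 G))),
     Comp = (\<lambda>(H, K, g0, g1) (G, H', f0, f1). (G, K, g0 \<cdot>\<^bsub>C\<^esub> f0, g1 \<cdot>\<^bsub>C\<^esub> f1))\<rparr>"

definition Eq_cat ::
  "('o, 'm) cat \<Rightarrow>
   (('o, 'm) igpd, ('o, 'm) igpd \<times> ('o, 'm) igpd \<times> 'm \<times> 'm) cat" where
  "Eq_cat C = full_subcategory (Grpd_cat C) {G. internal_equivalence_relation C G}"


section \<open>Semi-abelian categories\<close>

definition regular_category :: "('o, 'm) cat \<Rightarrow> bool" where
  "regular_category C \<longleftrightarrow> finitely_complete C \<and>
     (\<forall>f P a b. is_pullback C f f P a b \<longrightarrow> (\<exists>e. is_coequalizer C a b e)) \<and>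
     (\<forall>f g P a b. is_pullback C f g P a b \<and> regular_epi C g \<longrightarrow> regular_epi C a)"

definition Barr_exact :: "('o, 'm) cat \<Rightarrow> bool" where
  "Barr_exact C \<longleftrightarrow> regular_category C \<and>
     (\<forall>R. internal_equivalence_relation C R \<longrightarrow>
        (\<exists>f \<in> Ar C. is_pullback C f f (G1 R) (Gd0 R) (Gd1 R)))"

text \<open>\<open>(p, s)\<close> is an object of the category of points over \<open>B\<close>, with total object \<open>A\<close>.\<close>

definition is_point :: "('o, 'm) cat \<Rightarrow> 'o \<Rightarrow> 'o \<Rightarrow> 'm \<Rightarrow> 'm \<Rightarrow> bool" where
  "is_point C B A p s \<longleftrightarrow> p \<in> Hom C A B \<and> s \<in> Hom C B A \<and> p \<cdot>\<^bsub>C\<^esub> s = Ident C B"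

text \<open>Bourn protomodularity: for each \<open>v : E \<rightarrow> B\<close> the pullback functor from points over \<open>B\<close> to
  points over \<open>E\<close> reflects isomorphisms. Here \<open>g\<close> is the value of this functor at the morphism of
  points \<open>f\<close>, computed with respect to arbitrary pullbacks.\<close>

definition protomodular :: "('o, 'm) cat \<Rightarrow> bool" where
  "protomodular C \<longleftrightarrow>
     (\<forall>E B v A p s A' p' s' f P a e P' a' e' g.
        v \<in> Hom C E B \<and> is_point C B A p s \<and> is_point C B A' p' s' \<and>
        f \<in> Hom C A A' \<and> p' \<cdot>\<^bsub>C\<^esub> f = p \<and> f \<cdot>\<^bsub>C\<^esub> s = s' \<and>
        is_pullback C p v P a e \<and> is_pullback C p' v P' a' e' \<and>
        g \<in> Hom C P P' \<and> a' \<cdot>\<^bsub>C\<^esub> g = f \<cdot>\<^bsub>C\<^esub> a \<and> e' \<cdot>\<^bsub>C\<^esub> g = e \<and> iso_arr C g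
        \<longrightarrow> iso_arr C f)"

definition semi_abelian :: "('o, 'm) cat \<Rightarrow> bool" where
  "semi_abelian C \<longleftrightarrow> category C \<and> pointed C \<and> has_binary_coproducts C \<and>
     Barr_exact C \<and> protomodular C"


section \<open>Simplicial objects\<close>

text \<open>The object \<open>n\<close> of the simplex category is the ordinal \<open>[n] = {0, \<dots>, n}\<close>.\<close>

definition Delta :: "(nat, nat \<times> nat \<times> (nat \<Rightarrow> nat)) cat" where
  "Delta = \<lparr>Ob = UNIV,
     Ar = {(m, n, f). f \<in> {..m} \<rightarrow>\<^sub>E {..n} \<and> mono_on {..m} f},
     Dom = (\<lambda>(m, n, f). m),
     Cod = (\<lambda>(m, n, f). n),
     Ident = (\<lambda>n. (n, n, \<lambda>i\<in>{..n}. i)),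
     Comp = (\<lambda>(n, k, g) (m, n', f). (m, k, \<lambda>i\<in>{..m}. g (f i)))\<rparr>"

type_synonym ('o, 'm) simp_ob = "(nat, nat \<times> nat \<times> (nat \<Rightarrow> nat), 'o, 'm) func"
type_synonym ('o, 'm) simp_ar = "('o, 'm) simp_ob \<times> ('o, 'm) simp_ob \<times> (nat \<Rightarrow> 'm)"

definition Simp :: "('o, 'm) cat \<Rightarrow> (('o, 'm) simp_ob, ('o, 'm) simp_ar) cat" where
  "Simp C = functor_category (op_cat Delta) C"

definition tr0 :: "(('o, 'm) simp_ob, ('o, 'm) simp_ar, 'o, 'm) func" where
  "tr0 = \<lparr>FOb = (\<lambda>X. FOb X 0), FAr = (\<lambda>(X, Y, \<tau>). \<tau> 0)\<rparr>"

definition Ind :: "('o, 'm) cat \<Rightarrow> 'o \<Rightarrow> ('o, 'm) simp_ob" where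
  "Ind C A = \<lparr>FOb = (\<lambda>n. pow_ob C A (Suc n)),
     FAr = (\<lambda>\<alpha>\<in>Ar Delta. case \<alpha> of (m, n, f) \<Rightarrow>
       pow_tuple C (pow_ob C A (Suc n)) A (Suc m) (\<lambda>k. pow_proj C A (Suc n) (f k)))\<rparr>"

definition vertex :: "nat \<Rightarrow> nat \<Rightarrow> nat \<times> nat \<times> (nat \<Rightarrow> nat)" where
  "vertex n k = (0, n, \<lambda>i\<in>{..0}. k)"

text \<open>The unit of the adjunction between \<open>tr0\<close> and \<open>Ind\<close>: by naturality along the vertices
  \<open>[0] \<rightarrow> [n]\<close>, the transpose of the identity of \<open>X\<^sub>0\<close> is the tuple of the vertex maps of \<open>X\<close>.\<close>

definition unit_tr0 :: "('o, 'm) cat \<Rightarrow> ('o, 'm) simp_ob \<Rightarrow> ('o, 'm) simp_ar" where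
  "unit_tr0 C X = (X, Ind C (FOb X 0),
     \<lambda>n. pow_tuple C (FOb X n) (FOb X 0) (Suc n) (\<lambda>k. FAr X (vertex n k)))"

definition T_tr0 :: "('o, 'm) cat \<Rightarrow> (('o, 'm) simp_ob, ('o, 'm) simp_ar) cat" where
  "T_tr0 C = full_subcategory (Simp C) {X. isomorphic C (FOb tr0 X) (zero_ob C)}"

definition F_tr0 :: "('o, 'm) cat \<Rightarrow> (('o, 'm) simp_ob, ('o, 'm) simp_ar) cat" where
  "F_tr0 C = full_subcategory (Simp C) {X. monic (Simp C) (unit_tr0 C X)}"


section \<open>The nerve of an internal groupoid\<close>

text \<open>The object of composable strings of \<open>n\<close> arrows, with its vertices \<open>v 0, \<dots>, v n\<close> and edges
  \<open>e k : v k \<rightarrow> v (k + 1)\<close>.\<close>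

definition is_string ::
  "('o, 'm) cat \<Rightarrow> ('o, 'm) igpd \<Rightarrow> nat \<Rightarrow> 'o \<Rightarrow> (nat \<Rightarrow> 'm) \<Rightarrow> (nat \<Rightarrow> 'm) \<Rightarrow> bool" where
  "is_string C G n Q v e \<longleftrightarrow> Q \<in> Ob C \<and>
     (\<forall>k\<le>n. v k \<in> Hom C Q (G0 G)) \<and>
     (\<forall>k<n. e k \<in> Hom C Q (G1 G) \<and>
        Gd1 G \<cdot>\<^bsub>C\<^esub> e k = v k \<and> Gd0 G \<cdot>\<^bsub>C\<^esub> e k = v (Suc k))"

definition is_string_object ::
  "('o, 'm) cat \<Rightarrow> ('o, 'm) igpd \<Rightarrow> nat \<Rightarrow> 'o \<Rightarrow> (nat \<Rightarrow> 'm) \<Rightarrow> (nat \<Rightarrow> 'm) \<Rightarrow> bool" where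
  "is_string_object C G n N v e \<longleftrightarrow> is_string C G n N v e \<and>
     (\<forall>Q v' e'. is_string C G n Q v' e' \<longrightarrow>
        (\<exists>!h. h \<in> Hom C Q N \<and> (\<forall>k\<le>n. v k \<cdot>\<^bsub>C\<^esub> h = v' k) \<and> (\<forall>k<n. e k \<cdot>\<^bsub>C\<^esub> h = e' k)))"

definition strings ::
  "('o, 'm) cat \<Rightarrow> ('o, 'm) igpd \<Rightarrow> nat \<Rightarrow> 'o \<times> (nat \<Rightarrow> 'm) \<times> (nat \<Rightarrow> 'm)" where
  "strings C G n = (SOME (N, v, e). is_string_object C G n N v e)"

definition nerve_ob :: "('o, 'm) cat \<Rightarrow> ('o, 'm) igpd \<Rightarrow> nat \<Rightarrow> 'o" where
  "nerve_ob C G n = fst (strings C G n)"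

definition nerve_vert :: "('o, 'm) cat \<Rightarrow> ('o, 'm) igpd \<Rightarrow> nat \<Rightarrow> nat \<Rightarrow> 'm" where
  "nerve_vert C G n = fst (snd (strings C G n))"

definition nerve_edge :: "('o, 'm) cat \<Rightarrow> ('o, 'm) igpd \<Rightarrow> nat \<Rightarrow> nat \<Rightarrow> 'm" where
  "nerve_edge C G n = snd (snd (strings C G n))"

definition nerve_tuple ::
  "('o, 'm) cat \<Rightarrow> ('o, 'm) igpd \<Rightarrow> nat \<Rightarrow> 'o \<Rightarrow> (nat \<Rightarrow> 'm) \<Rightarrow> (nat \<Rightarrow> 'm) \<Rightarrow> 'm" where
  "nerve_tuple C G n Q v e =
     (THE h. h \<in> Hom C Q (nerve_ob C G n) \<and>
        (\<forall>k\<le>n. nerve_vert C G n k \<cdot>\<^bsub>C\<^esub> h = v k) \<and>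
        (\<forall>k<n. nerve_edge C G n k \<cdot>\<^bsub>C\<^esub> h = e k))"

text \<open>\<open>nerve_path C G n i l\<close> is the composite of the edges from vertex \<open>i\<close> to vertex \<open>i + l\<close>.\<close>

primrec nerve_path :: "('o, 'm) cat \<Rightarrow> ('o, 'm) igpd \<Rightarrow> nat \<Rightarrow> nat \<Rightarrow> nat \<Rightarrow> 'm" where
  "nerve_path C G n i 0 = Gs G \<cdot>\<^bsub>C\<^esub> nerve_vert C G n i"
| "nerve_path C G n i (Suc l) = gcomp C G (nerve_path C G n i l) (nerve_edge C G n (i + l))"

definition nerve_of :: "('o, 'm) cat \<Rightarrow> ('o, 'm) igpd \<Rightarrow> ('o, 'm) simp_ob" where
  "nerve_of C G = \<lparr>FOb = nerve_ob C G,
     FAr = (\<lambda>\<alpha>\<in>Ar Delta. case \<alpha> of (m, n, f) \<Rightarrow>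
       nerve_tuple C G m (nerve_ob C G n)
         (\<lambda>k. nerve_vert C G n (f k))
         (\<lambda>k. nerve_path C G n (f k) (f (Suc k) - f k)))\<rparr>"

definition nerve ::
  "('o, 'm) cat \<Rightarrow>
   (('o, 'm) igpd, ('o, 'm) igpd \<times> ('o, 'm) igpd \<times> 'm \<times> 'm,
    ('o, 'm) simp_ob, ('o, 'm) simp_ar) func" where
  "nerve C = \<lparr>FOb = nerve_of C,
     FAr = (\<lambda>(G, H, f0, f1). (nerve_of C G, nerve_of C H,
       \<lambda>n. nerve_tuple C H n (nerve_ob C G n)
         (\<lambda>k. f0 \<cdot>\<^bsub>C\<^esub> nerve_vert C G n k) (\<lambda>k. f1 \<cdot>\<^bsub>C\<^esub> nerve_edge C G n k)))\<rparr>"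


section \<open>Internal abelian groups\<close>

text \<open>The ambient category is pointed, so the terminal object in the type of the neutral element
  is taken to be the zero object.\<close>

record ('o, 'm) iab =
  Acar :: 'o
  Aadd :: 'm
  Azero :: 'm
  Aneg :: 'm

definition aadd :: "('o, 'm) cat \<Rightarrow> ('o, 'm) iab \<Rightarrow> 'm \<Rightarrow> 'm \<Rightarrow> 'm" where
  "aadd C A x y = Aadd A \<cdot>\<^bsub>C\<^esub> pow_pair C (Acar A) x y"

definition internal_abelian_group :: "('o, 'm) cat \<Rightarrow> ('o, 'm) iab \<Rightarrow> bool" where
  "internal_abelian_group C A \<longleftrightarrow>
     (let a = Acar A; one = Ident C a; z = Azero A \<cdot>\<^bsub>C\<^esub> to_zero C a;
          p = pow_proj C a 2; q = pow_proj C a 3 in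
       a \<in> Ob C \<and> Aadd A \<in> Hom C (pow_ob C a 2) a \<and>
       Azero A \<in> Hom C (zero_ob C) a \<and> Aneg A \<in> Hom C a a \<and>
       aadd C A (aadd C A (q 0) (q 1)) (q 2) = aadd C A (q 0) (aadd C A (q 1) (q 2)) \<and>
       aadd C A z one = one \<and> aadd C A one z = one \<and>
       aadd C A (Aneg A) one = z \<and> aadd C A one (Aneg A) = z \<and>
       aadd C A (p 0) (p 1) = aadd C A (p 1) (p 0))"

text \<open>As for ordinary groups, an arrow preserving addition preserves zero and negatives.\<close>

definition Ab_cat ::
  "('o, 'm) cat \<Rightarrow> (('o, 'm) iab, ('o, 'm) iab \<times> ('o, 'm) iab \<times> 'm) cat" where
  "Ab_cat C = \<lparr>Ob = {A. internal_abelian_group C A},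
     Ar = {(A, B, f). internal_abelian_group C A \<and> internal_abelian_group C B \<and>
             f \<in> Hom C (Acar A) (Acar B) \<and>
             f \<cdot>\<^bsub>C\<^esub> Aadd A =
               aadd C B (f \<cdot>\<^bsub>C\<^esub> pow_proj C (Acar A) 2 0) (f \<cdot>\<^bsub>C\<^esub> pow_proj C (Acar A) 2 1)},
     Dom = (\<lambda>(A, B, f). A),
     Cod = (\<lambda>(A, B, f). B),
     Ident = (\<lambda>A. (A, A, Ident C (Acar A))),
     Comp = (\<lambda>(B, D, g) (A, B', f). (A, D, g \<cdot>\<^bsub>C\<^esub> f))\<rparr>"

text \<open>An internal abelian group as an internal groupoid whose object of objects is zero; the object
  of composable pairs is then a product of two copies of the group.\<close>

definition ab_groupoid_of :: "('o, 'm) cat \<Rightarrow> ('o, 'm) iab \<Rightarrow> ('o, 'm) igpd" where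
  "ab_groupoid_of C A =
     (let t = to_zero C (Acar A) in
      \<lparr>G0 = zero_ob C, G1 = Acar A, Gd0 = t, Gd1 = t, Gs = Azero A,
       Gm = aadd C A (pb_fst C t t) (pb_snd C t t), Gi = Aneg A\<rparr>)"

definition ab_groupoid ::
  "('o, 'm) cat \<Rightarrow>
   (('o, 'm) iab, ('o, 'm) iab \<times> ('o, 'm) iab \<times> 'm,
    ('o, 'm) igpd, ('o, 'm) igpd \<times> ('o, 'm) igpd \<times> 'm \<times> 'm) func" where
  "ab_groupoid C = \<lparr>FOb = ab_groupoid_of C,
     FAr = (\<lambda>(A, B, f). (ab_groupoid_of C A, ab_groupoid_of C B, Ident C (zero_ob C), f))\<rparr>"

end

theory Submission
  imports Defs
begin

text \<open>The nerve is a fully faithful functor from internal groupoids to simplicial objects: a map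
  into the nerve is determined by its vertices and edges, and an internal functor is recovered from
  the components in degrees \<open>0\<close> and \<open>1\<close>. An internal abelian group is the same as a groupoid on
  the zero object, which gives the second claim. For the first one, limits of simplicial objects are
  pointwise, so the unit at \<open>X\<close> is monic iff maps into each \<open>X\<^sub>n\<close> are determined by their vertices.
  If so, protomodularity forces the canonical monomorphisms \<open>X\<^sub>n\<^sub>+\<^sub>1 \<rightarrow> X\<^sub>n \<times>\<^bsub>X\<^sub>0\<^esub> X\<^sub>1\<close> to be
  invertible, because the degeneracies provide sections of their codomain that already factor
  through \<open>X\<^sub>n\<^sub>+\<^sub>1\<close>. Hence \<open>X\<close> is the nerve of the relation \<open>X\<^sub>1\<close> on \<open>X\<^sub>0\<close>, which is reflexive and
  transitive by construction and symmetric by the same argument applied to an outer horn.\<close>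

section \<open>Categories and equivalences\<close>

text \<open>Pullbacks, powers and string objects are chosen by \<open>SOME\<close>, so they need not
  be the familiar objects; even the nerve in degrees \<open>0\<close> and \<open>1\<close> agrees
  with the groupoid only up to isomorphism. Hence arguments are made with generalized elements
  \<open>x : Q \<rightarrow> A\<close>: axioms stated for a generic arrow or tuple are moved to all
  elements by precomposition, and equalities of maps into a limit are tested on its projections. The
  equivalence is built from the side of the groupoids, where the functor is explicit;
  protomodularity enters in essential surjectivity. The obstacle there is that simplices must be
  glued from edges, while separation by vertices yields only uniqueness of a filler. Protomodularity
  supplies existence, with sections given by explicit monotone maps. For symmetry one fills the horn
  whose edge \<open>01\<close> is \<open>x\<close> and whose edge \<open>02\<close> is degenerate;
  its edge \<open>12\<close> is the inverse of \<open>x\<close>. The second claim reuses full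
  faithfulness of the nerve, composed with the groupoid on the zero object attached to an abelian
  group.\<close>

lemma Hom_iff: "f \<in> Hom C a b \<longleftrightarrow> f \<in> Ar C \<and> Dom C f = a \<and> Cod C f = b"
  by (simp add: Hom_def)

context category
begin

lemma Ident_simps [simp]:
  assumes "a \<in> Ob C"
  shows "Ident C a \<in> Ar C" "Dom C (Ident C a) = a" "Cod C (Ident C a) = a"
  using Ident_Hom[OF assms] by (auto simp: Hom_iff)

lemma Comp_simps [simp]:
  assumes "f \<in> Ar C" "g \<in> Ar C" "Cod C f = Dom C g"
  shows "g \<cdot> f \<in> Ar C" "Dom C (g \<cdot> f) = Dom C f" "Cod C (g \<cdot> f) = Cod C g"
  using Comp_Hom[of f "Dom C f" "Cod C f" g "Cod C g"] assms by (auto simp: Hom_iff)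

lemma Comp_assoc_simp [simp]:
  assumes "f \<in> Ar C" "g \<in> Ar C" "h \<in> Ar C" "Cod C f = Dom C g" "Cod C g = Dom C h"
  shows "(h \<cdot> g) \<cdot> f = h \<cdot> (g \<cdot> f)"
  using Comp_assoc[of f "Dom C f" "Cod C f" g "Cod C g" h "Cod C h"] assms by (auto simp: Hom_iff)

lemma Comp_Ident_simp [simp]:
  "f \<in> Ar C \<Longrightarrow> Dom C f = a \<Longrightarrow> f \<cdot> Ident C a = f"
  using Comp_Ident[of f a "Cod C f"] by (auto simp: Hom_iff)

lemma Ident_Comp_simp [simp]:
  "f \<in> Ar C \<Longrightarrow> Cod C f = b \<Longrightarrow> Ident C b \<cdot> f = f"
  using Ident_Comp[of f "Dom C f" b] by (auto simp: Hom_iff)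

lemma Hom_Ob: "f \<in> Hom C a b \<Longrightarrow> a \<in> Ob C" "f \<in> Hom C a b \<Longrightarrow> b \<in> Ob C"
  using Dom_Ob Cod_Ob by (auto simp: Hom_iff)

text \<open>Simplification brackets composites to the right, which hides a subterm
  \<open>g \<cdot> f\<close> once something is precomposed. This form lets an equation for
  \<open>g \<cdot> f\<close> act in front of any further arrow \<open>x\<close>; most diagram chases
  below rely on it.\<close>

lemma Comp_reassoc:
  assumes "g \<cdot> f = k" "f \<in> Hom C a b" "g \<in> Hom C b c" "x \<in> Ar C" "Cod C x = a"
  shows "g \<cdot> (f \<cdot> x) = k \<cdot> x"
  using assms by (auto simp: Hom_iff simp flip: assms(1))

lemma iso_arrI:
  assumes "f \<in> Hom C a b" "g \<in> Hom C b a" "g \<cdot> f = Ident C a" "f \<cdot> g = Ident C b"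
  shows "iso_arr C f"
  using assms by (auto simp: iso_arr_def Hom_iff)

lemma iso_arrE:
  assumes "iso_arr C f" "f \<in> Hom C a b"
  obtains g where "g \<in> Hom C b a" "g \<cdot> f = Ident C a" "f \<cdot> g = Ident C b"
  using assms by (auto simp: iso_arr_def Hom_iff)

lemma iso_arr_Ident: "a \<in> Ob C \<Longrightarrow> iso_arr C (Ident C a)"
  by (rule iso_arrI[of _ a a "Ident C a"]) (auto simp: Hom_iff)

end

lemma category_op_cat: "category C \<Longrightarrow> category (op_cat C)"
  by (simp add: category_def op_cat_def Hom_def)

lemma category_full_subcategory: "category C \<Longrightarrow> category (full_subcategory C S)"
  by (auto simp: category_def full_subcategory_def Hom_def)

lemma Hom_full_subcategory:
  "a \<in> S \<Longrightarrow> b \<in> S \<Longrightarrow> Hom (full_subcategory C S) a b = Hom C a b"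
  by (auto simp: full_subcategory_def Hom_def)

lemma Comp_full_subcategory [simp]: "g \<cdot>\<^bsub>full_subcategory C S\<^esub> f = g \<cdot>\<^bsub>C\<^esub> f"
  and Ident_full_subcategory [simp]: "Ident (full_subcategory C S) a = Ident C a"
  and Ob_full_subcategory [simp]: "Ob (full_subcategory C S) = Ob C \<inter> S"
  by (simp_all add: full_subcategory_def)

lemma iso_arr_full_subcategory:
  "iso_arr C f \<Longrightarrow> Dom C f \<in> S \<Longrightarrow> Cod C f \<in> S \<Longrightarrow> iso_arr (full_subcategory C S) f"
  by (auto simp: iso_arr_def full_subcategory_def Hom_def)

text \<open>Hom sets of a full subcategory are those of the ambient category, so only the passage of
  objects from \<open>S\<close> into \<open>T\<close> has to be supplied.\<close>

lemma fully_faithful_full_subcategory: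
  assumes "fully_faithful C D F" "category C"
    and "\<And>a. a \<in> Ob C \<Longrightarrow> a \<in> S \<Longrightarrow> FOb F a \<in> T"
  shows "fully_faithful (full_subcategory C S) (full_subcategory D T) F"
proof -
  interpret category C by fact
  have "is_functor (full_subcategory C S) (full_subcategory D T) F"
    using assms(1,3) Dom_Ob Cod_Ob
    by (auto simp: fully_faithful_def is_functor_def full_subcategory_def Hom_def)
  moreover have "Hom (full_subcategory C S) a b = Hom C a b"
    "Hom (full_subcategory D T) (FOb F a) (FOb F b) = Hom D (FOb F a) (FOb F b)"
    if "a \<in> Ob C \<inter> S" "b \<in> Ob C \<inter> S" for a b
    using that assms(3) by (auto simp: Hom_full_subcategory)
  ultimately show ?thesis
    using assms(1) by (simp add: fully_faithful_def)
qed

lemma fully_faithful_into_full_subcategory: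
  assumes "fully_faithful C D F" "category C" "\<And>a. a \<in> Ob C \<Longrightarrow> FOb F a \<in> T"
  shows "fully_faithful C (full_subcategory D T) F"
proof -
  \<comment> \<open>Restricting the source to all objects changes nothing, so the two-sided lemma
    applies.\<close>
  have "full_subcategory C UNIV = C"
    by (simp add: full_subcategory_def)
  then show ?thesis
    using fully_faithful_full_subcategory[of C D F UNIV T] assms by simp
qed

lemma fully_faithful_comp_func:
  assumes F: "fully_faithful C D F" and G: "fully_faithful D E G" and "category C"
  shows "fully_faithful C E (comp_func G F)"
proof -
  interpret category C by fact
  have "is_functor C E (comp_func G F)"
    using F G by (auto simp: fully_faithful_def is_functor_def comp_func_def Hom_def)
  moreover have "bij_betw (FAr G \<circ> FAr F) (Hom C a b) (Hom E (FOb G (FOb F a)) (FOb G (FOb F b)))"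
    if "a \<in> Ob C" "b \<in> Ob C" for a b
    using F G that by (intro bij_betw_trans) (auto simp: fully_faithful_def is_functor_def)
  ultimately show ?thesis
    by (simp add: fully_faithful_def comp_func_def)
qed

text \<open>The quasi-inverse sends \<open>c\<close> to a chosen \<open>FOb H c\<close> whose image under \<open>N\<close> is isomorphic
  to \<open>c\<close>, and an arrow to the unique preimage of its conjugate by the chosen isomorphisms.\<close>

lemma equivalent_categories_if_fully_faithful:
  assumes C: "category C" and D: "category D" and N: "fully_faithful D C N"
    and eso: "\<And>c. c \<in> Ob C \<Longrightarrow> \<exists>d \<in> Ob D. isomorphic C (FOb N d) c"
  shows "equivalent_categories C D"
proof -
  interpret C: category C by fact
  interpret D: category D by fact
  have NOb: "FOb N d \<in> Ob C" if "d \<in> Ob D" for d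
    using N that by (auto simp: fully_faithful_def is_functor_def)
  have NAr: "FAr N f \<in> Ar C" "Dom C (FAr N f) = FOb N (Dom D f)" "Cod C (FAr N f) = FOb N (Cod D f)"
    if "f \<in> Ar D" for f
    using N that by (auto simp: fully_faithful_def is_functor_def Hom_iff)
  have NId: "FAr N (Ident D d) = Ident C (FOb N d)" if "d \<in> Ob D" for d
    using N that by (auto simp: fully_faithful_def is_functor_def)
  have NComp: "FAr N (g \<cdot>\<^bsub>D\<^esub> f) = FAr N g \<cdot>\<^bsub>C\<^esub> FAr N f"
    if "f \<in> Ar D" "g \<in> Ar D" "Cod D f = Dom D g" for f g
    using N that by (auto simp: fully_faithful_def is_functor_def)
  have inj: "f = g" if "f \<in> Ar D" "g \<in> Ar D" "Dom D f = Dom D g" "Cod D f = Cod D g"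
    "FAr N f = FAr N g" for f g
  proof -
    have "inj_on (FAr N) (Hom D (Dom D f) (Cod D f))"
      using N D.Dom_Ob[OF that(1)] D.Cod_Ob[OF that(1)]
      by (auto simp: fully_faithful_def bij_betw_def)
    then show ?thesis using that by (auto simp: inj_on_def Hom_iff)
  qed
  have full: "\<exists>f. f \<in> Ar D \<and> Dom D f = a \<and> Cod D f = b \<and> FAr N f = k"
    if "k \<in> Ar C" "a \<in> Ob D" "b \<in> Ob D" "Dom C k = FOb N a" "Cod C k = FOb N b" for k a b
  proof -
    have "k \<in> FAr N ` Hom D a b"
      using N that by (auto simp: fully_faithful_def bij_betw_def Hom_iff)
    then show ?thesis by (auto simp: Hom_iff)
  qed
  have "\<forall>c. \<exists>d e e'. c \<in> Ob C \<longrightarrow> d \<in> Ob D \<and> e \<in> Hom C (FOb N d) c \<and> e' \<in> Hom C c (FOb N d) \<and>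
     e' \<cdot>\<^bsub>C\<^esub> e = Ident C (FOb N d) \<and> e \<cdot>\<^bsub>C\<^esub> e' = Ident C c"
    using eso by (force simp: isomorphic_def iso_arr_def Hom_iff)
  then obtain h e e' where *: "\<And>c. c \<in> Ob C \<Longrightarrow> h c \<in> Ob D \<and> e c \<in> Hom C (FOb N (h c)) c \<and>
     e' c \<in> Hom C c (FOb N (h c)) \<and> e' c \<cdot>\<^bsub>C\<^esub> e c = Ident C (FOb N (h c)) \<and>
     e c \<cdot>\<^bsub>C\<^esub> e' c = Ident C c"
    by metis
  then have h [simp]: "h c \<in> Ob D"
    and e [simp]: "e c \<in> Ar C" "Dom C (e c) = FOb N (h c)" "Cod C (e c) = c"
    and e' [simp]: "e' c \<in> Ar C" "Dom C (e' c) = c" "Cod C (e' c) = FOb N (h c)"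
    and ee' [simp]: "e' c \<cdot>\<^bsub>C\<^esub> e c = Ident C (FOb N (h c))" "e c \<cdot>\<^bsub>C\<^esub> e' c = Ident C c"
    if "c \<in> Ob C" for c using that by (auto simp: Hom_iff)
  have [simp]: "e' c \<cdot>\<^bsub>C\<^esub> (e c \<cdot>\<^bsub>C\<^esub> x) = x"
    if "c \<in> Ob C" "x \<in> Ar C" "Cod C x = FOb N (h c)" for c x
    using that C.Comp_reassoc[OF ee'(1)[OF that(1)]] by (simp add: Hom_iff)
  have [simp]: "e c \<cdot>\<^bsub>C\<^esub> (e' c \<cdot>\<^bsub>C\<^esub> x) = x"
    if "c \<in> Ob C" "x \<in> Ar C" "Cod C x = c" for c x
    using that C.Comp_reassoc[OF ee'(2)[OF that(1)]] by (simp add: Hom_iff)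
  have [simp]: "FOb N d \<in> Ob C" if "d \<in> Ob D" for d
    using NOb that .
  have [simp]: "Dom C f \<in> Ob C" "Cod C f \<in> Ob C" if "f \<in> Ar C" for f
    using that C.Dom_Ob C.Cod_Ob by auto
  have [simp]: "Dom D f \<in> Ob D" "Cod D f \<in> Ob D" if "f \<in> Ar D" for f
    using that D.Dom_Ob D.Cod_Ob by auto
  note [simp] = NAr NId NComp
  define k where "k f = (SOME k. k \<in> Ar D \<and> Dom D k = h (Dom C f) \<and> Cod D k = h (Cod C f) \<and>
     FAr N k = e' (Cod C f) \<cdot>\<^bsub>C\<^esub> (f \<cdot>\<^bsub>C\<^esub> e (Dom C f)))" for f
  have k: "k f \<in> Ar D \<and> Dom D (k f) = h (Dom C f) \<and> Cod D (k f) = h (Cod C f) \<and>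
     FAr N (k f) = e' (Cod C f) \<cdot>\<^bsub>C\<^esub> (f \<cdot>\<^bsub>C\<^esub> e (Dom C f))" if "f \<in> Ar C" for f
    unfolding k_def by (rule someI_ex, rule full) (use that in auto)
  then have k [simp]: "k f \<in> Ar D" "Dom D (k f) = h (Dom C f)" "Cod D (k f) = h (Cod C f)"
     "FAr N (k f) = e' (Cod C f) \<cdot>\<^bsub>C\<^esub> (f \<cdot>\<^bsub>C\<^esub> e (Dom C f))" if "f \<in> Ar C" for f
    using that by auto
  define H where "H = \<lparr>FOb = h, FAr = k\<rparr>"
  \<comment> \<open>Both functor laws are compared after applying \<open>N\<close>, where they hold
    because \<open>e\<close> and \<open>e'\<close> cancel; \<open>inj\<close> brings them back to
    \<open>D\<close>.\<close>
  have H: "is_functor C D H"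
    by (auto simp: H_def is_functor_def Hom_iff intro!: inj)
  have "naturally_isomorphic C C id_func (comp_func N H)"
    unfolding naturally_isomorphic_def is_nat_trans_def
  proof (intro exI[of _ e'] conjI ballI)
    show "iso_arr C (e' c)" if "c \<in> Ob C" for c
      using that by (intro C.iso_arrI[of "e' c" c "FOb N (h c)" "e c"]) (auto simp: Hom_iff)
  qed (auto simp: H_def comp_func_def id_func_def Hom_iff)
  moreover have "naturally_isomorphic D D (comp_func H N) id_func"
  proof -
    \<comment> \<open>The counit at \<open>d\<close> is the arrow of \<open>D\<close> lying over the
      chosen isomorphism \<open>e (FOb N d)\<close>, and \<open>t'\<close> lies over its inverse.
      Injectivity on hom sets reflects the inverse laws and naturality.\<close>
    define t where "t d = (SOME t. t \<in> Ar D \<and> Dom D t = h (FOb N d) \<and> Cod D t = d \<and>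
      FAr N t = e (FOb N d))" for d
    define t' where "t' d = (SOME t. t \<in> Ar D \<and> Dom D t = d \<and> Cod D t = h (FOb N d) \<and>
      FAr N t = e' (FOb N d))" for d
    have "t d \<in> Ar D \<and> Dom D (t d) = h (FOb N d) \<and> Cod D (t d) = d \<and> FAr N (t d) = e (FOb N d)"
      "t' d \<in> Ar D \<and> Dom D (t' d) = d \<and> Cod D (t' d) = h (FOb N d) \<and> FAr N (t' d) = e' (FOb N d)"
      if "d \<in> Ob D" for d
      unfolding t_def t'_def by (rule someI_ex, rule full; use that in auto)+
    then have [simp]: "t d \<in> Ar D" "Dom D (t d) = h (FOb N d)" "Cod D (t d) = d"
      "FAr N (t d) = e (FOb N d)" "t' d \<in> Ar D" "Dom D (t' d) = d" "Cod D (t' d) = h (FOb N d)"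
      "FAr N (t' d) = e' (FOb N d)" if "d \<in> Ob D" for d using that by auto
    show ?thesis
      unfolding naturally_isomorphic_def is_nat_trans_def
    proof (intro exI[of _ t] conjI ballI)
      show "iso_arr D (t d)" if "d \<in> Ob D" for d
        using that by (intro D.iso_arrI[of "t d" "h (FOb N d)" d "t' d"])
          (auto simp: Hom_iff intro!: inj)
    qed (auto simp: H_def comp_func_def id_func_def Hom_iff intro!: inj)
  qed
  moreover have "is_functor D C N"
    using N by (simp add: fully_faithful_def)
  ultimately show ?thesis
    using H by (auto simp: equivalent_categories_def)
qed

section \<open>Functor categories and finite limits\<close>

lemma Ob_functor_category:
  "Ob (functor_category C D) =
     {F. is_functor C D F \<and> FOb F \<in> extensional (Ob C) \<and> FAr F \<in> extensional (Ar C)}"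
  by (simp add: functor_category_def Let_def)

lemma Hom_functor_category:
  "f \<in> Hom (functor_category C D) F G \<longleftrightarrow> F \<in> Ob (functor_category C D) \<and>
     G \<in> Ob (functor_category C D) \<and>
     (\<exists>\<tau>. f = (F, G, \<tau>) \<and> is_nat_trans C D F G \<tau> \<and> \<tau> \<in> extensional (Ob C))"
  by (auto simp: functor_category_def Let_def Hom_def)

lemma Comp_functor_category [simp]:
  "(G, H, \<sigma>) \<cdot>\<^bsub>functor_category C D\<^esub> (F, G', \<tau>) = (F, H, \<lambda>a\<in>Ob C. \<sigma> a \<cdot>\<^bsub>D\<^esub> \<tau> a)"
  by (simp add: functor_category_def Let_def)

lemma Ident_functor_category [simp]:
  "Ident (functor_category C D) F = (F, F, \<lambda>a\<in>Ob C. Ident D (FOb F a))"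
  by (simp add: functor_category_def Let_def)

lemma is_functor_simps:
  assumes "is_functor C D F"
  shows "a \<in> Ob C \<Longrightarrow> FOb F a \<in> Ob D"
    and "f \<in> Ar C \<Longrightarrow> FAr F f \<in> Ar D"
    and "f \<in> Ar C \<Longrightarrow> Dom D (FAr F f) = FOb F (Dom C f)"
    and "f \<in> Ar C \<Longrightarrow> Cod D (FAr F f) = FOb F (Cod C f)"
  using assms by (auto simp: is_functor_def Hom_iff)

lemma is_nat_trans_simps:
  assumes "is_nat_trans C D F G \<tau>" "a \<in> Ob C"
  shows "\<tau> a \<in> Ar D" "Dom D (\<tau> a) = FOb F a" "Cod D (\<tau> a) = FOb G a"
  using assms by (auto simp: is_nat_trans_def Hom_iff)

lemma is_nat_trans_natural:
  assumes "is_nat_trans C D F G \<tau>" "f \<in> Ar C" "Dom C f = a" "Cod C f = b"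
  shows "\<tau> b \<cdot>\<^bsub>D\<^esub> FAr F f = FAr G f \<cdot>\<^bsub>D\<^esub> \<tau> a"
  using assms by (auto simp: is_nat_trans_def)

lemma (in category) is_nat_trans_comp:
  assumes J: "category J" and F: "is_functor J C F" and G: "is_functor J C G"
    and H: "is_functor J C H"
    and \<tau>: "is_nat_trans J C F G \<tau>" and \<sigma>: "is_nat_trans J C G H \<sigma>"
  shows "is_nat_trans J C F H (\<lambda>a\<in>Ob J. \<sigma> a \<cdot> \<tau> a)"
proof -
  interpret J: category J by fact
  note [simp] = J.Dom_Ob J.Cod_Ob is_functor_simps[OF F] is_functor_simps[OF G]
    is_functor_simps[OF H] is_nat_trans_simps[OF \<tau>] is_nat_trans_simps[OF \<sigma>]
  have "\<sigma> (Cod J f) \<cdot> (\<tau> (Cod J f) \<cdot> FAr F f) = FAr H f \<cdot> (\<sigma> (Dom J f) \<cdot> \<tau> (Dom J f))"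
    if f: "f \<in> Ar J" for f
  proof -
    have "\<sigma> (Cod J f) \<cdot> (\<tau> (Cod J f) \<cdot> FAr F f) = (\<sigma> (Cod J f) \<cdot> FAr G f) \<cdot> \<tau> (Dom J f)"
      using f by (simp add: is_nat_trans_natural[OF \<tau> f])
    also have "\<dots> = FAr H f \<cdot> (\<sigma> (Dom J f) \<cdot> \<tau> (Dom J f))"
      using f by (simp add: is_nat_trans_natural[OF \<sigma> f])
    finally show ?thesis .
  qed
  then show ?thesis
    by (auto simp: is_nat_trans_def Hom_iff)
qed

lemma (in category) is_nat_trans_Ident:
  assumes J: "category J" and F: "is_functor J C F"
  shows "is_nat_trans J C F F (\<lambda>a\<in>Ob J. Ident C (FOb F a))"
proof -
  interpret J: category J by fact
  show ?thesis
    using is_functor_simps[OF F] J.Dom_Ob J.Cod_Ob by (auto simp: is_nat_trans_def Hom_iff)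
qed

lemma category_functor_category:
  assumes J: "category J" and C: "category C"
  shows "category (functor_category J C)"
proof -
  interpret J: category J by fact
  interpret category C by fact
  let ?F = "functor_category J C"
  show ?thesis
  proof
    fix f assume "f \<in> Ar ?F"
    then show "Dom ?F f \<in> Ob ?F" "Cod ?F f \<in> Ob ?F"
      by (auto simp: functor_category_def Let_def)
  next
    fix F assume "F \<in> Ob ?F"
    then show "Ident ?F F \<in> Hom ?F F F"
      using is_nat_trans_Ident[OF J] by (auto simp: Hom_functor_category Ob_functor_category)
  next
    fix f g F G H assume "f \<in> Hom ?F F G" "g \<in> Hom ?F G H"
    then show "g \<cdot>\<^bsub>?F\<^esub> f \<in> Hom ?F F H"
      using is_nat_trans_comp[OF J] by (auto simp: Hom_functor_category Ob_functor_category)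
  next
    fix f F G assume "f \<in> Hom ?F F G"
    then show "f \<cdot>\<^bsub>?F\<^esub> Ident ?F F = f" "Ident ?F G \<cdot>\<^bsub>?F\<^esub> f = f"
      by (auto simp: Hom_functor_category Ob_functor_category is_nat_trans_simps
          intro!: extensionalityI[of _ "Ob J"])
  next
    fix f g h F G H K assume "f \<in> Hom ?F F G" "g \<in> Hom ?F G H" "h \<in> Hom ?F H K"
    then show "(h \<cdot>\<^bsub>?F\<^esub> g) \<cdot>\<^bsub>?F\<^esub> f = h \<cdot>\<^bsub>?F\<^esub> (g \<cdot>\<^bsub>?F\<^esub> f)"
      by (auto simp: Hom_functor_category Ob_functor_category is_nat_trans_simps
          intro!: extensionalityI[of _ "Ob J"])
  qed
qed

text \<open>Pointwise inverses are automatically natural: composing a naturality square of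
  \<open>\<tau>\<close> with the inverses on both sides gives the square of \<open>\<sigma>\<close>.
  The restriction of \<open>\<sigma>\<close> to the objects is what makes it an arrow of the functor
  category.\<close>

lemma (in category) iso_arr_functor_category:
  assumes J: "category J" and f: "(F, G, \<tau>) \<in> Hom (functor_category J C) F G"
    and iso: "\<And>a. a \<in> Ob J \<Longrightarrow> iso_arr C (\<tau> a)"
  shows "iso_arr (functor_category J C) (F, G, \<tau>)"
proof -
  interpret J: category J by fact
  have F: "is_functor J C F" and G: "is_functor J C G" and \<tau>: "is_nat_trans J C F G \<tau>"
    using f by (auto simp: Hom_functor_category Ob_functor_category)
  have "\<forall>a. \<exists>s. a \<in> Ob J \<longrightarrow> s \<in> Hom C (FOb G a) (FOb F a) \<and> s \<cdot> \<tau> a = Ident C (FOb F a) \<and>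
     \<tau> a \<cdot> s = Ident C (FOb G a)"
    using iso is_nat_trans_simps[OF \<tau>] by (fastforce simp: iso_arr_def)
  then obtain \<sigma> where \<sigma>: "\<And>a. a \<in> Ob J \<Longrightarrow> \<sigma> a \<in> Hom C (FOb G a) (FOb F a) \<and>
      \<sigma> a \<cdot> \<tau> a = Ident C (FOb F a) \<and> \<tau> a \<cdot> \<sigma> a = Ident C (FOb G a)"
    by metis
  then have \<sigma>_simps: "\<sigma> a \<in> Ar C" "Dom C (\<sigma> a) = FOb G a" "Cod C (\<sigma> a) = FOb F a"
    "\<sigma> a \<cdot> \<tau> a = Ident C (FOb F a)" "\<tau> a \<cdot> \<sigma> a = Ident C (FOb G a)"
    if "a \<in> Ob J" for a using that by (auto simp: Hom_iff)
  note [simp] = \<sigma>_simps is_nat_trans_simps[OF \<tau>] is_functor_simps[OF F] is_functor_simps[OF G]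
    J.Dom_Ob J.Cod_Ob
  have "\<sigma> (Cod J u) \<cdot> FAr G u = FAr F u \<cdot> \<sigma> (Dom J u)" if u: "u \<in> Ar J" for u
  proof -
    have "\<sigma> (Cod J u) \<cdot> FAr G u = \<sigma> (Cod J u) \<cdot> ((FAr G u \<cdot> \<tau> (Dom J u)) \<cdot> \<sigma> (Dom J u))"
      using u by simp
    also have "\<dots> = (\<sigma> (Cod J u) \<cdot> \<tau> (Cod J u)) \<cdot> (FAr F u \<cdot> \<sigma> (Dom J u))"
      using u by (simp add: is_nat_trans_natural[OF \<tau> u refl refl, symmetric] del: \<sigma>_simps(4,5))
    finally show ?thesis using u by simp
  qed
  then have "is_nat_trans J C G F (restrict \<sigma> (Ob J))"
    by (auto simp: is_nat_trans_def Hom_iff)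
  then have "(G, F, restrict \<sigma> (Ob J)) \<in> Hom (functor_category J C) G F"
    using f by (auto simp: Hom_functor_category)
  moreover have "Dom (functor_category J C) (F, G, \<tau>) = F" "Cod (functor_category J C) (F, G, \<tau>) =
      G"
    by (simp_all add: functor_category_def Let_def)
  ultimately show ?thesis
    using f by (auto simp: iso_arr_def Hom_iff intro!: bexI[of _ "(G, F, restrict \<sigma> (Ob J))"]
      extensionalityI[of _ "Ob J"])
qed

section \<open>Chosen finite limits and their calculus on generalized elements\<close>

locale lex_category = category +
  assumes lex: "finitely_complete C"
begin

lemma ex_pullback:
  assumes f: "f \<in> Hom C a c" and g: "g \<in> Hom C b c"
  shows "\<exists>P x y. is_pullback C f g P x y"
proof -
  note [simp] = f[unfolded Hom_iff, THEN conjunct1] g[unfolded Hom_iff, THEN conjunct1]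
  have [simp]: "Dom C f = a" "Cod C f = c" "Dom C g = b" "Cod C g = c"
    using f g by (auto simp: Hom_iff)
  have [simp]: "a \<in> Ob C" "b \<in> Ob C" "c \<in> Ob C"
    using Hom_Ob[OF f] Hom_Ob[OF g] by auto
  \<comment> \<open>The cospan shape: \<open>0\<close>, \<open>1\<close>, \<open>2\<close> are the
    objects and their identities, and the arrows \<open>3 : 0 \<rightarrow> 2\<close> and
    \<open>4 : 1 \<rightarrow> 2\<close> carry \<open>f\<close> and \<open>g\<close>. Domains are
    residues modulo \<open>3\<close>, codomains are truncations at \<open>2\<close>. In a composite
    one factor is an identity, and \<open>max\<close> returns the other.\<close>
  define J :: "(nat, nat) cat" where "J = \<lparr>Ob = {0, 1, 2}, Ar = {0, 1, 2, 3, 4},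
    Dom = (\<lambda>u. u mod 3), Cod = min 2, Ident = (\<lambda>u. u), Comp = max\<rparr>"
  define D :: "(nat, nat, 'a, 'b) func" where "D = \<lparr>FOb = (\<lambda>j. if j = 0 then a else if j =
      1 then b else c),
    FAr = (\<lambda>u. if u = 3 then f else if u = 4 then g else
       Ident C (if u = 0 then a else if u = 1 then b else c))\<rparr>"
  have "category J"
  proof
    show "v \<cdot>\<^bsub>J\<^esub> u \<in> Hom J i k" if "u \<in> Hom J i j" "v \<in> Hom J j k" for u v i j k
      using that by (auto simp: J_def Hom_def)
  qed (auto simp: J_def Hom_def)
  moreover have "is_functor J C D"
    unfolding is_functor_def
  proof (intro conjI ballI impI)
    show "FAr D (v \<cdot>\<^bsub>J\<^esub> u) = FAr D v \<cdot> FAr D u"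
      if "u \<in> Ar J" "v \<in> Ar J" "Dom J v = Cod J u" for u v
    proof -
      have "(u, v) \<in> {(0, 0), (0, 3), (1, 1), (1, 4), (2, 2), (3, 2), (4, 2)}"
        using that by (simp add: J_def) presburger
      then show ?thesis
        by (elim insertE emptyE; simp add: J_def D_def)
    qed
  qed (auto simp: J_def D_def Hom_iff)
  moreover have "finite (Ob J)" "finite (Ar J)"
    by (auto simp: J_def)
  ultimately obtain L p where L: "is_limit J C D L p"
    using lex unfolding finitely_complete_def by blast
  have cone: "is_cone J C D Q q \<longleftrightarrow> Q \<in> Ob C \<and> q 0 \<in> Hom C Q a \<and> q 1 \<in> Hom C Q b \<and>
    q 2 \<in> Hom C Q c \<and> f \<cdot> q 0 = q 2 \<and> g \<cdot> q 1 = q 2" for Q q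
    by (auto simp: is_cone_def J_def D_def Hom_iff)
  have "is_pullback C f g L (p 0) (p 1)"
    unfolding is_pullback_def
  proof (intro conjI allI ballI impI)
    show "p 0 \<in> Hom C L (Dom C f)" "p 1 \<in> Hom C L (Dom C g)" "f \<cdot> p 0 = g \<cdot> p 1"
      using L by (auto simp: is_limit_def cone)
  next
    fix q x y assume xy: "x \<in> Hom C q (Dom C f)" "y \<in> Hom C q (Dom C g)" "f \<cdot> x = g \<cdot> y"
    let ?q = "\<lambda>j::nat. if j = 0 then x else if j = 1 then y else f \<cdot> x"
    have "is_cone J C D q ?q"
      using xy Hom_Ob[OF xy(1)] by (auto simp: cone Hom_iff)
    then have *: "\<exists>!h. h \<in> Hom C q L \<and> (\<forall>j\<in>Ob J. p j \<cdot> h = ?q j)"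
      using L by (auto simp: is_limit_def)
    \<comment> \<open>The leg at \<open>2\<close> is determined by the leg at \<open>0\<close>,
      hence adds no condition on \<open>h\<close>.\<close>
    have "f \<cdot> p 0 = p 2" "p 0 \<in> Hom C L a"
      using L by (auto simp: is_limit_def cone)
    then have "(\<forall>j\<in>Ob J. p j \<cdot> h = ?q j) \<longleftrightarrow> p 0 \<cdot> h = x \<and> p 1 \<cdot> h = y" if "h \<in> Hom C q L" for h
      using that Comp_reassoc[of f "p 0" "p 2" L a c h] f by (auto simp: J_def Hom_iff)
    then show "\<exists>!h. h \<in> Hom C q L \<and> p 0 \<cdot> h = x \<and> p 1 \<cdot> h = y"
      using * by (smt (verit))
  qed auto
  then show ?thesis by blast
qed

lemma ex_power:
  assumes A: "A \<in> Ob C"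
  shows "\<exists>P p. is_power C A k P p"
proof -
  \<comment> \<open>The discrete category on \<open>k\<close> objects, whose cones are just families
    of \<open>k\<close> arrows.\<close>
  define J :: "(nat, nat) cat" where "J = \<lparr>Ob = {..<k}, Ar = {..<k}, Dom = (\<lambda>u. u),
    Cod = (\<lambda>u. u), Ident = (\<lambda>u. u), Comp = (\<lambda>v u. u)\<rparr>"
  define D :: "(nat, nat, 'a, 'b) func" where "D = \<lparr>FOb = (\<lambda>j. A), FAr = (\<lambda>u. Ident C A)\<rparr>"
  have "category J"
    by unfold_locales (auto simp: J_def Hom_def)
  moreover have "is_functor J C D"
    using A by (auto simp: is_functor_def J_def D_def Hom_iff)
  moreover have "finite (Ob J)" "finite (Ar J)"
    by (auto simp: J_def)
  ultimately obtain L p where L: "is_limit J C D L p"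
    using lex unfolding finitely_complete_def by blast
  have "is_cone J C D Q q \<longleftrightarrow> Q \<in> Ob C \<and> (\<forall>i<k. q i \<in> Hom C Q A)" for Q q
    by (auto simp: is_cone_def J_def D_def Hom_iff)
  then have "is_power C A k L p"
    using L unfolding is_limit_def is_power_def by (simp add: J_def Ball_def)
  then show ?thesis by blast
qed

lemma pb_is_pullback:
  assumes "f \<in> Hom C a c" "g \<in> Hom C b c"
  shows "is_pullback C f g (pb_ob C f g) (pb_fst C f g) (pb_snd C f g)"
proof -
  have "case pb C f g of (P, x, y) \<Rightarrow> is_pullback C f g P x y"
    unfolding pb_def by (rule someI_ex) (use ex_pullback[OF assms] in auto)
  then show ?thesis
    by (simp add: pb_ob_def pb_fst_def pb_snd_def split: prod.splits)
qed

lemma pb_simps: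
  assumes "f \<in> Hom C a c" "g \<in> Hom C b c"
  shows "pb_fst C f g \<in> Hom C (pb_ob C f g) a" "pb_snd C f g \<in> Hom C (pb_ob C f g) b"
    "f \<cdot> pb_fst C f g = g \<cdot> pb_snd C f g"
  using pb_is_pullback[OF assms] assms by (auto simp: is_pullback_def Hom_iff)

lemma pb_pair_simps:
  assumes fg: "f \<in> Hom C a c" "g \<in> Hom C b c"
    and xy: "x \<in> Hom C q a" "y \<in> Hom C q b" "f \<cdot> x = g \<cdot> y"
  shows "pb_pair C f g x y \<in> Hom C q (pb_ob C f g)"
    "pb_fst C f g \<cdot> pb_pair C f g x y = x" "pb_snd C f g \<cdot> pb_pair C f g x y = y"
proof -
  have "\<exists>!h. h \<in> Hom C q (pb_ob C f g) \<and> pb_fst C f g \<cdot> h = x \<and> pb_snd C f g \<cdot> h = y"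
    using pb_is_pullback[OF fg] fg xy by (auto simp: is_pullback_def Hom_iff)
  moreover have "Dom C x = q"
    using xy by (simp add: Hom_iff)
  ultimately have "pb_pair C f g x y \<in> Hom C q (pb_ob C f g) \<and>
    pb_fst C f g \<cdot> pb_pair C f g x y = x \<and> pb_snd C f g \<cdot> pb_pair C f g x y = y"
    unfolding pb_pair_def using theI'[of "\<lambda>h. h \<in> Hom C q (pb_ob C f g) \<and>
      pb_fst C f g \<cdot> h = x \<and> pb_snd C f g \<cdot> h = y"] by simp
  then show "pb_pair C f g x y \<in> Hom C q (pb_ob C f g)"
    "pb_fst C f g \<cdot> pb_pair C f g x y = x" "pb_snd C f g \<cdot> pb_pair C f g x y = y"
    by auto
qed

text \<open>Both \<open>h\<close> and \<open>h'\<close> fill the same cone, so uniqueness in the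
  universal property makes the projections jointly monic.\<close>

lemma is_pullback_ext:
  assumes P: "is_pullback C f g P a b" and h: "h \<in> Hom C q P" "h' \<in> Hom C q P"
    and eq: "a \<cdot> h = a \<cdot> h'" "b \<cdot> h = b \<cdot> h'"
  shows "h = h'"
proof -
  have ab: "a \<in> Hom C P (Dom C f)" "b \<in> Hom C P (Dom C g)" "f \<cdot> a = g \<cdot> b" "f \<in> Ar C" "g \<in> Ar C"
    using P by (auto simp: is_pullback_def)
  have "f \<cdot> (a \<cdot> h) = g \<cdot> (b \<cdot> h)"
    using Comp_reassoc[OF ab(3,1)] ab h by (auto simp: Hom_iff)
  moreover have "a \<cdot> h \<in> Hom C q (Dom C f)" "b \<cdot> h \<in> Hom C q (Dom C g)"
    using ab h by (auto simp: Hom_iff)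
  ultimately have "\<exists>!k. k \<in> Hom C q P \<and> a \<cdot> k = a \<cdot> h \<and> b \<cdot> k = b \<cdot> h"
    using P by (simp add: is_pullback_def)
  then show ?thesis
    using h eq by metis
qed

lemma pb_ext:
  assumes "f \<in> Hom C a c" "g \<in> Hom C b c" "h \<in> Hom C q (pb_ob C f g)" "h' \<in> Hom C q (pb_ob C f g)"
    "pb_fst C f g \<cdot> h = pb_fst C f g \<cdot> h'" "pb_snd C f g \<cdot> h = pb_snd C f g \<cdot> h'"
  shows "h = h'"
  using is_pullback_ext[OF pb_is_pullback] assms by blast

text \<open>Both sides have the same projections. This naturality of pairing is what makes
  composition in a groupoid stable under change of the element domain.\<close>

lemma pb_pair_comp:
  assumes fg: "f \<in> Hom C a c" "g \<in> Hom C b c"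
    and xy: "x \<in> Hom C q a" "y \<in> Hom C q b" "f \<cdot> x = g \<cdot> y" and h: "h \<in> Hom C r q"
  shows "pb_pair C f g x y \<cdot> h = pb_pair C f g (x \<cdot> h) (y \<cdot> h)"
proof -
  have "x \<cdot> h \<in> Hom C r a" "y \<cdot> h \<in> Hom C r b" "f \<cdot> (x \<cdot> h) = g \<cdot> (y \<cdot> h)"
    using fg xy h Comp_reassoc[OF xy(3,1) fg(1), of h] by (auto simp: Hom_iff)
  note 1 = pb_pair_simps[OF fg xy] and 2 = pb_pair_simps[OF fg this] and 3 = pb_simps[OF fg]
  show ?thesis
    by (rule pb_ext[OF fg, of _ r])
      (use 1 2 3 h Comp_reassoc[OF 1(2,1) 3(1)]
          Comp_reassoc[OF 1(3,1) 3(2)] in \<open>auto simp: Hom_iff\<close>)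
qed

lemma pow_is_power:
  assumes "A \<in> Ob C"
  shows "is_power C A k (pow_ob C A k) (pow_proj C A k)"
proof -
  have "case pow C A k of (P, p) \<Rightarrow> is_power C A k P p"
    unfolding pow_def by (rule someI_ex) (use ex_power[OF assms] in auto)
  then show ?thesis
    by (simp add: pow_ob_def pow_proj_def split: prod.splits)
qed

lemma pow_ob_Ob [simp]: "A \<in> Ob C \<Longrightarrow> pow_ob C A k \<in> Ob C"
  using pow_is_power[of A k] by (auto simp: is_power_def)

lemma pow_proj_Hom: "A \<in> Ob C \<Longrightarrow> i < k \<Longrightarrow> pow_proj C A k i \<in> Hom C (pow_ob C A k) A"
  using pow_is_power[of A k] by (auto simp: is_power_def)

lemma pow_tuple_simps:
  assumes "A \<in> Ob C" "Q \<in> Ob C" "\<And>i. i < k \<Longrightarrow> x i \<in> Hom C Q A"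
  shows "pow_tuple C Q A k x \<in> Hom C Q (pow_ob C A k)"
    "i < k \<Longrightarrow> pow_proj C A k i \<cdot> pow_tuple C Q A k x = x i"
proof -
  have "\<exists>!h. h \<in> Hom C Q (pow_ob C A k) \<and> (\<forall>i<k. pow_proj C A k i \<cdot> h = x i)"
    using pow_is_power[of A k] assms by (auto simp: is_power_def)
  then have "pow_tuple C Q A k x \<in> Hom C Q (pow_ob C A k) \<and>
    (\<forall>i<k. pow_proj C A k i \<cdot> pow_tuple C Q A k x = x i)"
    unfolding pow_tuple_def by (rule theI')
  then show "pow_tuple C Q A k x \<in> Hom C Q (pow_ob C A k)"
    "i < k \<Longrightarrow> pow_proj C A k i \<cdot> pow_tuple C Q A k x = x i"
    by auto
qed

lemma pow_ext:
  assumes "A \<in> Ob C" "h \<in> Hom C Q (pow_ob C A k)" "h' \<in> Hom C Q (pow_ob C A k)"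
    "\<And>i. i < k \<Longrightarrow> pow_proj C A k i \<cdot> h = pow_proj C A k i \<cdot> h'"
  shows "h = h'"
proof -
  have "\<exists>!g. g \<in> Hom C Q (pow_ob C A k) \<and> (\<forall>i<k. pow_proj C A k i \<cdot> g = pow_proj C A k i \<cdot> h)"
    using pow_is_power[of A k] pow_proj_Hom[OF assms(1)] assms Hom_Ob[OF assms(2)]
    by (auto simp: is_power_def Hom_iff)
  then show ?thesis
    using assms by metis
qed

lemma pow_pair_simps:
  assumes "x \<in> Hom C Q A" "y \<in> Hom C Q A"
  shows "pow_pair C A x y \<in> Hom C Q (pow_ob C A 2)"
    "pow_proj C A 2 0 \<cdot> pow_pair C A x y = x" "pow_proj C A 2 (Suc 0) \<cdot> pow_pair C A x y = y"
proof -
  have 1: "[x, y] ! i \<in> Hom C Q A" if "i < 2" for i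
    using that assms by (auto simp: less_2_cases_iff)
  have Q: "Dom C x = Q" "Q \<in> Ob C" "A \<in> Ob C"
    using assms(1) Hom_Ob[OF assms(1)] by (auto simp: Hom_iff)
  note 2 = pow_tuple_simps[OF Q(3,2), of 2 "\<lambda>i. [x, y] ! i", OF 1]
  show "pow_pair C A x y \<in> Hom C Q (pow_ob C A 2)"
    "pow_proj C A 2 0 \<cdot> pow_pair C A x y = x" "pow_proj C A 2 (Suc 0) \<cdot> pow_pair C A x y = y"
    using 2(1) 2(2)[of 0] 2(2)[of 1] Q by (simp_all add: pow_pair_def)
qed

lemma pow2_ext:
  assumes A: "A \<in> Ob C" and h: "h \<in> Hom C Q (pow_ob C A 2)" "h' \<in> Hom C Q (pow_ob C A 2)"
    and "pow_proj C A 2 0 \<cdot> h = pow_proj C A 2 0 \<cdot> h'"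
    "pow_proj C A 2 (Suc 0) \<cdot> h = pow_proj C A 2 (Suc 0) \<cdot> h'"
  shows "h = h'"
  by (rule pow_ext[OF A h]) (use assms in \<open>auto simp: less_2_cases_iff\<close>)

lemma pow_pair_comp:
  assumes x: "x \<in> Hom C Q A" and y: "y \<in> Hom C Q A" and h: "h \<in> Hom C R Q"
  shows "pow_pair C A x y \<cdot> h = pow_pair C A (x \<cdot> h) (y \<cdot> h)"
proof -
  have A: "A \<in> Ob C" using Hom_Ob[OF x] by simp
  have "x \<cdot> h \<in> Hom C R A" "y \<cdot> h \<in> Hom C R A"
    using x y h by (auto simp: Hom_iff)
  note 1 = pow_pair_simps[OF x y] and 2 = pow_pair_simps[OF this]
    and 3 = pow_proj_Hom[OF A, of 0 2] pow_proj_Hom[OF A, of 1 2]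
  show ?thesis
    by (rule pow2_ext[OF A, of _ R])
      (use 1 2 3 h Comp_reassoc[OF 1(2,1) 3(1)] Comp_reassoc[OF 1(3,1)] in \<open>auto simp: Hom_iff\<close>)
qed

end

section \<open>Zero objects\<close>

lemma zero_ob_is_zero: "pointed C \<Longrightarrow> is_zero_object C (zero_ob C)"
  unfolding zero_ob_def pointed_def by (rule someI_ex)

context category
begin

lemma zero_ob_Ob: "pointed C \<Longrightarrow> zero_ob C \<in> Ob C"
  using zero_ob_is_zero by (auto simp: is_zero_object_def)

lemma to_zero_Hom:
  assumes "pointed C" "a \<in> Ob C"
  shows "to_zero C a \<in> Hom C a (zero_ob C)"
  unfolding to_zero_def
  by (rule theI') (use zero_ob_is_zero[OF assms(1)] assms(2) in \<open>auto simp: is_zero_object_def\<close>)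

lemma zero_ob_ext:
  assumes "pointed C" "f \<in> Hom C a (zero_ob C)" "g \<in> Hom C a (zero_ob C)"
  shows "f = g"
  using zero_ob_is_zero[OF assms(1)] assms(2,3) Hom_Ob[OF assms(2)]
  unfolding is_zero_object_def by metis

end

section \<open>The nerve of an internal groupoid\<close>

lemma Delta_simps [simp]:
  "Ob Delta = UNIV" "Dom Delta (m, n, f) = m" "Cod Delta (m, n, f) = n"
  "Ident Delta n = (n, n, \<lambda>i\<in>{..n}. i)"
  "(n, k, g) \<cdot>\<^bsub>Delta\<^esub> (m, n', f) = (m, k, \<lambda>i\<in>{..m}. g (f i))"
  by (simp_all add: Delta_def)

lemma Ar_Delta: "(m, n, f) \<in> Ar Delta \<longleftrightarrow> f \<in> {..m} \<rightarrow>\<^sub>E {..n} \<and> mono_on {..m} f"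
  by (simp add: Delta_def)

lemma Ident_Delta_Ar: "(n, n, restrict (\<lambda>i. i) {..n}) \<in> Ar Delta"
  by (auto simp: Ar_Delta mono_on_def)

lemma category_Delta: "category Delta"
proof
  fix a b c :: nat and f g assume "f \<in> Hom Delta a b" "g \<in> Hom Delta b c"
  then show "g \<cdot>\<^bsub>Delta\<^esub> f \<in> Hom Delta a c"
    by (cases f; cases g) (auto simp: Hom_iff Ar_Delta mono_on_def PiE_iff Pi_iff)
next
  fix f g h and a b c d :: nat
  assume "f \<in> Hom Delta a b" "g \<in> Hom Delta b c" "h \<in> Hom Delta c d"
  then show "h \<cdot>\<^bsub>Delta\<^esub> g \<cdot>\<^bsub>Delta\<^esub> f = h \<cdot>\<^bsub>Delta\<^esub> (g \<cdot>\<^bsub>Delta\<^esub> f)"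
    by (cases f; cases g; cases h) (auto simp: Hom_iff Ar_Delta PiE_iff Pi_iff)
next
  fix f and a b :: nat assume "f \<in> Hom Delta a b"
  then show "f \<cdot>\<^bsub>Delta\<^esub> Ident Delta a = f" "Ident Delta b \<cdot>\<^bsub>Delta\<^esub> f = f"
    by (cases f; auto simp: Hom_iff Ar_Delta PiE_iff Pi_iff extensional_def)+
qed (auto simp: Hom_iff Ar_Delta mono_on_def)

lemma op_cat_simps [simp]:
  "Ob (op_cat C) = Ob C" "Ar (op_cat C) = Ar C" "Dom (op_cat C) = Cod C" "Cod (op_cat C) = Dom C"
  "Ident (op_cat C) = Ident C" "g \<cdot>\<^bsub>op_cat C\<^esub> f = f \<cdot>\<^bsub>C\<^esub> g"
  by (simp_all add: op_cat_def)

lemma (in category) category_Simp: "category (Simp C)"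
  unfolding Simp_def
  by (rule category_functor_category[OF category_op_cat[OF category_Delta] category_axioms])

lemma Ob_Simp: "X \<in> Ob (Simp C) \<longleftrightarrow> is_functor (op_cat Delta) C X \<and> FAr X \<in> extensional (Ar Delta)"
  by (simp add: Simp_def Ob_functor_category)

lemma Hom_Simp: "f \<in> Hom (Simp C) X Y \<longleftrightarrow> X \<in> Ob (Simp C) \<and> Y \<in> Ob (Simp C) \<and>
    (\<exists>\<tau>. f = (X, Y, \<tau>) \<and> is_nat_trans (op_cat Delta) C X Y \<tau>)"
  by (simp add: Simp_def Hom_functor_category)

lemma Simp_simps [simp]:
  "(Y, Z, \<sigma>) \<cdot>\<^bsub>Simp C\<^esub> (X, Y', \<tau>) = (X, Z, \<lambda>n. \<sigma> n \<cdot>\<^bsub>C\<^esub> \<tau> n)"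
  "Ident (Simp C) X = (X, X, \<lambda>n. Ident C (FOb X n))"
  "Dom (Simp C) (X, Y, \<tau>) = X" "Cod (Simp C) (X, Y, \<tau>) = Y"
  by (auto simp: Simp_def functor_category_def Let_def)

section \<open>Strings of composable arrows and the action of monotone maps on them\<close>

text \<open>The recursion of \<open>nerve_path\<close>, for an arbitrary string on \<open>Q\<close>
  in place of the generic one. Transport of paths along maps and along functors calls for this
  generality; \<open>nerve_path_eq\<close> leads back to the nerve.\<close>

definition gpath ::
  "('o, 'm) cat \<Rightarrow> ('o, 'm) igpd \<Rightarrow> (nat \<Rightarrow> 'm) \<Rightarrow> (nat \<Rightarrow> 'm) \<Rightarrow> nat \<Rightarrow> nat \<Rightarrow> 'm" where
  "gpath C G v e i l = rec_nat (Gs G \<cdot>\<^bsub>C\<^esub> v i) (\<lambda>l p. gcomp C G p (e (i + l))) l"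

lemma gpath_simps [simp]:
  "gpath C G v e i 0 = Gs G \<cdot>\<^bsub>C\<^esub> v i"
  "gpath C G v e i (Suc l) = gcomp C G (gpath C G v e i l) (e (i + l))"
  by (simp_all add: gpath_def)

lemma nerve_path_eq: "nerve_path C G n i l = gpath C G (nerve_vert C G n) (nerve_edge C G n) i l"
  by (induction l) simp_all

locale groupoid_in = lex_category +
  fixes G
  assumes groupoid: "internal_groupoid C G"
begin

abbreviation "d0 \<equiv> Gd0 G"
abbreviation "d1 \<equiv> Gd1 G"
abbreviation "s \<equiv> Gs G"
abbreviation comp_gpd (infixl "\<star>" 70) where "x \<star> y \<equiv> gcomp C G x y"

lemma G_Ob [simp]: "G0 G \<in> Ob C" "G1 G \<in> Ob C"
  using groupoid by (auto simp: internal_groupoid_def Let_def)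

lemma G_Hom: "d0 \<in> Hom C (G1 G) (G0 G)" "d1 \<in> Hom C (G1 G) (G0 G)" "s \<in> Hom C (G0 G) (G1 G)"
  "Gm G \<in> Hom C (pb_ob C d0 d1) (G1 G)"
  using groupoid by (auto simp: internal_groupoid_def Let_def)

lemma G_simps [simp]:
  "d0 \<in> Ar C" "Dom C d0 = G1 G" "Cod C d0 = G0 G"
  "d1 \<in> Ar C" "Dom C d1 = G1 G" "Cod C d1 = G0 G"
  "s \<in> Ar C" "Dom C s = G0 G" "Cod C s = G1 G"
  "Gm G \<in> Ar C" "Dom C (Gm G) = pb_ob C d0 d1" "Cod C (Gm G) = G1 G"
  using G_Hom by (auto simp: Hom_iff)

lemma ds: "d0 \<cdot> s = Ident C (G0 G)" "d1 \<cdot> s = Ident C (G0 G)"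
  using groupoid by (auto simp: internal_groupoid_def Let_def)

lemma ds_simps [simp]:
  assumes "x \<in> Hom C Q (G0 G)"
  shows "d0 \<cdot> (s \<cdot> x) = x" "d1 \<cdot> (s \<cdot> x) = x"
  using ds[THEN Comp_reassoc] assms by (auto simp: Hom_iff)

lemma dm: "d1 \<cdot> Gm G = d1 \<cdot> pb_fst C d0 d1" "d0 \<cdot> Gm G = d0 \<cdot> pb_snd C d0 d1"
  using groupoid by (auto simp: internal_groupoid_def Let_def)

lemma gc_Hom:
  assumes xy: "x \<in> Hom C Q (G1 G)" "y \<in> Hom C Q (G1 G)" "d0 \<cdot> x = d1 \<cdot> y"
  shows "x \<star> y \<in> Hom C Q (G1 G)" "d1 \<cdot> (x \<star> y) = d1 \<cdot> x" "d0 \<cdot> (x \<star> y) = d0 \<cdot> y"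
proof -
  note 1 = pb_pair_simps[OF G_Hom(1,2) xy] and 2 = pb_simps[OF G_Hom(1,2)]
  show "x \<star> y \<in> Hom C Q (G1 G)"
    using 1(1) by (auto simp: gcomp_def Hom_iff)
  show "d1 \<cdot> (x \<star> y) = d1 \<cdot> x" "d0 \<cdot> (x \<star> y) = d0 \<cdot> y"
    using Comp_reassoc[OF dm(1), of "pb_ob C d0 d1" "G1 G" "G0 G" "pb_pair C d0 d1 x y"]
      Comp_reassoc[OF dm(2), of "pb_ob C d0 d1" "G1 G" "G0 G" "pb_pair C d0 d1 x y"] 1 2
    by (auto simp: gcomp_def Hom_iff)
qed

lemma gc_comp:
  assumes xy: "x \<in> Hom C Q (G1 G)" "y \<in> Hom C Q (G1 G)" "d0 \<cdot> x = d1 \<cdot> y" and h: "h \<in> Hom C R Q"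
  shows "(x \<star> y) \<cdot> h = (x \<cdot> h) \<star> (y \<cdot> h)"
  using pb_pair_comp[OF G_Hom(1,2) xy h] pb_pair_simps[OF G_Hom(1,2) xy] h
  by (auto simp: gcomp_def Hom_iff)

text \<open>The unit axioms of a groupoid are stated for the generic arrow
  \<open>Ident C (G1 G)\<close>; precomposing them with \<open>x\<close> gives the laws for every
  element.\<close>

lemma gc_unit:
  assumes x: "x \<in> Hom C Q (G1 G)"
  shows "(s \<cdot> (d1 \<cdot> x)) \<star> x = x" "x \<star> (s \<cdot> (d0 \<cdot> x)) = x"
proof -
  have 1: "(s \<cdot> d1) \<star> Ident C (G1 G) = Ident C (G1 G)" "Ident C (G1 G) \<star> (s \<cdot> d0) = Ident C (G1 G)"
    using groupoid by (auto simp: internal_groupoid_def Let_def)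
  have "((s \<cdot> d1) \<star> Ident C (G1 G)) \<cdot> x = (s \<cdot> d1 \<cdot> x) \<star> (Ident C (G1 G) \<cdot> x)"
    by (rule gc_comp[OF _ _ _ x]) (use ds_simps[of d1] in \<open>auto simp: Hom_iff\<close>)
  then show "(s \<cdot> (d1 \<cdot> x)) \<star> x = x"
    using 1 x by (simp add: Hom_iff)
  have "(Ident C (G1 G) \<star> (s \<cdot> d0)) \<cdot> x = (Ident C (G1 G) \<cdot> x) \<star> (s \<cdot> d0 \<cdot> x)"
    by (rule gc_comp[OF _ _ _ x]) (use ds_simps[of d0] in \<open>auto simp: Hom_iff\<close>)
  then show "x \<star> (s \<cdot> (d0 \<cdot> x)) = x"
    using 1 x by (simp add: Hom_iff)
qed

lemma gc_assoc:
  assumes "x \<in> Hom C Q (G1 G)" "y \<in> Hom C Q (G1 G)" "z \<in> Hom C Q (G1 G)"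
    "d0 \<cdot> x = d1 \<cdot> y" "d0 \<cdot> y = d1 \<cdot> z"
  shows "(x \<star> y) \<star> z = x \<star> (y \<star> z)"
  using groupoid assms unfolding internal_groupoid_def Let_def by blast

lemma is_stringD:
  assumes "is_string C G n Q v e"
  shows "Q \<in> Ob C" "k \<le> n \<Longrightarrow> v k \<in> Hom C Q (G0 G)" "k < n \<Longrightarrow> e k \<in> Hom C Q (G1 G)"
    "k < n \<Longrightarrow> d1 \<cdot> e k = v k" "k < n \<Longrightarrow> d0 \<cdot> e k = v (Suc k)"
  using assms by (auto simp: is_string_def)

lemma is_string_comp:
  assumes "is_string C G n Q v e" and h: "h \<in> Hom C R Q"
  shows "is_string C G n R (\<lambda>k. v k \<cdot> h) (\<lambda>k. e k \<cdot> h)"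
  unfolding is_string_def
proof (intro conjI allI impI)
  fix k assume k: "k < n"
  note * = is_stringD[OF assms(1)]
  show "d1 \<cdot> (e k \<cdot> h) = v k \<cdot> h" "d0 \<cdot> (e k \<cdot> h) = v (Suc k) \<cdot> h"
    using Comp_reassoc[OF *(4)[OF k] *(3)[OF k] G_Hom(2)]
        Comp_reassoc[OF *(5)[OF k] *(3)[OF k] G_Hom(1)] h
    by (auto simp: Hom_iff)
qed (use is_stringD[OF assms(1)] h Hom_Ob[OF h] in \<open>auto simp: Hom_iff\<close>)

lemma is_string_object_ext:
  assumes "is_string_object C G n N v e" and h: "h \<in> Hom C Q N" "h' \<in> Hom C Q N"
    and "\<And>k. k \<le> n \<Longrightarrow> v k \<cdot> h = v k \<cdot> h'" "\<And>k. k < n \<Longrightarrow> e k \<cdot> h = e k \<cdot> h'"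
  shows "h = h'"
proof -
  have "is_string C G n Q (\<lambda>k. v k \<cdot> h) (\<lambda>k. e k \<cdot> h)"
    using assms(1) h by (intro is_string_comp) (auto simp: is_string_object_def)
  then have "\<exists>!g. g \<in> Hom C Q N \<and> (\<forall>k\<le>n. v k \<cdot> g = v k \<cdot> h) \<and> (\<forall>k<n. e k \<cdot> g = e k \<cdot> h)"
    using assms(1) by (simp add: is_string_object_def)
  then show ?thesis
    using assms by metis
qed

text \<open>A string of \<open>n + 1\<close> arrows is a string of \<open>n\<close> arrows with one
  more arrow whose source is the last vertex. So the next object is the pullback of
  \<open>v n\<close> along \<open>d1\<close>, starting from \<open>G0 G\<close> for strings without
  arrows.\<close>

lemma ex_string_object: "\<exists>N v e. is_string_object C G n N v e"
proof (induction n)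
  case 0
  \<comment> \<open>There are no edges in length \<open>0\<close>, so the family \<open>e\<close> is
    arbitrary.\<close>
  have "is_string_object C G 0 (G0 G) (\<lambda>_. Ident C (G0 G)) e" for e
    by (auto simp: is_string_object_def is_string_def Hom_iff)
  then show ?case by blast
next
  case (Suc n)
  then obtain N v e where N: "is_string_object C G n N v e" by blast
  then have str: "is_string C G n N v e" by (simp add: is_string_object_def)
  note S = is_stringD[OF str]
  have vn: "v n \<in> Hom C N (G0 G)" using S by simp
  define P p q where "P = pb_ob C (v n) d1" and "p = pb_fst C (v n) d1" and "q = pb_snd C (v n) d1"
  have P: "is_pullback C (v n) d1 P p q"
    unfolding P_def p_def q_def by (rule pb_is_pullback[OF vn G_Hom(2)])
  have pq: "p \<in> Hom C P N" "q \<in> Hom C P (G1 G)" "v n \<cdot> p = d1 \<cdot> q"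
    using P vn by (auto simp: is_pullback_def Hom_iff)
  \<comment> \<open>The projection \<open>q\<close> is the added edge and
    \<open>d0 \<cdot> q\<close>, its target, the added vertex; the older data are pulled back along
    \<open>p\<close>.\<close>
  define v' e' where "v' k = (if k \<le> n then v k \<cdot> p else d0 \<cdot> q)"
    and "e' k = (if k < n then e k \<cdot> p else q)" for k
  have str': "is_string C G (Suc n) P v' e'"
    unfolding is_string_def
  proof (intro conjI allI impI)
    note 1 = is_stringD[OF is_string_comp[OF str pq(1)]]
    show "P \<in> Ob C" using Hom_Ob[OF pq(1)] by simp
    show "v' k \<in> Hom C P (G0 G)" if "k \<le> Suc n" for k
      using 1(2)[of k] pq by (auto simp: v'_def Hom_iff)
    show "e' k \<in> Hom C P (G1 G)" if "k < Suc n" for k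
      using 1(3)[of k] pq by (auto simp: e'_def Hom_iff)
    show "d1 \<cdot> e' k = v' k" "d0 \<cdot> e' k = v' (Suc k)" if "k < Suc n" for k
      using 1(4,5)[of k] pq that by (auto simp: e'_def v'_def less_Suc_eq)
  qed
  have "\<exists>!h. h \<in> Hom C Q P \<and> (\<forall>k\<le>Suc n. v' k \<cdot> h = w k) \<and> (\<forall>k<Suc n. e' k \<cdot> h = f k)"
    if wf: "is_string C G (Suc n) Q w f" for Q w f
  proof -
    note W = is_stringD[OF wf]
    have "is_string C G n Q w f" using wf by (auto simp: is_string_def)
    then obtain g where g: "g \<in> Hom C Q N" "\<And>k. k \<le> n \<Longrightarrow> v k \<cdot> g = w k" "\<And>k. k < n \<Longrightarrow> e k \<cdot> g = f k"
      using N unfolding is_string_object_def by blast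
    have "v n \<cdot> g = d1 \<cdot> f n"
      using g(2)[of n] W(4)[of n] by simp
    moreover have "Dom C (v n) = N" using vn by (simp add: Hom_iff)
    ultimately obtain h where h: "h \<in> Hom C Q P" "p \<cdot> h = g" "q \<cdot> h = f n"
      using P g(1) W(3)[of n] unfolding is_pullback_def by (metis G_simps(5) lessI)
    have v'h: "v' k \<cdot> x = (if k \<le> n then v k \<cdot> (p \<cdot> x) else d0 \<cdot> (q \<cdot> x))" if "x \<in> Hom C Q P"
        for x k
      using S(2)[of k] pq that by (auto simp: v'_def Hom_iff)
    have e'h: "e' k \<cdot> x = (if k < n then e k \<cdot> (p \<cdot> x) else q \<cdot> x)" if "x \<in> Hom C Q P" for x k
      using S(3)[of k] pq that by (auto simp: e'_def Hom_iff)
    show ?thesis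
    proof (rule ex1I[of _ h])
      show "h \<in> Hom C Q P \<and> (\<forall>k\<le>Suc n. v' k \<cdot> h = w k) \<and> (\<forall>k<Suc n. e' k \<cdot> h = f k)"
        using h g W(5)[of n] by (auto simp: v'h e'h le_Suc_eq less_Suc_eq)
      fix h' assume h': "h' \<in> Hom C Q P \<and> (\<forall>k\<le>Suc n. v' k \<cdot> h' = w k) \<and> (\<forall>k<Suc n. e' k \<cdot> h' = f k)"
      have 1: "p \<cdot> h' = p \<cdot> h"
      proof (rule is_string_object_ext[OF N])
        show "v k \<cdot> (p \<cdot> h') = v k \<cdot> (p \<cdot> h)" if "k \<le> n" for k
          using h'[THEN conjunct2, THEN conjunct1, rule_format, of k] v'h[of h' k] h' that g h
              by auto
        show "e k \<cdot> (p \<cdot> h') = e k \<cdot> (p \<cdot> h)" if "k < n" for k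
          using h'[THEN conjunct2, THEN conjunct2, rule_format, of k] e'h[of h' k] h' that g h
              by auto
      qed (use pq h h' in \<open>auto simp: Hom_iff\<close>)
      have "e' n \<cdot> h' = f n" using h' by auto
      then have "q \<cdot> h' = q \<cdot> h"
        using e'h[of h' n] h h' by auto
      then show "h' = h"
        using is_pullback_ext[OF P] 1 h h' by blast
    qed
  qed
  then have "is_string_object C G (Suc n) P v' e'"
    using str' unfolding is_string_object_def by blast
  then show ?case by blast
qed

abbreviation "N n \<equiv> nerve_ob C G n"
abbreviation "vert n \<equiv> nerve_vert C G n"
abbreviation "edge n \<equiv> nerve_edge C G n"

lemma nerve_string_object: "is_string_object C G n (N n) (vert n) (edge n)"
proof -
  have "case strings C G n of (P, v, e) \<Rightarrow> is_string_object C G n P v e"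
    unfolding strings_def by (rule someI_ex) (use ex_string_object[of n] in auto)
  then show ?thesis
    by (simp add: nerve_ob_def nerve_vert_def nerve_edge_def split: prod.splits)
qed

lemma nerve_string: "is_string C G n (N n) (vert n) (edge n)"
  using nerve_string_object by (simp add: is_string_object_def)

lemmas nerve_stringD = is_stringD[OF nerve_string]
lemmas nerve_ext = is_string_object_ext[OF nerve_string_object]

lemma nerve_simps [simp]:
  "N n \<in> Ob C"
  "k \<le> n \<Longrightarrow> vert n k \<in> Ar C" "k \<le> n \<Longrightarrow> Dom C (vert n k) = N n" "k \<le> n \<Longrightarrow> Cod C (vert n k) = G0 G"
  "k < n \<Longrightarrow> edge n k \<in> Ar C" "k < n \<Longrightarrow> Dom C (edge n k) = N n" "k < n \<Longrightarrow> Cod C (edge n k) = G1 G"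
  using nerve_stringD(1)[of n] nerve_stringD(2,3)[of k n] by (auto simp: Hom_iff)

lemma nerve_tuple_simps:
  assumes "is_string C G n Q v e"
  shows "nerve_tuple C G n Q v e \<in> Hom C Q (N n)"
    "k \<le> n \<Longrightarrow> vert n k \<cdot> nerve_tuple C G n Q v e = v k"
    "k < n \<Longrightarrow> edge n k \<cdot> nerve_tuple C G n Q v e = e k"
proof -
  have "\<exists>!h. h \<in> Hom C Q (N n) \<and> (\<forall>k\<le>n. vert n k \<cdot> h = v k) \<and> (\<forall>k<n. edge n k \<cdot> h = e k)"
    using nerve_string_object[of n] assms by (auto simp: is_string_object_def)
  from theI'[OF this] show "nerve_tuple C G n Q v e \<in> Hom C Q (N n)"
    "k \<le> n \<Longrightarrow> vert n k \<cdot> nerve_tuple C G n Q v e = v k"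
    "k < n \<Longrightarrow> edge n k \<cdot> nerve_tuple C G n Q v e = e k"
    by (auto simp: nerve_tuple_def)
qed

lemma gpath_Hom:
  assumes "is_string C G n Q v e" "i + l \<le> n"
  shows "gpath C G v e i l \<in> Hom C Q (G1 G) \<and> d1 \<cdot> gpath C G v e i l = v i \<and>
    d0 \<cdot> gpath C G v e i l = v (i + l)"
  using assms(2)
proof (induction l)
  case 0
  then have "v i \<in> Hom C Q (G0 G)"
    using is_stringD(2)[OF assms(1), of i] by simp
  then show ?case by (auto simp: Hom_iff[of s] intro: Comp_Hom G_Hom)
next
  case (Suc l)
  then show ?case
    using gc_Hom[of "gpath C G v e i l" Q "e (i + l)"] is_stringD(3-5)[OF assms(1), of "i + l"]
        by simp
qed

lemma gpath_comp:
  assumes "is_string C G n Q v e" "h \<in> Hom C R Q" "i + l \<le> n"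
  shows "gpath C G v e i l \<cdot> h = gpath C G (\<lambda>k. v k \<cdot> h) (\<lambda>k. e k \<cdot> h) i l"
  using assms(3)
proof (induction l)
  case 0
  then have "v i \<in> Hom C Q (G0 G)"
    using is_stringD(2)[OF assms(1), of i] by simp
  then show ?case using assms(2) by (auto simp: Hom_iff)
next
  case (Suc l)
  then show ?case
    using gc_comp[of "gpath C G v e i l" Q "e (i + l)" h R] is_stringD(3-5)[OF assms(1), of "i + l"]
      gpath_Hom[OF assms(1), of i l] assms(2) by simp
qed

text \<open>A path starts with the identity at its initial vertex and afterwards uses edges only, so
  agreement at \<open>v i\<close> and on the edges in range is enough.\<close>

lemma gpath_cong:
  assumes "v i = v' i" "\<And>k. i \<le> k \<Longrightarrow> k < i + l \<Longrightarrow> e k = e' k"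
  shows "gpath C G v e i l = gpath C G v' e' i l"
  using assms(2) by (induction l) (simp_all add: assms(1))

lemma gpath_1:
  assumes "is_string C G n Q v e" "i < n"
  shows "gpath C G v e i (Suc 0) = e i"
  using is_stringD(3,4)[OF assms(1), of i] gc_unit(1)[of "e i" Q] assms(2) by simp

text \<open>Concatenation of paths: the base case is the right unit law, the step is
  associativity.\<close>

lemma gpath_add:
  assumes "is_string C G n Q v e" "i + l + l' \<le> n"
  shows "gpath C G v e i l \<star> gpath C G v e (i + l) l' = gpath C G v e i (l + l')"
  using assms(2)
proof (induction l')
  case 0
  then show ?case
    using gpath_Hom[OF assms(1), of i l] gc_unit(2)[of "gpath C G v e i l" Q] by simp
next
  case (Suc l')
  then show ?case
    using gpath_Hom[OF assms(1), of i l] gpath_Hom[OF assms(1), of "i + l" l']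
      is_stringD(3-5)[OF assms(1), of "i + l + l'"]
      gc_assoc[of "gpath C G v e i l" Q "gpath C G v e (i + l) l'" "e (i + l + l')"]
    by (simp add: add.assoc)
qed

text \<open>This is the action of a monotone map \<open>f : [m] \<rightarrow> [n]\<close>: the edge
  from \<open>k\<close> to \<open>k + 1\<close> becomes the composite from \<open>f k\<close> to
  \<open>f (k + 1)\<close>, which is an identity where \<open>f\<close> is stationary.\<close>

lemma is_string_reindex:
  assumes str: "is_string C G n Q v e" and f: "f \<in> {..m} \<rightarrow> {..n}" "mono_on {..m} f"
  shows "is_string C G m Q (\<lambda>k. v (f k)) (\<lambda>k. gpath C G v e (f k) (f (Suc k) - f k))"
  unfolding is_string_def
proof (intro conjI allI impI)
  fix k assume k: "k < m"
  then have "f k \<le> f (Suc k)" "f (Suc k) \<le> n"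
    using f by (auto simp: mono_on_def Pi_iff)
  then show "gpath C G v e (f k) (f (Suc k) - f k) \<in> Hom C Q (G1 G)"
    "d1 \<cdot> gpath C G v e (f k) (f (Suc k) - f k) = v (f k)"
    "d0 \<cdot> gpath C G v e (f k) (f (Suc k) - f k) = v (f (Suc k))"
    using gpath_Hom[OF str, of "f k" "f (Suc k) - f k"] by auto
qed (use is_stringD[OF str] f in \<open>auto simp: Pi_iff\<close>)

text \<open>Consecutive edges of the reindexed string are composites over adjacent intervals, so a
  path telescopes by \<open>gpath_add\<close>. This is the computation behind the preservation of
  composites by the simplicial operators of the nerve.\<close>

lemma gpath_reindex:
  assumes str: "is_string C G n Q v e" and f: "f \<in> {..m} \<rightarrow> {..n}" "mono_on {..m} f"
    and il: "i + l \<le> m"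
  shows "gpath C G (\<lambda>k. v (f k)) (\<lambda>k. gpath C G v e (f k) (f (Suc k) - f k)) i l =
    gpath C G v e (f i) (f (i + l) - f i)"
  using il
proof (induction l)
  case (Suc l)
  then have *: "f i \<le> f (i + l)" "f (i + l) \<le> f (Suc (i + l))" "f (Suc (i + l)) \<le> n"
    using f by (auto simp: mono_on_def Pi_iff)
  then show ?case
    using Suc gpath_add[OF str, of "f i" "f (i + l) - f i" "f (Suc (i + l)) - f (i + l)"] by simp
qed simp

lemma FOb_nerve_of [simp]: "FOb (nerve_of C G) = nerve_ob C G"
  by (simp add: nerve_of_def)

lemma nerve_of_map:
  assumes "(m, n, f) \<in> Ar Delta"
  shows "FAr (nerve_of C G) (m, n, f) \<in> Hom C (N n) (N m)"
    "k \<le> m \<Longrightarrow> vert m k \<cdot> FAr (nerve_of C G) (m, n, f) = vert n (f k)"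
    "k < m \<Longrightarrow> edge m k \<cdot> FAr (nerve_of C G) (m, n, f) =
       gpath C G (vert n) (edge n) (f k) (f (Suc k) - f k)"
proof -
  have f: "f \<in> {..m} \<rightarrow> {..n}" "mono_on {..m} f"
    using assms by (auto simp: Ar_Delta)
  note * = nerve_tuple_simps[OF is_string_reindex[OF nerve_string[of n] f]]
  show "FAr (nerve_of C G) (m, n, f) \<in> Hom C (N n) (N m)"
    "k \<le> m \<Longrightarrow> vert m k \<cdot> FAr (nerve_of C G) (m, n, f) = vert n (f k)"
    "k < m \<Longrightarrow> edge m k \<cdot> FAr (nerve_of C G) (m, n, f) =
       gpath C G (vert n) (edge n) (f k) (f (Suc k) - f k)"
    using assms * by (simp_all add: nerve_of_def nerve_path_eq)
qed

lemma nerve_of_Ob: "nerve_of C G \<in> Ob (Simp C)"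
proof -
  have "is_functor (op_cat Delta) C (nerve_of C G)"
    unfolding is_functor_def
  proof (intro conjI ballI impI)
    fix n :: nat
    note 1 = nerve_of_map[OF Ident_Delta_Ar[of n]]
    have "FAr (nerve_of C G) (n, n, restrict (\<lambda>i. i) {..n}) = Ident C (N n)"
    proof (rule nerve_ext[OF 1(1)])
      show "Ident C (N n) \<in> Hom C (N n) (N n)"
        by (rule Ident_Hom) simp
      show "vert n k \<cdot> FAr (nerve_of C G) (n, n, restrict (\<lambda>i. i) {..n}) = vert n k \<cdot> Ident C (N n)"
        if "k \<le> n" for k
        using 1(2)[OF that] that by simp
      \<comment> \<open>The identity map advances by one at each step, and a path of length one is
        the edge itself.\<close>
      show "edge n k \<cdot> FAr (nerve_of C G) (n, n, restrict (\<lambda>i. i) {..n}) = edge n k \<cdot> Ident C (N n)"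
        if "k < n" for k
      proof -
        have "restrict (\<lambda>i. i) {..n} (Suc k) - restrict (\<lambda>i. i) {..n} k = Suc 0"
          "restrict (\<lambda>i. i) {..n} k = k"
          using that by auto
        then show ?thesis
          unfolding 1(3)[OF that] using gpath_1[OF nerve_string that] that
              by (simp only: Comp_Ident_simp nerve_simps)
      qed
    qed
    then show "FAr (nerve_of C G) (Ident (op_cat Delta) n) = Ident C (FOb (nerve_of C G) n)"
      by simp
  next
    fix \<beta> \<alpha> assume \<beta>\<alpha>: "\<beta> \<in> Ar (op_cat Delta)" "\<alpha> \<in> Ar (op_cat Delta)"
      "Dom (op_cat Delta) \<alpha> = Cod (op_cat Delta) \<beta>"
    obtain l m f where lmf: "\<alpha> = (l, m, f)" by (rule prod_cases3)
    obtain m' n g where mng: "\<beta> = (m', n, g)" by (rule prod_cases3)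
    have "m' = m" using \<beta>\<alpha>(3) by (simp add: lmf mng)
    then have \<alpha>: "\<alpha> = (l, m, f)" "(l, m, f) \<in> Ar Delta" and \<beta>: "\<beta> = (m, n, g)"
        "(m, n, g) \<in> Ar Delta"
      using \<beta>\<alpha>(1,2) by (simp_all add: lmf mng)
    have \<gamma>: "(l, n, \<lambda>i\<in>{..l}. g (f i)) \<in> Ar Delta"
      using \<alpha>(2) \<beta>(2) by (auto simp: Ar_Delta mono_on_def PiE_iff Pi_iff)
    note A = nerve_of_map[OF \<alpha>(2)] and B = nerve_of_map[OF \<beta>(2)] and C = nerve_of_map[OF \<gamma>]
    have f: "f k \<le> m" if "k \<le> l" for k using \<alpha>(2) that by (auto simp: Ar_Delta)
    have g: "g \<in> {..m} \<rightarrow> {..n}" "mono_on {..m} g" using \<beta>(2) by (auto simp: Ar_Delta)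
    have "FAr (nerve_of C G) (l, n, \<lambda>i\<in>{..l}. g (f i)) =
      FAr (nerve_of C G) (l, m, f) \<cdot> FAr (nerve_of C G) (m, n, g)" (is "?c = ?a \<cdot> ?b")
    proof (rule nerve_ext)
      show "?c \<in> Hom C (N n) (N l)" "?a \<cdot> ?b \<in> Hom C (N n) (N l)"
        using A(1) B(1) C(1) by (auto simp: Hom_iff)
      show "vert l k \<cdot> ?c = vert l k \<cdot> (?a \<cdot> ?b)" if "k \<le> l" for k
        using Comp_reassoc[OF A(2)[OF that] A(1), of "G0 G" ?b] that A(1) B C f[of k]
            by (auto simp: Hom_iff)
      \<comment> \<open>The path computed in degree \<open>m\<close> is carried along
        \<open>?b\<close> to the string that \<open>g\<close> cuts out of degree \<open>n\<close>,
        where \<open>gpath_reindex\<close> evaluates it.\<close>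
      show "edge l k \<cdot> ?c = edge l k \<cdot> (?a \<cdot> ?b)" if k: "k < l" for k
      proof -
        have *: "f k + (f (Suc k) - f k) \<le> m" "f k \<le> f (Suc k)"
          using f[of k] f[of "Suc k"] \<alpha>(2) k by (auto simp: Ar_Delta mono_on_def)
        have "edge l k \<cdot> (?a \<cdot> ?b) = gpath C G (vert m) (edge m) (f k) (f (Suc k) - f k) \<cdot> ?b"
          using Comp_reassoc[OF A(3)[OF k] A(1), of "G1 G" ?b] A(1) B(1) k by (auto simp: Hom_iff)
        also have "\<dots> = gpath C G (\<lambda>k. vert m k \<cdot> ?b) (\<lambda>k. edge m k \<cdot> ?b) (f k) (f (Suc k) - f k)"
          by (rule gpath_comp[OF nerve_string B(1)]) (use * in simp)
        also have "\<dots> = gpath C G (\<lambda>k. vert n (g k))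
            (\<lambda>k. gpath C G (vert n) (edge n) (g k) (g (Suc k) - g k)) (f k) (f (Suc k) - f k)"
          by (rule gpath_cong) (use * B in auto)
        also have "\<dots> = gpath C G (vert n) (edge n) (g (f k)) (g (f (Suc k)) - g (f k))"
          using gpath_reindex[OF nerve_string g *(1)] *(2) by simp
        also have "\<dots> = edge l k \<cdot> ?c"
          using C(3)[OF k] k by simp
        finally show ?thesis by (rule sym)
      qed
    qed
    then show "FAr (nerve_of C G) (\<alpha> \<cdot>\<^bsub>op_cat Delta\<^esub> \<beta>) =
        FAr (nerve_of C G) \<alpha> \<cdot> FAr (nerve_of C G) \<beta>"
      by (simp add: \<alpha> \<beta>)
  next
    fix \<alpha> assume \<alpha>: "\<alpha> \<in> Ar (op_cat Delta)"
    obtain m n f where "\<alpha> = (m, n, f)" by (rule prod_cases3)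
    then show "FAr (nerve_of C G) \<alpha> \<in>
      Hom C (FOb (nerve_of C G) (Dom (op_cat Delta) \<alpha>)) (FOb (nerve_of C G) (Cod (op_cat Delta) \<alpha>))"
      using \<alpha> nerve_of_map(1) by simp
  qed simp
  then show ?thesis
    by (simp add: Ob_Simp nerve_of_def)
qed

end

section \<open>Recovering objects, arrows and composition from low degrees of the nerve\<close>

definition edge_arr :: "nat \<Rightarrow> nat \<Rightarrow> nat \<times> nat \<times> (nat \<Rightarrow> nat)" where
  "edge_arr n k = (1, n, \<lambda>i\<in>{..1}. k + i)"

lemma vertex_Ar: "k \<le> n \<Longrightarrow> vertex n k \<in> Ar Delta"
  by (auto simp: vertex_def Ar_Delta mono_on_def)

lemma edge_arr_Ar: "k < n \<Longrightarrow> edge_arr n k \<in> Ar Delta"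
  by (auto simp: edge_arr_def Ar_Delta mono_on_def)

lemma degeneracy_Ar: "(n, 0, \<lambda>i\<in>{..n}. 0) \<in> Ar Delta"
  by (auto simp: Ar_Delta mono_on_def)

lemma inner_face_Ar: "(1, 2, \<lambda>i\<in>{..1}. 2 * i) \<in> Ar Delta"
  by (auto simp: Ar_Delta mono_on_def)

context groupoid_in
begin

text \<open>As \<open>N 0\<close>, \<open>N 1\<close> and \<open>N 2\<close> are chosen objects,
  this arrow and the next two compare them with \<open>G0 G\<close>, \<open>G1 G\<close> and the
  object of composable pairs. The edge argument \<open>s\<close> is a placeholder, since a string of
  length \<open>0\<close> has no edges.\<close>

definition "unit_string = nerve_tuple C G 0 (G0 G) (\<lambda>_. Ident C (G0 G)) (\<lambda>_. s)"

definition "arrow_string =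
  nerve_tuple C G 1 (G1 G) (\<lambda>k. if k = 0 then d1 else d0) (\<lambda>_. Ident C (G1 G))"

definition "pair_string = nerve_tuple C G 2 (pb_ob C d0 d1)
  (\<lambda>k. if k = 0 then d1 \<cdot> pb_fst C d0 d1 else if k = 1 then d1 \<cdot> pb_snd C d0 d1
     else d0 \<cdot> pb_snd C d0 d1)
  (\<lambda>k. if k = 0 then pb_fst C d0 d1 else pb_snd C d0 d1)"

lemma unit_string:
  "unit_string \<in> Hom C (G0 G) (N 0)" "vert 0 0 \<cdot> unit_string = Ident C (G0 G)"
proof -
  have "is_string C G 0 (G0 G) (\<lambda>_. Ident C (G0 G)) (\<lambda>_. s)"
    by (auto simp: is_string_def Hom_iff)
  note 1 = nerve_tuple_simps[OF this]
  show "unit_string \<in> Hom C (G0 G) (N 0)" "vert 0 0 \<cdot> unit_string = Ident C (G0 G)"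
    using 1(1) 1(2)[of 0] by (simp_all add: unit_string_def)
qed

lemma arrow_string:
  "arrow_string \<in> Hom C (G1 G) (N 1)" "vert 1 0 \<cdot> arrow_string = d1" "vert 1 1 \<cdot> arrow_string = d0"
  "edge 1 0 \<cdot> arrow_string = Ident C (G1 G)"
proof -
  have "is_string C G 1 (G1 G) (\<lambda>k. if k = 0 then d1 else d0) (\<lambda>_. Ident C (G1 G))"
    by (auto simp: is_string_def Hom_iff)
  note 1 = nerve_tuple_simps[OF this]
  show "arrow_string \<in> Hom C (G1 G) (N 1)" "vert 1 0 \<cdot> arrow_string = d1"
    "vert 1 1 \<cdot> arrow_string = d0" "edge 1 0 \<cdot> arrow_string = Ident C (G1 G)"
    using 1(1) 1(2)[of 0] 1(2)[of 1] 1(3)[of 0] by (simp_all add: arrow_string_def)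
qed

lemma pair_string:
  "pair_string \<in> Hom C (pb_ob C d0 d1) (N 2)"
  "edge 2 0 \<cdot> pair_string = pb_fst C d0 d1" "edge 2 1 \<cdot> pair_string = pb_snd C d0 d1"
  "vert 2 0 \<cdot> pair_string = d1 \<cdot> pb_fst C d0 d1" "vert 2 2 \<cdot> pair_string = d0 \<cdot> pb_snd C d0 d1"
proof -
  note P = pb_simps[OF G_Hom(1,2)]
  have "is_string C G 2 (pb_ob C d0 d1)
     (\<lambda>k. if k = 0 then d1 \<cdot> pb_fst C d0 d1 else if k = 1 then d1 \<cdot> pb_snd C d0 d1
        else d0 \<cdot> pb_snd C d0 d1)
     (\<lambda>k. if k = 0 then pb_fst C d0 d1 else pb_snd C d0 d1)"
    using P Hom_Ob[OF P(1)] by (auto simp: is_string_def Hom_iff)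
  note 1 = nerve_tuple_simps[OF this]
  show "pair_string \<in> Hom C (pb_ob C d0 d1) (N 2)"
    "edge 2 0 \<cdot> pair_string = pb_fst C d0 d1" "edge 2 1 \<cdot> pair_string = pb_snd C d0 d1"
    "vert 2 0 \<cdot> pair_string = d1 \<cdot> pb_fst C d0 d1" "vert 2 2 \<cdot> pair_string = d0 \<cdot> pb_snd C d0 d1"
    using 1(1) 1(3)[of 0] 1(3)[of 1] 1(2)[of 0] 1(2)[of 2] by (simp_all add: pair_string_def)
qed

text \<open>Relates the simplicial operator of a vertex to the projection of the string object;
  \<open>unit_string\<close> corrects for the choice of \<open>N 0\<close>. With naturality, this
  reads off the components of a simplicial map.\<close>

lemma nerve_of_vertex:
  assumes "k \<le> n"
  shows "FAr (nerve_of C G) (vertex n k) = unit_string \<cdot> vert n k"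
proof -
  note 1 = nerve_of_map[OF vertex_Ar[OF assms, unfolded vertex_def], folded vertex_def]
  show ?thesis
    by (rule nerve_ext[OF 1(1)])
      (use 1(2)[of 0] assms unit_string Comp_reassoc[OF unit_string(2,1)] in \<open>auto simp: Hom_iff\<close>)
qed

lemma nerve_of_edge:
  assumes "k < n"
  shows "FAr (nerve_of C G) (edge_arr n k) = arrow_string \<cdot> edge n k"
proof -
  note 1 = nerve_of_map[OF edge_arr_Ar[OF assms, unfolded edge_arr_def], folded edge_arr_def]
  note 2 = nerve_stringD(4,5)[OF assms]
  have "vert 1 j \<cdot> FAr (nerve_of C G) (edge_arr n k) = vert 1 j \<cdot> (arrow_string \<cdot> edge n k)"
    if "j \<le> 1" for j
    using that 1(2)[of j] assms 2 Comp_reassoc[OF arrow_string(2,1), of "G0 G" "edge n k"]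
      Comp_reassoc[OF arrow_string(3,1), of "G0 G" "edge n k"] by (auto simp: le_Suc_eq Hom_iff)
  moreover have "edge 1 0 \<cdot> FAr (nerve_of C G) (edge_arr n k) =
      edge 1 0 \<cdot> (arrow_string \<cdot> edge n k)"
    using 1(3)[of 0] assms gpath_1[OF nerve_string assms]
      Comp_reassoc[OF arrow_string(4,1), of "G1 G" "edge n k"]
          by (auto simp: Hom_iff simp del: gpath_simps)
  ultimately show ?thesis
    using assms arrow_string(1) by - (rule nerve_ext[OF 1(1)]; auto simp: Hom_iff)
qed

text \<open>The degeneracy along \<open>[1] \<rightarrow> [0]\<close> sends an object to the path of
  length \<open>0\<close> at it, that is, to its identity arrow.\<close>

lemma arrow_string_unit:
  "arrow_string \<cdot> s = FAr (nerve_of C G) (1, 0, \<lambda>i\<in>{..1}. 0) \<cdot> unit_string"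
proof -
  note 1 = nerve_of_map[OF degeneracy_Ar[of 1]]
  have "vert 1 j \<cdot> (arrow_string \<cdot> s) = vert 1 j \<cdot> (FAr (nerve_of C G) (1, 0, \<lambda>i\<in>{..1}. 0) \<cdot>
      unit_string)"
    if "j \<le> 1" for j
    using that Comp_reassoc[OF arrow_string(2,1), of "G0 G" s]
        Comp_reassoc[OF arrow_string(3,1), of "G0 G" s]
      ds unit_string Comp_reassoc[OF 1(2)[of j] 1(1), of "G0 G" unit_string]
          by (auto simp: le_Suc_eq Hom_iff)
  moreover have "edge 1 0 \<cdot> (arrow_string \<cdot> s) =
      edge 1 0 \<cdot> (FAr (nerve_of C G) (1, 0, \<lambda>i\<in>{..1}. 0) \<cdot> unit_string)"
    using Comp_reassoc[OF arrow_string(4,1), of "G1 G" s] unit_string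
      Comp_reassoc[OF 1(3)[of 0] 1(1), of "G1 G" unit_string] by (auto simp: Hom_iff)
  ultimately show ?thesis
    using arrow_string(1) unit_string(1) 1(1)
    by - (rule nerve_ext[of _ "G0 G" 1]; auto simp: Hom_iff)
qed

text \<open>The map with values \<open>0\<close> and \<open>2\<close> skips the middle vertex, so
  its edge is the path of length two from \<open>0\<close>: the inner face is composition.\<close>

lemma edge_inner_face:
  "edge 1 0 \<cdot> FAr (nerve_of C G) (1, 2, \<lambda>i\<in>{..1}. 2 * i) = edge 2 0 \<star> edge 2 1"
  using nerve_of_map(3)[OF inner_face_Ar, of 0] gpath_1[OF nerve_string, of 0 2]
  by (simp add: numeral_2_eq_2 del: gpath_simps(1))

lemma gcomp_projections: "pb_fst C d0 d1 \<star> pb_snd C d0 d1 = Gm G"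
proof -
  note P = pb_simps[OF G_Hom(1,2)]
  have "pb_pair C d0 d1 (pb_fst C d0 d1) (pb_snd C d0 d1) = Ident C (pb_ob C d0 d1)"
    by (rule pb_ext[OF G_Hom(1,2), of _ "pb_ob C d0 d1"])
      (use pb_pair_simps[OF G_Hom(1,2) P] P Hom_Ob[OF P(1)] in \<open>auto simp: Hom_iff\<close>)
  then show ?thesis
    by (simp add: gcomp_def)
qed

text \<open>Composition of \<open>G\<close> read inside the nerve. Together with
  \<open>arrow_string_unit\<close> it turns naturality of a simplicial map into the axioms of an
  internal functor.\<close>

lemma arrow_string_comp:
  "arrow_string \<cdot> Gm G = FAr (nerve_of C G) (1, 2, \<lambda>i\<in>{..1}. 2 * i) \<cdot> pair_string"
proof -
  let ?d = "FAr (nerve_of C G) (1, 2, \<lambda>i\<in>{..1}. 2 * i)"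
  note P = pb_simps[OF G_Hom(1,2)]
  note 1 = nerve_of_map[OF inner_face_Ar]
  note a = arrow_string and p = pair_string
  have [simp]: "arrow_string \<in> Ar C" "Dom C arrow_string = G1 G" "Cod C arrow_string = N 1"
    "?d \<in> Ar C" "Dom C ?d = N 2" "Cod C ?d = N 1"
    "pair_string \<in> Ar C" "Dom C pair_string = pb_ob C d0 d1" "Cod C pair_string = N 2"
    using a(1) p(1) 1(1) by (auto simp: Hom_iff)
  have "vert 1 j \<cdot> (arrow_string \<cdot> Gm G) = vert 1 j \<cdot> (?d \<cdot> pair_string)" if "j \<le> 1" for j
  proof -
    have "vert 1 j \<cdot> (?d \<cdot> pair_string) = vert 2 (2 * j) \<cdot> pair_string"
      using Comp_reassoc[OF 1(2)[OF that] 1(1), of "G0 G" pair_string] that by (simp add: Hom_iff)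
    then show ?thesis
      using that Comp_reassoc[OF a(2,1), of "G0 G" "Gm G"] Comp_reassoc[OF a(3,1), of "G0 G"
          "Gm G"] dm p
      by (auto simp: le_Suc_eq Hom_iff)
  qed
  moreover have "edge 1 0 \<cdot> (arrow_string \<cdot> Gm G) = edge 1 0 \<cdot> (?d \<cdot> pair_string)"
  proof -
    have "edge 1 0 \<cdot> (?d \<cdot> pair_string) = (edge 2 0 \<star> edge 2 1) \<cdot> pair_string"
      using Comp_reassoc[OF edge_inner_face 1(1), of "G1 G" pair_string] by (simp add: Hom_iff)
    also have "\<dots> = (edge 2 0 \<cdot> pair_string) \<star> (edge 2 1 \<cdot> pair_string)"
      by (rule gc_comp[OF _ _ _ p(1)])
        (use nerve_stringD(3)[of 0 2] nerve_stringD(3)[of 1 2] nerve_stringD(5)[of 0 2]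
           nerve_stringD(4)[of 1 2] in simp_all)
    also have "\<dots> = Gm G"
      unfolding p(2,3) by (rule gcomp_projections)
    finally show ?thesis
      using Comp_reassoc[OF a(4,1), of "G1 G" "Gm G"] by (simp add: Hom_iff)
  qed
  ultimately show ?thesis
    using 1(1) by - (rule nerve_ext[of _ "pb_ob C d0 d1" 1]; auto simp: Hom_iff)
qed

end

section \<open>Internal functors and their nerves\<close>

locale groupoid_pair = lex_category C + G: groupoid_in C G + H: groupoid_in C H for C (structure)
    and G H
begin

lemma functorD:
  assumes "internal_functor C G H f0 f1"
  shows "f0 \<in> Hom C (G0 G) (G0 H)" "f1 \<in> Hom C (G1 G) (G1 H)"
    "Gd0 H \<cdot> f1 = f0 \<cdot> Gd0 G" "Gd1 H \<cdot> f1 = f0 \<cdot> Gd1 G" "Gs H \<cdot> f0 = f1 \<cdot> Gs G"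
    "f1 \<cdot> Gm G = gcomp C H (f1 \<cdot> pb_fst C (Gd0 G) (Gd1 G)) (f1 \<cdot> pb_snd C (Gd0 G) (Gd1 G))"
  using assms by (auto simp: internal_functor_def)

lemma functor_d:
  assumes "internal_functor C G H f0 f1" "x \<in> Hom C Q (G1 G)"
  shows "Gd0 H \<cdot> (f1 \<cdot> x) = f0 \<cdot> (Gd0 G \<cdot> x)" "Gd1 H \<cdot> (f1 \<cdot> x) = f0 \<cdot> (Gd1 G \<cdot> x)"
  using functorD(1,2)[OF assms(1)] assms(2)
    Comp_reassoc[OF functorD(3)[OF assms(1)] functorD(2)[OF assms(1)], of "G0 H" x]
    Comp_reassoc[OF functorD(4)[OF assms(1)] functorD(2)[OF assms(1)], of "G0 H" x]
  by (auto simp: Hom_iff)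

text \<open>The axiom on \<open>Gm G\<close> is the case of the generic composable pair;
  precomposing it with the pairing of \<open>x\<close> and \<open>y\<close> gives every other
  case.\<close>

lemma functor_gcomp:
  assumes F: "internal_functor C G H f0 f1"
    and xy: "x \<in> Hom C Q (G1 G)" "y \<in> Hom C Q (G1 G)" "Gd0 G \<cdot> x = Gd1 G \<cdot> y"
  shows "f1 \<cdot> gcomp C G x y = gcomp C H (f1 \<cdot> x) (f1 \<cdot> y)"
proof -
  note f = functorD[OF F] and P = pb_simps[OF G.G_Hom(1,2)]
    and h = pb_pair_simps[OF G.G_Hom(1,2) xy]
  let ?h = "pb_pair C (Gd0 G) (Gd1 G) x y"
  have "f1 \<cdot> gcomp C G x y = (f1 \<cdot> Gm G) \<cdot> ?h"
    using f(2) h(1) by (auto simp: gcomp_def Hom_iff)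
  also have "\<dots> = gcomp C H (f1 \<cdot> pb_fst C (Gd0 G) (Gd1 G) \<cdot> ?h) (f1 \<cdot> pb_snd C (Gd0 G) (Gd1 G) \<cdot>
      ?h)"
    unfolding f(6)
    by (rule H.gc_comp[OF _ _ _ h(1)]) (use f(1,2) P functor_d[OF F] in \<open>auto simp: Hom_iff\<close>)
  also have "\<dots> = gcomp C H (f1 \<cdot> x) (f1 \<cdot> y)"
    using h P f(2) by (auto simp: Hom_iff)
  finally show ?thesis .
qed

lemma functor_string:
  assumes F: "internal_functor C G H f0 f1" and str: "is_string C G n Q v e"
  shows "is_string C H n Q (\<lambda>k. f0 \<cdot> v k) (\<lambda>k. f1 \<cdot> e k)"
  unfolding is_string_def
proof (intro conjI allI impI)
  fix k assume k: "k < n"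
  show "Gd1 H \<cdot> (f1 \<cdot> e k) = f0 \<cdot> v k" "Gd0 H \<cdot> (f1 \<cdot> e k) = f0 \<cdot> v (Suc k)"
    using functor_d[OF F G.is_stringD(3)[OF str k]] G.is_stringD(4,5)[OF str k] by auto
qed (use G.is_stringD[OF str] functorD(1,2)[OF F] in \<open>auto intro: Comp_Hom\<close>)

lemma functor_gpath:
  assumes F: "internal_functor C G H f0 f1" and str: "is_string C G n Q v e" and "i + l \<le> n"
  shows "f1 \<cdot> gpath C G v e i l = gpath C H (\<lambda>k. f0 \<cdot> v k) (\<lambda>k. f1 \<cdot> e k) i l"
  using assms(3)
proof (induction l)
  case 0
  then have "v i \<in> Hom C Q (G0 G)"
    using G.is_stringD(2)[OF str, of i] by simp
  then show ?case
    using Comp_reassoc[OF functorD(5)[OF F] functorD(1)[OF F], of "G1 H" "v i"] functorD(1,2)[OF F]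
    by (auto simp: Hom_iff)
next
  case (Suc l)
  then show ?case
    using functor_gcomp[OF F, of "gpath C G v e i l" Q "e (i + l)"] G.is_stringD(3-5)[OF str, of
        "i + l"]
      G.gpath_Hom[OF str, of i l] by simp
qed

lemma nerve_component:
  assumes F: "internal_functor C G H f0 f1"
  defines "t \<equiv> \<lambda>n. nerve_tuple C H n (nerve_ob C G n)
    (\<lambda>k. f0 \<cdot> nerve_vert C G n k) (\<lambda>k. f1 \<cdot> nerve_edge C G n k)"
  shows "t n \<in> Hom C (nerve_ob C G n) (nerve_ob C H n)"
    "k \<le> n \<Longrightarrow> nerve_vert C H n k \<cdot> t n = f0 \<cdot> nerve_vert C G n k"
    "k < n \<Longrightarrow> nerve_edge C H n k \<cdot> t n = f1 \<cdot> nerve_edge C G n k"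
  using H.nerve_tuple_simps[OF functor_string[OF F G.nerve_string]] by (simp_all add: t_def)

text \<open>Maps into a nerve object of \<open>H\<close> are compared on vertices and edges. On
  edges the point is that a functor commutes with composites of paths, which is
  \<open>functor_gpath\<close>.\<close>

lemma nerve_map_nat_trans:
  assumes F: "internal_functor C G H f0 f1"
  defines "t \<equiv> \<lambda>n. nerve_tuple C H n (nerve_ob C G n)
    (\<lambda>k. f0 \<cdot> nerve_vert C G n k) (\<lambda>k. f1 \<cdot> nerve_edge C G n k)"
  shows "is_nat_trans (op_cat Delta) C (nerve_of C G) (nerve_of C H) t"
proof -
  have t: "t n = nerve_tuple C H n (nerve_ob C G n)
    (\<lambda>k. f0 \<cdot> nerve_vert C G n k) (\<lambda>k. f1 \<cdot> nerve_edge C G n k)" for n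
    by (simp add: t_def)
  note T = nerve_component[OF F, folded t] and f = functorD(1,2)[OF F]
  have "t m \<cdot> FAr (nerve_of C G) (m, n, g) = FAr (nerve_of C H) (m, n, g) \<cdot> t n"
    if g: "(m, n, g) \<in> Ar Delta" for m n g
  proof (rule H.nerve_ext)
    note A = G.nerve_of_map[OF g] and B = H.nerve_of_map[OF g]
    let ?a = "FAr (nerve_of C G) (m, n, g)" and ?b = "FAr (nerve_of C H) (m, n, g)"
    show "t m \<cdot> ?a \<in> Hom C (nerve_ob C G n) (nerve_ob C H m)"
      "?b \<cdot> t n \<in> Hom C (nerve_ob C G n) (nerve_ob C H m)"
      using A(1) B(1) T(1) by (auto intro: Comp_Hom)
    fix k
    show "nerve_vert C H m k \<cdot> (t m \<cdot> ?a) = nerve_vert C H m k \<cdot> (?b \<cdot> t n)" if k: "k \<le> m"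
    proof -
      have "g k \<le> n" using g k by (auto simp: Ar_Delta)
      then show ?thesis
        using Comp_reassoc[OF T(2)[OF k] T(1), of "G0 H" ?a] Comp_reassoc[OF B(2)[OF k] B(1), of
            "G0 H" "t n"]
          A(1) A(2)[OF k] k T f(1) T(2)[of "g k" n] by (auto simp: Hom_iff)
    qed
    show "nerve_edge C H m k \<cdot> (t m \<cdot> ?a) = nerve_edge C H m k \<cdot> (?b \<cdot> t n)" if k: "k < m"
    proof -
      have *: "g k + (g (Suc k) - g k) \<le> n"
        using g k by (auto simp: Ar_Delta mono_on_def)
      have "nerve_edge C H m k \<cdot> (t m \<cdot> ?a) =
          f1 \<cdot> gpath C G (nerve_vert C G n) (nerve_edge C G n) (g k) (g (Suc k) - g k)"
        using Comp_reassoc[OF T(3)[OF k] T(1), of "G1 H" ?a] A(1) A(3)[OF k] k f(2)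
            by (auto simp: Hom_iff)
      also have "\<dots> = gpath C H (\<lambda>j. f0 \<cdot> nerve_vert C G n j) (\<lambda>j. f1 \<cdot> nerve_edge C G n j)
          (g k) (g (Suc k) - g k)"
        by (rule functor_gpath[OF F G.nerve_string *])
      also have "\<dots> = gpath C H (\<lambda>j. nerve_vert C H n j \<cdot> t n) (\<lambda>j. nerve_edge C H n j \<cdot> t n)
          (g k) (g (Suc k) - g k)"
        by (rule H.gpath_cong) (use * T(2,3)[of _ n] in auto)
      also have "\<dots> = gpath C H (nerve_vert C H n) (nerve_edge C H n) (g k) (g (Suc k) - g k) \<cdot> t n"
        by (rule H.gpath_comp[OF H.nerve_string T(1) *, symmetric])
      also have "\<dots> = nerve_edge C H m k \<cdot> (?b \<cdot> t n)"
        using Comp_reassoc[OF B(3)[OF k] B(1), of "G1 H" "t n"] T(1)[of n] k by (auto simp: Hom_iff)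
      finally show ?thesis .
    qed
  qed
  then have "t (Dom Delta \<alpha>) \<cdot> FAr (nerve_of C G) \<alpha> = FAr (nerve_of C H) \<alpha> \<cdot> t (Cod Delta \<alpha>)"
    if "\<alpha> \<in> Ar Delta" for \<alpha>
    using that by (cases \<alpha> rule: prod_cases3) simp
  then show ?thesis
    using T(1) by (simp add: is_nat_trans_def)
qed

text \<open>The candidates for \<open>f0\<close> and \<open>f1\<close> are the components in degrees
  \<open>0\<close> and \<open>1\<close>, transported by the comparison arrows. Naturality along
  vertices and consecutive edges fixes every component, while naturality along the degeneracy
  \<open>[1] \<rightarrow> [0]\<close> and the inner face of \<open>[2]\<close> gives compatibility
  with identities and composition.\<close>

lemma nerve_full:
  assumes nat: "is_nat_trans (op_cat Delta) C (nerve_of C G) (nerve_of C H) \<tau>"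
  obtains f0 f1 where "internal_functor C G H f0 f1"
    "\<And>n. \<tau> n = nerve_tuple C H n (nerve_ob C G n)
        (\<lambda>k. f0 \<cdot> nerve_vert C G n k) (\<lambda>k. f1 \<cdot> nerve_edge C G n k)"
proof -
  define f0 where "f0 = nerve_vert C H 0 0 \<cdot> (\<tau> 0 \<cdot> G.unit_string)"
  define f1 where "f1 = nerve_edge C H 1 0 \<cdot> (\<tau> 1 \<cdot> G.arrow_string)"
  have \<tau> [simp]: "\<tau> n \<in> Ar C" "Dom C (\<tau> n) = nerve_ob C G n" "Cod C (\<tau> n) = nerve_ob C H n" for n
    using is_nat_trans_simps[OF nat, of n] by auto
  have natural: "\<tau> m \<cdot> FAr (nerve_of C G) (m, n, g) = FAr (nerve_of C H) (m, n, g) \<cdot> \<tau> n"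
    if "(m, n, g) \<in> Ar Delta" for m n g
    using is_nat_trans_natural[OF nat, of "(m, n, g)" n m] that by simp
  have [simp]: "G.unit_string \<in> Ar C" "Dom C G.unit_string = G0 G" "Cod C G.unit_string =
      nerve_ob C G 0"
    "G.arrow_string \<in> Ar C" "Dom C G.arrow_string = G1 G" "Cod C G.arrow_string = nerve_ob C G 1"
    "G.pair_string \<in> Ar C" "Dom C G.pair_string = pb_ob C (Gd0 G) (Gd1 G)" "Cod C G.pair_string =
        nerve_ob C G 2"
    using G.unit_string(1) G.arrow_string(1) G.pair_string(1) by (auto simp: Hom_iff)
  have f0: "f0 \<in> Hom C (G0 G) (G0 H)" and f1: "f1 \<in> Hom C (G1 G) (G1 H)"
    by (auto simp: f0_def f1_def Hom_iff)
  then have [simp]: "f0 \<in> Ar C" "Dom C f0 = G0 G" "Cod C f0 = G0 H"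
    "f1 \<in> Ar C" "Dom C f1 = G1 G" "Cod C f1 = G1 H" by (auto simp: Hom_iff)
  have [simp]: "FAr (nerve_of C G) (m, n, g) \<in> Ar C" "Dom C (FAr (nerve_of C G) (m, n, g)) =
      nerve_ob C G n"
    "Cod C (FAr (nerve_of C G) (m, n, g)) = nerve_ob C G m" "FAr (nerve_of C H) (m, n, g) \<in> Ar C"
    "Dom C (FAr (nerve_of C H) (m, n, g)) = nerve_ob C H n"
    "Cod C (FAr (nerve_of C H) (m, n, g)) = nerve_ob C H m"
    if "(m, n, g) \<in> Ar Delta" for m n g
    using G.nerve_of_map(1)[OF that] H.nerve_of_map(1)[OF that] by (auto simp: Hom_iff)
  have vert: "nerve_vert C H n k \<cdot> \<tau> n = f0 \<cdot> nerve_vert C G n k" if k: "k \<le> n" for n k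
  proof -
    note v = vertex_Ar[OF k, unfolded vertex_def]
    have "nerve_vert C H n k \<cdot> \<tau> n = nerve_vert C H 0 0 \<cdot> (FAr (nerve_of C H) (vertex n k) \<cdot> \<tau> n)"
      using Comp_reassoc[OF H.nerve_of_map(2)[OF v, of 0] H.nerve_of_map(1)[OF v], of "G0 H" "\<tau> n"]
      by (simp add: vertex_def Hom_iff)
    also have "\<dots> = nerve_vert C H 0 0 \<cdot> (\<tau> 0 \<cdot> FAr (nerve_of C G) (vertex n k))"
      using natural[OF v] by (simp add: vertex_def)
    also have "\<dots> = f0 \<cdot> nerve_vert C G n k"
      using k by (simp add: G.nerve_of_vertex f0_def)
    finally show ?thesis .
  qed
  have edge: "nerve_edge C H n k \<cdot> \<tau> n = f1 \<cdot> nerve_edge C G n k" if k: "k < n" for n k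
  proof -
    note v = edge_arr_Ar[OF k, unfolded edge_arr_def]
    have "nerve_edge C H 1 0 \<cdot> FAr (nerve_of C H) (edge_arr n k) = nerve_edge C H n k"
      using H.nerve_of_map(3)[OF v, of 0] H.gpath_1[OF H.nerve_string k]
      by (simp add: edge_arr_def del: gpath_simps)
    then have "nerve_edge C H n k \<cdot> \<tau> n = nerve_edge C H 1 0 \<cdot> (FAr (nerve_of C H) (edge_arr n k)
        \<cdot> \<tau> n)"
      using Comp_reassoc[OF _ H.nerve_of_map(1)[OF v], of "nerve_edge C H 1 0" _ "G1 H" "\<tau> n"]
      by (simp add: edge_arr_def Hom_iff)
    also have "\<dots> = nerve_edge C H 1 0 \<cdot> (\<tau> 1 \<cdot> FAr (nerve_of C G) (edge_arr n k))"
      using natural[OF v] by (simp add: edge_arr_def)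
    also have "\<dots> = f1 \<cdot> nerve_edge C G n k"
      using k by (simp add: G.nerve_of_edge f1_def)
    finally show ?thesis .
  qed
  have "internal_functor C G H f0 f1"
    unfolding internal_functor_def
  proof (intro conjI f0 f1)
    \<comment> \<open>Vertex \<open>1\<close> of a \<open>1\<close>-simplex is its target, given by
      \<open>Gd0\<close>, and vertex \<open>0\<close> its source, given by
      \<open>Gd1\<close>.\<close>
    have "Gd0 H \<cdot> nerve_edge C H 1 0 = nerve_vert C H 1 1" "Gd1 H \<cdot> nerve_edge C H 1 0 =
        nerve_vert C H 1 0"
      using H.nerve_stringD(4,5)[of 0 1] by simp_all
    then have "Gd0 H \<cdot> f1 = nerve_vert C H 1 1 \<cdot> (\<tau> 1 \<cdot> G.arrow_string)"
      "Gd1 H \<cdot> f1 = nerve_vert C H 1 0 \<cdot> (\<tau> 1 \<cdot> G.arrow_string)"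
      unfolding f1_def
      using Comp_reassoc[of "Gd0 H" "nerve_edge C H 1 0" _ "nerve_ob C H 1" "G1 H" "G0 H" "\<tau> 1 \<cdot>
          G.arrow_string"]
        Comp_reassoc[of "Gd1 H" "nerve_edge C H 1 0" _ "nerve_ob C H 1" "G1 H" "G0 H" "\<tau> 1 \<cdot>
            G.arrow_string"]
      by (simp_all add: Hom_iff)
    then show "Gd0 H \<cdot> f1 = f0 \<cdot> Gd0 G" "Gd1 H \<cdot> f1 = f0 \<cdot> Gd1 G"
      using Comp_reassoc[OF vert[of 1 1], of "nerve_ob C G 1" "nerve_ob C H 1" "G0 H"
          G.arrow_string]
        Comp_reassoc[OF vert[of 0 1], of "nerve_ob C G 1" "nerve_ob C H 1" "G0 H" G.arrow_string]
        G.arrow_string by (simp_all add: Hom_iff)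
    let ?d = "(1, 0, \<lambda>i\<in>{..1}. 0)"
    note d = degeneracy_Ar[of 1]
    have "f1 \<cdot> Gs G = nerve_edge C H 1 0 \<cdot> (\<tau> 1 \<cdot> (FAr (nerve_of C G) ?d \<cdot> G.unit_string))"
      by (simp add: f1_def G.arrow_string_unit)
    also have "\<dots> = nerve_edge C H 1 0 \<cdot> ((\<tau> 1 \<cdot> FAr (nerve_of C G) ?d) \<cdot> G.unit_string)"
      using d by simp
    also have "\<dots> = (nerve_edge C H 1 0 \<cdot> FAr (nerve_of C H) ?d) \<cdot> (\<tau> 0 \<cdot> G.unit_string)"
      unfolding natural[OF d] using d by simp
    also have "\<dots> = Gs H \<cdot> f0"
      using H.nerve_of_map(3)[OF d, of 0] by (simp add: f0_def)
    finally show "Gs H \<cdot> f0 = f1 \<cdot> Gs G" ..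
    let ?d = "(1, 2, \<lambda>i\<in>{..1}. 2 * i)"
    note d = inner_face_Ar
    have "f1 \<cdot> Gm G = nerve_edge C H 1 0 \<cdot> (\<tau> 1 \<cdot> (FAr (nerve_of C G) ?d \<cdot> G.pair_string))"
      by (simp add: f1_def G.arrow_string_comp)
    also have "\<dots> = nerve_edge C H 1 0 \<cdot> ((\<tau> 1 \<cdot> FAr (nerve_of C G) ?d) \<cdot> G.pair_string)"
      using d by simp
    also have "\<dots> = (nerve_edge C H 1 0 \<cdot> FAr (nerve_of C H) ?d) \<cdot> (\<tau> 2 \<cdot> G.pair_string)"
      unfolding natural[OF d] using d by simp
    also have "\<dots> = gcomp C H (nerve_edge C H 2 0) (nerve_edge C H 2 1) \<cdot> (\<tau> 2 \<cdot> G.pair_string)"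
      by (simp only: H.edge_inner_face)
    also have "\<dots> = gcomp C H (nerve_edge C H 2 0 \<cdot> (\<tau> 2 \<cdot> G.pair_string))
        (nerve_edge C H 2 1 \<cdot> (\<tau> 2 \<cdot> G.pair_string))"
      by (rule H.gc_comp[of _ "nerve_ob C H 2"])
        (use H.nerve_stringD(5)[of 0 2] H.nerve_stringD(4)[of 1 2] in \<open>auto simp: Hom_iff\<close>)
    also have "\<dots> = gcomp C H (f1 \<cdot> pb_fst C (Gd0 G) (Gd1 G)) (f1 \<cdot> pb_snd C (Gd0 G) (Gd1 G))"
      using Comp_reassoc[OF edge[of 0 2], of "nerve_ob C G 2" "nerve_ob C H 2" "G1 H" G.pair_string]
        Comp_reassoc[OF edge[of 1 2], of "nerve_ob C G 2" "nerve_ob C H 2" "G1 H" G.pair_string]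
        G.pair_string by (simp add: Hom_iff)
    finally show "f1 \<cdot> Gm G = gcomp C H (f1 \<cdot> pb_fst C (Gd0 G) (Gd1 G)) (f1 \<cdot> pb_snd C (Gd0 G)
        (Gd1 G))" .
  qed
  moreover have "\<tau> n = nerve_tuple C H n (nerve_ob C G n)
        (\<lambda>k. f0 \<cdot> nerve_vert C G n k) (\<lambda>k. f1 \<cdot> nerve_edge C G n k)" for n
    using nerve_component[OF \<open>internal_functor C G H f0 f1\<close>, where n = n] vert[of _ n] edge[of _ n]
    by - (rule H.nerve_ext[of _ "nerve_ob C G n" n]; auto simp: Hom_iff)
  ultimately show ?thesis
    by (rule that)
qed

text \<open>Degrees \<open>0\<close> and \<open>1\<close> suffice, since \<open>unit_string\<close>
  and \<open>arrow_string\<close> are right inverses of the vertex and edge projections and cancel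
  against them.\<close>

lemma nerve_faithful:
  assumes F: "internal_functor C G H f0 f1" and F': "internal_functor C G H f0' f1'"
    and eq: "\<And>n. nerve_tuple C H n (nerve_ob C G n)
        (\<lambda>k. f0 \<cdot> nerve_vert C G n k) (\<lambda>k. f1 \<cdot> nerve_edge C G n k) =
      nerve_tuple C H n (nerve_ob C G n)
        (\<lambda>k. f0' \<cdot> nerve_vert C G n k) (\<lambda>k. f1' \<cdot> nerve_edge C G n k)"
  shows "f0 = f0'" "f1 = f1'"
proof -
  note f = functorD(1,2)[OF F] and f' = functorD(1,2)[OF F']
  have "f0 \<cdot> nerve_vert C G 0 0 = f0' \<cdot> nerve_vert C G 0 0"
    using nerve_component(2)[OF F, of 0 0] nerve_component(2)[OF F', of 0 0] eq[of 0] by simp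
  then have "f0 \<cdot> nerve_vert C G 0 0 \<cdot> G.unit_string = f0' \<cdot> nerve_vert C G 0 0 \<cdot> G.unit_string"
    by simp
  then show "f0 = f0'"
    using G.unit_string f f' by (simp add: Hom_iff)
  have "f1 \<cdot> nerve_edge C G 1 0 = f1' \<cdot> nerve_edge C G 1 0"
    using nerve_component(3)[OF F, of 0 1] nerve_component(3)[OF F', of 0 1] eq[of 1] by simp
  then have "f1 \<cdot> nerve_edge C G 1 0 \<cdot> G.arrow_string = f1' \<cdot> nerve_edge C G 1 0 \<cdot> G.arrow_string"
    by simp
  then show "f1 = f1'"
    using G.arrow_string f f' by (simp add: Hom_iff)
qed

end

section \<open>The category of internal groupoids and full faithfulness of the nerve\<close>

lemma Grpd_cat_simps [simp]:
  "G \<in> Ob (Grpd_cat C) \<longleftrightarrow> internal_groupoid C G"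
  "(G, H, f0, f1) \<in> Ar (Grpd_cat C) \<longleftrightarrow>
     internal_groupoid C G \<and> internal_groupoid C H \<and> internal_functor C G H f0 f1"
  "Dom (Grpd_cat C) (G, H, f0, f1) = G" "Cod (Grpd_cat C) (G, H, f0, f1) = H"
  "Ident (Grpd_cat C) G = (G, G, Ident C (G0 G), Ident C (G1 G))"
  "(H, K, g0, g1) \<cdot>\<^bsub>Grpd_cat C\<^esub> (G, H', f0, f1) = (G, K, g0 \<cdot>\<^bsub>C\<^esub> f0, g1 \<cdot>\<^bsub>C\<^esub> f1)"
  by (simp_all add: Grpd_cat_def)

lemma Hom_Grpd: "f \<in> Hom (Grpd_cat C) G H \<longleftrightarrow> internal_groupoid C G \<and> internal_groupoid C H \<and>
    (\<exists>f0 f1. f = (G, H, f0, f1) \<and> internal_functor C G H f0 f1)"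
  by (auto simp: Hom_def Grpd_cat_def)

context lex_category
begin

lemma groupoid_in: "internal_groupoid C G \<Longrightarrow> groupoid_in C G"
  by unfold_locales

lemma groupoid_pair: "internal_groupoid C G \<Longrightarrow> internal_groupoid C H \<Longrightarrow> groupoid_pair C G H"
  by (intro groupoid_pair.intro groupoid_in lex_category_axioms)

lemma internal_functor_Ident:
  assumes "internal_groupoid C G"
  shows "internal_functor C G G (Ident C (G0 G)) (Ident C (G1 G))"
proof -
  interpret groupoid_in C G by (rule groupoid_in[OF assms])
  show ?thesis
    using pb_simps[OF G_Hom(1,2)] gcomp_projections by (auto simp: internal_functor_def Hom_iff)
qed

lemma internal_functor_comp:
  assumes G: "internal_groupoid C G" and H: "internal_groupoid C H" and K: "internal_groupoid C K"
    and f: "internal_functor C G H f0 f1" and g: "internal_functor C H K g0 g1"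
  shows "internal_functor C G K (g0 \<cdot> f0) (g1 \<cdot> f1)"
proof -
  interpret GH: groupoid_pair C G H by (rule groupoid_pair[OF G H])
  interpret HK: groupoid_pair C H K by (rule groupoid_pair[OF H K])
  note F = GH.functorD[OF f] and G = HK.functorD[OF g]
  have [simp]: "f0 \<in> Ar C" "Dom C f0 = G0 G" "Cod C f0 = G0 H" "f1 \<in> Ar C" "Dom C f1 = G1 G"
    "Cod C f1 = G1 H" "g0 \<in> Ar C" "Dom C g0 = G0 H" "Cod C g0 = G0 K" "g1 \<in> Ar C"
    "Dom C g1 = G1 H" "Cod C g1 = G1 K"
    using F(1,2) G(1,2) by (auto simp: Hom_iff)
  note P = pb_simps[OF GH.G.G_Hom(1,2)]
  let ?p = "pb_fst C (Gd0 G) (Gd1 G)" and ?q = "pb_snd C (Gd0 G) (Gd1 G)"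
  have [simp]: "?p \<in> Ar C" "Dom C ?p = pb_ob C (Gd0 G) (Gd1 G)" "Cod C ?p = G1 G"
    "?q \<in> Ar C" "Dom C ?q = pb_ob C (Gd0 G) (Gd1 G)" "Cod C ?q = G1 G"
    using P by (auto simp: Hom_iff)
  have "Gd0 K \<cdot> (g1 \<cdot> f1) = g0 \<cdot> (f0 \<cdot> Gd0 G)" "Gd1 K \<cdot> (g1 \<cdot> f1) = g0 \<cdot> (f0 \<cdot> Gd1 G)"
    using HK.functor_d[OF g F(2)] F(3,4) by simp_all
  moreover have "Gs K \<cdot> (g0 \<cdot> f0) = g1 \<cdot> (f1 \<cdot> Gs G)"
    using Comp_reassoc[OF G(5) G(1), of "G1 K" f0] F(5) by (simp add: Hom_iff)
  moreover have "g1 \<cdot> (f1 \<cdot> Gm G) = gcomp C K (g1 \<cdot> (f1 \<cdot> ?p)) (g1 \<cdot> (f1 \<cdot> ?q))"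
    unfolding F(6)
    by (rule HK.functor_gcomp[OF g, of _ "pb_ob C (Gd0 G) (Gd1 G)"])
      (use GH.functor_d[OF f, of ?p] GH.functor_d[OF f, of ?q] P in \<open>simp_all add: Hom_iff\<close>)
  ultimately show ?thesis
    by (simp add: internal_functor_def Hom_iff)
qed

lemma category_Grpd: "category (Grpd_cat C)"
proof
  fix f assume "f \<in> Ar (Grpd_cat C)"
  then show "Dom (Grpd_cat C) f \<in> Ob (Grpd_cat C)" "Cod (Grpd_cat C) f \<in> Ob (Grpd_cat C)"
    by (auto simp: Grpd_cat_def)
next
  fix G assume "G \<in> Ob (Grpd_cat C)"
  then show "Ident (Grpd_cat C) G \<in> Hom (Grpd_cat C) G G"
    by (auto simp: Hom_Grpd internal_functor_Ident)
next
  fix f g G H K assume "f \<in> Hom (Grpd_cat C) G H" "g \<in> Hom (Grpd_cat C) H K"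
  then show "g \<cdot>\<^bsub>Grpd_cat C\<^esub> f \<in> Hom (Grpd_cat C) G K"
    using internal_functor_comp[of G H K] by (auto simp: Hom_Grpd)
qed (auto simp: Hom_Grpd internal_functor_def Hom_iff)

lemma nerve_is_functor: "is_functor (Grpd_cat C) (Simp C) (nerve C)"
  unfolding is_functor_def
proof (intro conjI ballI impI)
  fix G assume "G \<in> Ob (Grpd_cat C)"
  then have G: "internal_groupoid C G" by simp
  interpret groupoid_pair C G G by (rule groupoid_pair[OF G G])
  show "FOb (nerve C) G \<in> Ob (Simp C)"
    by (simp add: nerve_def G.nerve_of_Ob)
  have "nerve_tuple C G n (nerve_ob C G n) (\<lambda>k. Ident C (G0 G) \<cdot> nerve_vert C G n k)
     (\<lambda>k. Ident C (G1 G) \<cdot> nerve_edge C G n k) = Ident C (nerve_ob C G n)" for n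
    using nerve_component[OF internal_functor_Ident[OF G], where n = n]
    by - (rule G.nerve_ext[of _ "nerve_ob C G n" n]; auto simp: Hom_iff)
  then show "FAr (nerve C) (Ident (Grpd_cat C) G) = Ident (Simp C) (FOb (nerve C) G)"
    by (simp add: nerve_def)
next
  fix f assume f: "f \<in> Ar (Grpd_cat C)"
  obtain G H f0 f1 where f_eq: "f = (G, H, f0, f1)" by (rule prod_cases4)
  have G: "internal_groupoid C G" and H: "internal_groupoid C H" and F:
      "internal_functor C G H f0 f1"
    using f by (simp_all add: f_eq)
  interpret groupoid_pair C G H by (rule groupoid_pair[OF G H])
  show "FAr (nerve C) f \<in> Hom (Simp C) (FOb (nerve C) (Dom (Grpd_cat C) f)) (FOb (nerve C) (Cod
      (Grpd_cat C) f))"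
    using nerve_map_nat_trans[OF F] by (simp add: f_eq nerve_def Hom_Simp
        G.nerve_of_Ob H.nerve_of_Ob)
next
  fix f g assume fg: "f \<in> Ar (Grpd_cat C)" "g \<in> Ar (Grpd_cat C)"
    "Dom (Grpd_cat C) g = Cod (Grpd_cat C) f"
  obtain G H f0 f1 where f_eq: "f = (G, H, f0, f1)" by (rule prod_cases4)
  obtain H' K g0 g1 where g_eq: "g = (H', K, g0, g1)" by (rule prod_cases4)
  have H': "H' = H" using fg(3) by (simp add: f_eq g_eq)
  have G: "internal_groupoid C G" and H: "internal_groupoid C H" and K: "internal_groupoid C K"
    and F: "internal_functor C G H f0 f1" and F': "internal_functor C H K g0 g1"
    using fg(1,2) by (simp_all add: f_eq g_eq H')
  interpret GH: groupoid_pair C G H by (rule groupoid_pair[OF G H])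
  interpret HK: groupoid_pair C H K by (rule groupoid_pair[OF H K])
  interpret GK: groupoid_pair C G K by (rule groupoid_pair[OF G K])
  have "nerve_tuple C K n (nerve_ob C G n) (\<lambda>k. (g0 \<cdot> f0) \<cdot> nerve_vert C G n k)
       (\<lambda>k. (g1 \<cdot> f1) \<cdot> nerve_edge C G n k) =
     nerve_tuple C K n (nerve_ob C H n) (\<lambda>k. g0 \<cdot> nerve_vert C H n k) (\<lambda>k. g1 \<cdot>
         nerve_edge C H n k) \<cdot>
     nerve_tuple C H n (nerve_ob C G n) (\<lambda>k. f0 \<cdot> nerve_vert C G n k) (\<lambda>k. f1 \<cdot> nerve_edge C G n k)"
    (is "?gf = ?g \<cdot> ?f") for n
  proof (rule HK.H.nerve_ext)
    note f = GH.nerve_component[OF F, where n = n] and g = HK.nerve_component[OF F', where n = n]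
      and gf = GK.nerve_component[OF internal_functor_comp[OF G H K F F'], where n = n]
    note fg = GH.functorD(1,2)[OF F] HK.functorD(1,2)[OF F']
    show "?gf \<in> Hom C (nerve_ob C G n) (nerve_ob C K n)" by (rule gf(1))
    show "?g \<cdot> ?f \<in> Hom C (nerve_ob C G n) (nerve_ob C K n)" by (rule Comp_Hom[OF f(1) g(1)])
    show "nerve_vert C K n k \<cdot> ?gf = nerve_vert C K n k \<cdot> (?g \<cdot> ?f)" if k: "k \<le> n" for k
      using Comp_reassoc[OF g(2)[OF k] g(1), of "G0 K" ?f] gf(2)[OF k] f(1) f(2)[OF k] g(1) k fg
      by (auto simp: Hom_iff)
    show "nerve_edge C K n k \<cdot> ?gf = nerve_edge C K n k \<cdot> (?g \<cdot> ?f)" if k: "k < n" for k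
      using Comp_reassoc[OF g(3)[OF k] g(1), of "G1 K" ?f] gf(3)[OF k] f(1) f(3)[OF k] g(1) k fg
      by (auto simp: Hom_iff)
  qed
  then show "FAr (nerve C) (g \<cdot>\<^bsub>Grpd_cat C\<^esub> f) = FAr (nerve C) g \<cdot>\<^bsub>Simp C\<^esub> FAr (nerve C) f"
    by (simp add: nerve_def f_eq g_eq H')
qed

lemma nerve_fully_faithful: "fully_faithful (Grpd_cat C) (Simp C) (nerve C)"
  unfolding fully_faithful_def
proof (intro conjI nerve_is_functor ballI)
  fix G H assume "G \<in> Ob (Grpd_cat C)" "H \<in> Ob (Grpd_cat C)"
  then have G: "internal_groupoid C G" and H: "internal_groupoid C H" by simp_all
  interpret groupoid_pair C G H by (rule groupoid_pair[OF G H])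
  show "bij_betw (FAr (nerve C)) (Hom (Grpd_cat C) G H) (Hom (Simp C) (FOb (nerve C) G) (FOb
      (nerve C) H))"
    unfolding bij_betw_def
  proof
    show "inj_on (FAr (nerve C)) (Hom (Grpd_cat C) G H)"
    proof (rule inj_onI)
      fix f g assume fg: "f \<in> Hom (Grpd_cat C) G H" "g \<in> Hom (Grpd_cat C) G H"
        "FAr (nerve C) f = FAr (nerve C) g"
      then obtain f0 f1 g0 g1 where *: "f = (G, H, f0, f1)" "g = (G, H, g0, g1)"
        "internal_functor C G H f0 f1" "internal_functor C G H g0 g1"
        by (auto simp: Hom_Grpd)
      have "f0 = g0" "f1 = g1"
        using nerve_faithful[OF *(3,4)] fg(3) by (simp_all add: *(1,2) nerve_def fun_eq_iff)
      then show "f = g" by (simp add: *)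
    qed
    have "FAr (nerve C) ` Hom (Grpd_cat C) G H \<subseteq> Hom (Simp C) (FOb (nerve C) G) (FOb (nerve C) H)"
      using nerve_is_functor by (auto simp: is_functor_def Hom_iff)
    moreover have "\<phi> \<in> FAr (nerve C) ` Hom (Grpd_cat C) G H"
      if "\<phi> \<in> Hom (Simp C) (FOb (nerve C) G) (FOb (nerve C) H)" for \<phi>
    proof -
      obtain \<tau> where \<phi>: "\<phi> = (nerve_of C G, nerve_of C H, \<tau>)"
        and \<tau>: "is_nat_trans (op_cat Delta) C (nerve_of C G) (nerve_of C H) \<tau>"
        using \<open>\<phi> \<in> _\<close> by (auto simp: Hom_Simp nerve_def)
      obtain f0 f1 where f: "internal_functor C G H f0 f1"
        "\<And>n. \<tau> n = nerve_tuple C H n (nerve_ob C G n)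
            (\<lambda>k. f0 \<cdot> nerve_vert C G n k) (\<lambda>k. f1 \<cdot> nerve_edge C G n k)"
        using nerve_full[OF \<tau>] by blast
      have "\<phi> = FAr (nerve C) (G, H, f0, f1)"
        using f(2) by (simp add: \<phi> nerve_def fun_eq_iff)
      moreover have "(G, H, f0, f1) \<in> Hom (Grpd_cat C) G H"
        using G H f(1) by (simp add: Hom_Grpd)
      ultimately show ?thesis by (rule image_eqI)
    qed
    ultimately show "FAr (nerve C) ` Hom (Grpd_cat C) G H =
        Hom (Simp C) (FOb (nerve C) G) (FOb (nerve C) H)"
      by blast
  qed
qed

end

text \<open>\<open>N 0\<close> is a choice of string object and so is \<open>G0 G\<close> only up to
  isomorphism. The torsion condition on degree \<open>0\<close> is phrased with
  \<open>isomorphic\<close> and is insensitive to this.\<close>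

lemma (in groupoid_in) nerve_ob_0: "isomorphic C (N 0) (G0 G)"
proof -
  have "unit_string \<cdot> vert 0 0 = Ident C (N 0)"
    using unit_string Comp_reassoc[OF unit_string(2,1), of "G0 G" "vert 0 0"]
    by - (rule nerve_ext[of _ "N 0" 0]; auto simp: Hom_iff)
  then have "iso_arr C (vert 0 0)"
    using unit_string by (intro iso_arrI[of _ "N 0" "G0 G" unit_string]) (auto simp: Hom_iff)
  then show ?thesis
    unfolding isomorphic_def by (intro bexI[of _ "vert 0 0"]) (auto simp: Hom_iff)
qed

section \<open>Internal abelian groups\<close>

lemma Ab_cat_simps [simp]:
  "A \<in> Ob (Ab_cat C) \<longleftrightarrow> internal_abelian_group C A"
  "Dom (Ab_cat C) (A, B, f) = A" "Cod (Ab_cat C) (A, B, f) = B"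
  "Ident (Ab_cat C) A = (A, A, Ident C (Acar A))"
  "(B, D, g) \<cdot>\<^bsub>Ab_cat C\<^esub> (A, B', f) = (A, D, g \<cdot>\<^bsub>C\<^esub> f)"
  by (simp_all add: Ab_cat_def)

text \<open>Additivity on the generic pair, the form used for arrows of \<open>Ab_cat\<close>;
  \<open>additive_add\<close> and \<open>additiveI\<close> translate between it and arbitrary pairs
  of elements.\<close>

definition additive :: "('o, 'm) cat \<Rightarrow> ('o, 'm) iab \<Rightarrow> ('o, 'm) iab \<Rightarrow> 'm \<Rightarrow> bool" where
  "additive C A B f \<longleftrightarrow> f \<in> Hom C (Acar A) (Acar B) \<and> f \<cdot>\<^bsub>C\<^esub> Aadd A =
     aadd C B (f \<cdot>\<^bsub>C\<^esub> pow_proj C (Acar A) 2 0) (f \<cdot>\<^bsub>C\<^esub> pow_proj C (Acar A) 2 1)"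

lemma Ar_Ab: "(A, B, f) \<in> Ar (Ab_cat C) \<longleftrightarrow>
    internal_abelian_group C A \<and> internal_abelian_group C B \<and> additive C A B f"
  by (simp add: Ab_cat_def additive_def)

lemma Hom_Ab: "\<phi> \<in> Hom (Ab_cat C) A B \<longleftrightarrow>
    internal_abelian_group C A \<and> internal_abelian_group C B \<and> (\<exists>f. \<phi> = (A, B, f) \<and>
        additive C A B f)"
  by (auto simp: Hom_def Ab_cat_def additive_def)

lemma ab_groupoid_of_simps [simp]:
  "G0 (ab_groupoid_of C A) = zero_ob C" "G1 (ab_groupoid_of C A) = Acar A"
  by (simp_all add: ab_groupoid_of_def Let_def)

locale pointed_lex_category = lex_category +
  assumes pointed: "pointed C"
begin

lemmas zero_Ob [simp] = zero_ob_Ob[OF pointed]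
lemmas to_zero = to_zero_Hom[OF pointed]
lemmas zero_ext = zero_ob_ext[OF pointed]

lemma to_zero_simps [simp]:
  assumes "a \<in> Ob C"
  shows "to_zero C a \<in> Ar C" "Dom C (to_zero C a) = a" "Cod C (to_zero C a) = zero_ob C"
  using to_zero[OF assms] by (auto simp: Hom_iff)

lemma to_zero_comp: "x \<in> Hom C a b \<Longrightarrow> to_zero C b \<cdot> x = to_zero C a"
  using Hom_Ob[of x a b] by (intro zero_ext[of _ a]) (auto simp: Hom_iff)

end

locale abelian_group_in = pointed_lex_category +
  fixes A
  assumes abelian_group: "internal_abelian_group C A"
begin

abbreviation "a \<equiv> Acar A"
abbreviation add (infixl "\<oplus>" 65) where "x \<oplus> y \<equiv> aadd C A x y"
abbreviation "zero Q \<equiv> Azero A \<cdot> to_zero C Q"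

lemma A_Hom: "Aadd A \<in> Hom C (pow_ob C a 2) a" "Azero A \<in> Hom C (zero_ob C) a" "Aneg A \<in> Hom C a a"
  using abelian_group by (simp_all add: internal_abelian_group_def Let_def)

lemma A_simps [simp]:
  "a \<in> Ob C" "Aadd A \<in> Ar C" "Dom C (Aadd A) = pow_ob C a 2" "Cod C (Aadd A) = a"
  "Azero A \<in> Ar C" "Dom C (Azero A) = zero_ob C" "Cod C (Azero A) = a"
  "Aneg A \<in> Ar C" "Dom C (Aneg A) = a" "Cod C (Aneg A) = a"
  using abelian_group A_Hom by (auto simp: internal_abelian_group_def Let_def Hom_iff)

lemma add_Hom:
  assumes "x \<in> Hom C Q a" "y \<in> Hom C Q a"
  shows "x \<oplus> y \<in> Hom C Q a"
  using pow_pair_simps(1)[OF assms] by (simp add: aadd_def Hom_iff)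

lemma add_comp:
  assumes "x \<in> Hom C Q a" "y \<in> Hom C Q a" "h \<in> Hom C R Q"
  shows "(x \<oplus> y) \<cdot> h = (x \<cdot> h) \<oplus> (y \<cdot> h)"
  using pow_pair_comp[OF assms] pow_pair_simps(1)[OF assms(1,2)] assms(3)
  by (simp add: aadd_def Hom_iff)

lemma zero_Hom: "Q \<in> Ob C \<Longrightarrow> zero Q \<in> Hom C Q a"
  by (simp add: Hom_iff)

lemma zero_comp: "h \<in> Hom C R Q \<Longrightarrow> zero Q \<cdot> h = zero R"
  using to_zero_comp[of h R Q] Hom_Ob[of h R Q] by (simp add: Hom_iff)

lemma group_axioms:
  "zero a \<oplus> Ident C a = Ident C a" "Ident C a \<oplus> zero a = Ident C a"
  "Aneg A \<oplus> Ident C a = zero a" "Ident C a \<oplus> Aneg A = zero a"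
  using abelian_group by (simp_all add: internal_abelian_group_def Let_def)

lemma add_zero:
  assumes x: "x \<in> Hom C Q a"
  shows "zero Q \<oplus> x = x" "x \<oplus> zero Q = x"
  using add_comp[OF _ _ x, of "zero a" "Ident C a"] add_comp[OF _ _ x, of "Ident C a" "zero a"]
    group_axioms zero_comp[OF x] x by (simp_all add: Hom_iff)

lemma add_neg:
  assumes x: "x \<in> Hom C Q a"
  shows "(Aneg A \<cdot> x) \<oplus> x = zero Q"
  using add_comp[OF _ _ x, of "Aneg A" "Ident C a"] group_axioms zero_comp[OF x] x
  by (simp add: Hom_iff)

text \<open>Associativity is an axiom about the three projections of the third power of
  \<open>a\<close>; evaluating it at the triple of \<open>x\<close>, \<open>y\<close> and
  \<open>z\<close> gives the general law.\<close>

lemma add_assoc: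
  assumes x: "x \<in> Hom C Q a" and y: "y \<in> Hom C Q a" and z: "z \<in> Hom C Q a"
  shows "(x \<oplus> y) \<oplus> z = x \<oplus> (y \<oplus> z)"
proof -
  let ?q = "pow_proj C a 3" and ?h = "pow_tuple C Q a 3 (\<lambda>i. [x, y, z] ! i)"
  have q: "?q 0 \<in> Hom C (pow_ob C a 3) a" "?q 1 \<in> Hom C (pow_ob C a 3) a"
      "?q 2 \<in> Hom C (pow_ob C a 3) a"
    by (simp_all add: pow_proj_Hom)
  have xyz: "[x, y, z] ! i \<in> Hom C Q a" if "i < 3" for i
    using that x y z by (auto simp: less_Suc_eq numeral_3_eq_3)
  have Q: "Q \<in> Ob C" using Hom_Ob[OF x] by simp
  note H = pow_tuple_simps[OF A_simps(1) Q, of 3 "\<lambda>i. [x, y, z] ! i", OF xyz]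
  have h: "?h \<in> Hom C Q (pow_ob C a 3)" "?q 0 \<cdot> ?h = x" "?q 1 \<cdot> ?h = y" "?q 2 \<cdot> ?h = z"
    using H(1) H(2)[of 0] H(2)[of 1] H(2)[of 2] by simp_all
  have "(?q 0 \<oplus> ?q 1 \<oplus> ?q 2) \<cdot> ?h = (?q 0 \<oplus> (?q 1 \<oplus> ?q 2)) \<cdot> ?h"
    using abelian_group by (simp add: internal_abelian_group_def Let_def)
  moreover have "(?q 0 \<oplus> ?q 1 \<oplus> ?q 2) \<cdot> ?h = (x \<oplus> y) \<oplus> z"
    by (simp only: add_comp[OF add_Hom[OF q(1,2)] q(3) h(1)] add_comp[OF q(1,2) h(1)] h)
  moreover have "(?q 0 \<oplus> (?q 1 \<oplus> ?q 2)) \<cdot> ?h = x \<oplus> (y \<oplus> z)"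
    by (simp only: add_comp[OF q(1) add_Hom[OF q(2,3)] h(1)] add_comp[OF q(2,3) h(1)] h)
  ultimately show ?thesis by simp
qed

text \<open>Adding the negative of \<open>x\<close> to both sides of \<open>x \<oplus> x = x\<close>
  leaves \<open>x\<close> on one side and zero on the other. Applied to the image of zero, this
  shows that additive maps preserve zero.\<close>

lemma idempotent_zero:
  assumes x: "x \<in> Hom C Q a" and "x \<oplus> x = x"
  shows "x = zero Q"
proof -
  have n: "Aneg A \<cdot> x \<in> Hom C Q a" using x by (simp add: Hom_iff)
  have "zero Q = (Aneg A \<cdot> x) \<oplus> (x \<oplus> x)" by (simp only: assms(2) add_neg[OF x])
  also have "\<dots> = x" by (simp only: add_assoc[OF n x x, symmetric] add_neg[OF x] add_zero[OF x])
  finally show ?thesis by (rule sym)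
qed

abbreviation "BA \<equiv> ab_groupoid_of C A"

lemma ab_groupoid_simps [simp]:
  "Gd0 BA = to_zero C a" "Gd1 BA = to_zero C a"
  "Gs BA = Azero A" "Gi BA = Aneg A"
  by (simp_all add: ab_groupoid_of_def Let_def)

lemma Gm_ab_groupoid:
  "Gm BA = pb_fst C (to_zero C a) (to_zero C a) \<oplus> pb_snd C (to_zero C a) (to_zero C a)"
  by (simp add: ab_groupoid_of_def Let_def)

text \<open>Over the zero object any two elements with the same domain are composable, so
  composition is defined everywhere and is addition.\<close>

lemma gcomp_ab_groupoid:
  assumes "x \<in> Hom C Q a" "y \<in> Hom C Q a"
  shows "gcomp C BA x y = x \<oplus> y"
proof -
  note t = to_zero[OF A_simps(1)]
  have "to_zero C a \<cdot> x = to_zero C a \<cdot> y"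
    using assms by (simp add: to_zero_comp)
  note h = pb_pair_simps[OF t t assms this]
  show ?thesis
    using add_comp[OF pb_simps(1,2)[OF t t] h(1)] h by (simp add: gcomp_def Gm_ab_groupoid)
qed

text \<open>Equations between arrows into \<open>zero_ob C\<close> hold by uniqueness; what remains
  of the groupoid axioms are the group laws.\<close>

lemma ab_groupoid_is_groupoid: "internal_groupoid C BA"
proof -
  note t = to_zero[OF A_simps(1)]
  note P = pb_simps[OF t t]
  have I: "Ident C a \<in> Hom C a a" by (simp add: Hom_iff)
  note m = add_Hom[OF P(1,2)]
  have gc: "gcomp C BA (gcomp C BA x y) z = gcomp C BA x (gcomp C BA y z)"
    if "x \<in> Hom C q a" "y \<in> Hom C q a" "z \<in> Hom C q a" for q x y z
    using that by (simp add: gcomp_ab_groupoid[of _ q] add_Hom add_assoc)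
  show ?thesis
    unfolding internal_groupoid_def Let_def
    using A_Hom t m gc zero_Hom[OF A_simps(1)] I group_axioms
    by (auto simp: gcomp_ab_groupoid[of _ a] Gm_ab_groupoid Hom_iff to_zero_comp[OF m]
        to_zero_comp[OF P(1)] to_zero_comp[OF P(2)] to_zero_comp[OF A_Hom(3)]
        intro!: zero_ext[of _ "zero_ob C"])
qed

end

section \<open>Additive maps as internal functors\<close>

context pointed_lex_category
begin

lemma abelian_group_in: "internal_abelian_group C A \<Longrightarrow> abelian_group_in C A"
  by unfold_locales

lemma additive_add:
  assumes A: "internal_abelian_group C A" and B: "internal_abelian_group C B"
    and f: "additive C A B f" and xy: "x \<in> Hom C Q (Acar A)" "y \<in> Hom C Q (Acar A)"
  shows "f \<cdot> aadd C A x y = aadd C B (f \<cdot> x) (f \<cdot> y)"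
proof -
  interpret A: abelian_group_in C A by (rule abelian_group_in[OF A])
  interpret B: abelian_group_in C B by (rule abelian_group_in[OF B])
  have F: "f \<in> Hom C (Acar A) (Acar B)" using f by (simp add: additive_def)
  have p: "pow_proj C (Acar A) 2 i \<in> Hom C (pow_ob C (Acar A) 2) (Acar A)" if "i < 2" for i
    using that by (simp add: pow_proj_Hom)
  note h = pow_pair_simps[OF xy]
  have "f \<cdot> aadd C A x y = (f \<cdot> Aadd A) \<cdot> pow_pair C (Acar A) x y"
    using F h(1) by (simp add: aadd_def Hom_iff)
  also have "\<dots> = aadd C B (f \<cdot> pow_proj C (Acar A) 2 0 \<cdot> pow_pair C (Acar A) x y)
      (f \<cdot> pow_proj C (Acar A) 2 1 \<cdot> pow_pair C (Acar A) x y)"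
    using f B.add_comp[OF Comp_Hom[OF p F] Comp_Hom[OF p F] h(1), of 0 1]
        by (simp add: additive_def)
  also have "\<dots> = aadd C B (f \<cdot> x) (f \<cdot> y)"
    using F p[of 0] p[of 1] h by (simp add: Hom_iff)
  finally show ?thesis .
qed

lemma additive_Ident:
  assumes "internal_abelian_group C A"
  shows "additive C A A (Ident C (Acar A))"
proof -
  interpret A: abelian_group_in C A by (rule abelian_group_in[OF assms])
  have p: "pow_proj C (Acar A) 2 i \<in> Hom C (pow_ob C (Acar A) 2) (Acar A)" if "i < 2" for i
    using that by (simp add: pow_proj_Hom)
  have "pow_pair C (Acar A) (pow_proj C (Acar A) 2 0) (pow_proj C (Acar A) 2 1) =
      Ident C (pow_ob C (Acar A) 2)"
    using pow_pair_simps[OF p p, of 0 1] p[of 0] p[of 1]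
    by - (rule pow2_ext[of "Acar A" _ "pow_ob C (Acar A) 2"]; simp add: Hom_iff)
  then show ?thesis
    using p[of 0] p[of 1] by (simp add: additive_def aadd_def Hom_iff)
qed

lemma additiveI:
  assumes A: "internal_abelian_group C A" and B: "internal_abelian_group C B"
    and f: "f \<in> Hom C (Acar A) (Acar B)"
    and add: "\<And>Q x y. x \<in> Hom C Q (Acar A) \<Longrightarrow> y \<in> Hom C Q (Acar A) \<Longrightarrow>
       f \<cdot> aadd C A x y = aadd C B (f \<cdot> x) (f \<cdot> y)"
  shows "additive C A B f"
proof -
  interpret A: abelian_group_in C A by (rule abelian_group_in[OF A])
  have p: "pow_proj C (Acar A) 2 i \<in> Hom C (pow_ob C (Acar A) 2) (Acar A)" if "i < 2" for i
    using that by (simp add: pow_proj_Hom)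
  have "aadd C A (pow_proj C (Acar A) 2 0) (pow_proj C (Acar A) 2 1) = Aadd A"
    using additive_Ident[OF A] p[of 0] p[of 1] by (simp add: additive_def Hom_iff)
  then show ?thesis
    using add[OF p p, of 0 1] f by (simp add: additive_def)
qed

lemma additive_comp:
  assumes A: "internal_abelian_group C A" and B: "internal_abelian_group C B"
    and D: "internal_abelian_group C D" and f: "additive C A B f" and g: "additive C B D g"
  shows "additive C A D (g \<cdot> f)"
proof (rule additiveI[OF A D])
  have F: "f \<in> Hom C (Acar A) (Acar B)" "g \<in> Hom C (Acar B) (Acar D)"
    using f g by (simp_all add: additive_def)
  then show "g \<cdot> f \<in> Hom C (Acar A) (Acar D)" by (rule Comp_Hom)
  interpret A: abelian_group_in C A by (rule abelian_group_in[OF A])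
  show "g \<cdot> f \<cdot> aadd C A x y = aadd C D (g \<cdot> f \<cdot> x) (g \<cdot> f \<cdot> y)"
    if "x \<in> Hom C Q (Acar A)" "y \<in> Hom C Q (Acar A)" for Q x y
    using additive_add[OF A B f that] additive_add[OF B D g, of "f \<cdot> x" Q
        "f \<cdot> y"] that F A.add_Hom[OF that]
    by (simp add: Hom_iff)
qed

lemma category_Ab: "category (Ab_cat C)"
proof
  fix f assume "f \<in> Ar (Ab_cat C)"
  then show "Dom (Ab_cat C) f \<in> Ob (Ab_cat C)" "Cod (Ab_cat C) f \<in> Ob (Ab_cat C)"
    by (auto simp: Ab_cat_def)
next
  fix A assume "A \<in> Ob (Ab_cat C)"
  then show "Ident (Ab_cat C) A \<in> Hom (Ab_cat C) A A"
    by (auto simp: Hom_Ab additive_Ident)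
next
  fix f g A B D assume "f \<in> Hom (Ab_cat C) A B" "g \<in> Hom (Ab_cat C) B D"
  then show "g \<cdot>\<^bsub>Ab_cat C\<^esub> f \<in> Hom (Ab_cat C) A D"
    using additive_comp[of A B D] by (auto simp: Hom_Ab)
qed (auto simp: Hom_Ab additive_def Hom_iff[of _ C])

text \<open>The object part is an endomorphism of the zero object, hence the identity, and
  preservation of composition is additivity. In the converse direction compatibility with
  \<open>Gs\<close> is preservation of zero, obtained from \<open>idempotent_zero\<close>.\<close>

lemma internal_functor_ab_groupoid:
  assumes A: "internal_abelian_group C A" and B: "internal_abelian_group C B"
  shows "internal_functor C (ab_groupoid_of C A) (ab_groupoid_of C B) f0 f1 \<longleftrightarrow>
    f0 = Ident C (zero_ob C) \<and> additive C A B f1"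
proof -
  interpret A: abelian_group_in C A by (rule abelian_group_in[OF A])
  interpret B: abelian_group_in C B by (rule abelian_group_in[OF B])
  interpret groupoid_pair C "ab_groupoid_of C A" "ab_groupoid_of C B"
    by (rule groupoid_pair[OF A.ab_groupoid_is_groupoid B.ab_groupoid_is_groupoid])
  show ?thesis
  proof
    assume F: "internal_functor C (ab_groupoid_of C A) (ab_groupoid_of C B) f0 f1"
    note f = functorD[OF F]
    have "f0 = Ident C (zero_ob C)"
      using f(1) by (intro zero_ext[of _ "zero_ob C"]) (auto simp: Hom_iff)
    moreover have "additive C A B f1"
    proof (rule additiveI[OF A B])
      show "f1 \<in> Hom C (Acar A) (Acar B)" using f(2) by simp
      fix Q x y assume xy: "x \<in> Hom C Q (Acar A)" "y \<in> Hom C Q (Acar A)"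
      have "f1 \<cdot> x \<in> Hom C Q (Acar B)" "f1 \<cdot> y \<in> Hom C Q (Acar B)"
        using f(2) xy by (auto intro: Comp_Hom)
      then show "f1 \<cdot> aadd C A x y = aadd C B (f1 \<cdot> x) (f1 \<cdot> y)"
        using functor_gcomp[OF F, of x Q y] xy
        by (simp add: A.gcomp_ab_groupoid[of _ Q] B.gcomp_ab_groupoid[of _ Q] to_zero_comp[of _ Q])
    qed
    ultimately show "f0 = Ident C (zero_ob C) \<and> additive C A B f1" by simp
  next
    assume "f0 = Ident C (zero_ob C) \<and> additive C A B f1"
    then have f0: "f0 = Ident C (zero_ob C)" and f1: "additive C A B f1" by simp_all
    have F: "f1 \<in> Hom C (Acar A) (Acar B)" using f1 by (simp add: additive_def)
    have id0: "to_zero C (zero_ob C) = Ident C (zero_ob C)"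
      by (rule zero_ext[of _ "zero_ob C"]) (auto simp: Hom_iff)
    have "f1 \<cdot> Azero A = B.zero (zero_ob C)"
    proof (rule B.idempotent_zero)
      show "f1 \<cdot> Azero A \<in> Hom C (zero_ob C) (Acar B)" using F A.A_Hom(2)
          by (rule Comp_Hom[rotated])
      show "aadd C B (f1 \<cdot> Azero A) (f1 \<cdot> Azero A) = f1 \<cdot> Azero A"
        using additive_add[OF A B f1 A.A_Hom(2) A.A_Hom(2)] A.add_zero[OF A.A_Hom(2)] id0 by simp
    qed
    moreover note t = to_zero[OF A.A_simps(1)]
    note P = pb_simps[OF t t]
    have "f1 \<cdot> Gm (ab_groupoid_of C A) = aadd C B (f1 \<cdot> pb_fst C (to_zero C (Acar A)) (to_zero C
        (Acar A)))
       (f1 \<cdot> pb_snd C (to_zero C (Acar A)) (to_zero C (Acar A)))"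
      unfolding A.Gm_ab_groupoid by (rule additive_add[OF A B f1 P(1,2)])
    ultimately show "internal_functor C (ab_groupoid_of C A) (ab_groupoid_of C B) f0 f1"
      using F B.gcomp_ab_groupoid[OF Comp_Hom[OF P(1) F] Comp_Hom[OF P(2) F]]
      by (simp add: internal_functor_def f0 id0 to_zero_comp[OF F] Ident_Hom)
  qed
qed

lemma ab_groupoid_is_groupoid:
  assumes "internal_abelian_group C A"
  shows "internal_groupoid C (ab_groupoid_of C A)"
proof -
  interpret abelian_group_in C A by (rule abelian_group_in[OF assms])
  show ?thesis by (rule ab_groupoid_is_groupoid)
qed

lemma ab_groupoid_fully_faithful: "fully_faithful (Ab_cat C) (Grpd_cat C) (ab_groupoid C)"
  unfolding fully_faithful_def
proof (intro conjI ballI)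
  show "is_functor (Ab_cat C) (Grpd_cat C) (ab_groupoid C)"
    by (auto simp: is_functor_def ab_groupoid_def ab_groupoid_is_groupoid Hom_Grpd Ar_Ab
        internal_functor_ab_groupoid)
  fix A B assume "A \<in> Ob (Ab_cat C)" "B \<in> Ob (Ab_cat C)"
  then have A: "internal_abelian_group C A" and B: "internal_abelian_group C B" by simp_all
  show "bij_betw (FAr (ab_groupoid C)) (Hom (Ab_cat C) A B)
      (Hom (Grpd_cat C) (FOb (ab_groupoid C) A) (FOb (ab_groupoid C) B))"
    using A B by (auto simp: bij_betw_def inj_on_def Hom_Ab Hom_Grpd ab_groupoid_def
        ab_groupoid_is_groupoid internal_functor_ab_groupoid
        intro!: image_eqI[of _ _ "(A, B, _)"])
qed

text \<open>The composite lands in the torsion part because the groupoid of an abelian group has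
  \<open>zero_ob C\<close> as object of objects, and the nerve in degree \<open>0\<close> is
  isomorphic to that.\<close>

lemma fully_faithful_Ab_T_tr0:
  "fully_faithful (Ab_cat C) (T_tr0 C) (comp_func (nerve C) (ab_groupoid C))"
  unfolding T_tr0_def
proof (rule fully_faithful_into_full_subcategory)
  show "fully_faithful (Ab_cat C) (Simp C) (comp_func (nerve C) (ab_groupoid C))"
    by (rule fully_faithful_comp_func[OF ab_groupoid_fully_faithful
        nerve_fully_faithful category_Ab])
  fix A assume "A \<in> Ob (Ab_cat C)"
  then have A: "internal_abelian_group C A" by simp
  interpret groupoid_in C "ab_groupoid_of C A"
    by (rule groupoid_in[OF ab_groupoid_is_groupoid[OF A]])
  show "FOb (comp_func (nerve C) (ab_groupoid C)) A \<in> {X. isomorphic C (FOb tr0 X) (zero_ob C)}"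
    using nerve_ob_0 by (simp add: comp_func_def nerve_def ab_groupoid_def tr0_def)
qed (rule category_Ab)

end

section \<open>Protomodularity and the unit of the truncation adjunction\<close>

context lex_category
begin

text \<open>A single object \<open>q\<close> cannot serve directly as a test, since monicity is
  tested against functors. Instead the kernel pairs of the components of \<open>\<tau>\<close> are
  assembled into a functor \<open>K\<close> with two projections to \<open>F\<close>. These are
  equalized by \<open>\<tau>\<close>, hence equal, and an arrow whose kernel pair has equal
  projections is monic.\<close>

lemma monic_functor_category:
  assumes J: "category J" and f: "(F, G, \<tau>) \<in> Hom (functor_category J C) F G"
    and monic: "monic (functor_category J C) (F, G, \<tau>)"
    and a: "a \<in> Ob J" and xy: "x \<in> Hom C q (FOb F a)" "y \<in> Hom C q (FOb F a)" "\<tau> a \<cdot> x = \<tau> a \<cdot> y"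
  shows "x = y"
proof -
  interpret J: category J by fact
  have F: "is_functor J C F" and G: "is_functor J C G" and \<tau>: "is_nat_trans J C F G \<tau>"
    using f by (auto simp: Hom_functor_category Ob_functor_category)
  note [simp] = is_nat_trans_simps[OF \<tau>] is_functor_simps[OF F] is_functor_simps[OF G]
    J.Dom_Ob J.Cod_Ob
  have \<tau>_Hom: "\<tau> b \<in> Hom C (FOb F b) (FOb G b)" if "b \<in> Ob J" for b
    using that by (simp add: Hom_iff)
  define P where "P b = pb_ob C (\<tau> b) (\<tau> b)" for b
  define p where "p b = pb_fst C (\<tau> b) (\<tau> b)" for b
  define q' where "q' b = pb_snd C (\<tau> b) (\<tau> b)" for b
  have pb: "p b \<in> Hom C (P b) (FOb F b)" "q' b \<in> Hom C (P b) (FOb F b)" "\<tau> b \<cdot> p b = \<tau> b \<cdot> q' b"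
    if "b \<in> Ob J" for b
    using pb_simps[OF \<tau>_Hom[OF that] \<tau>_Hom[OF that]] by (simp_all add: P_def p_def q'_def)
  then have [simp]: "p b \<in> Ar C" "Dom C (p b) = P b" "Cod C (p b) = FOb F b"
    "q' b \<in> Ar C" "Dom C (q' b) = P b" "Cod C (q' b) = FOb F b" "P b \<in> Ob C"
    if "b \<in> Ob J" for b
    using that Hom_Ob[of "p b" "P b" "FOb F b"] by (auto simp: Hom_iff)
  \<comment> \<open>The action of \<open>K\<close> on \<open>u\<close> is induced by
    \<open>FAr F u\<close>; naturality of \<open>\<tau>\<close> gives the compatibility that the
    pairing requires.\<close>
  define k where "k u = pb_pair C (\<tau> (Cod J u)) (\<tau> (Cod J u))
     (FAr F u \<cdot> p (Dom J u)) (FAr F u \<cdot> q' (Dom J u))" for u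
  have k: "k u \<in> Hom C (P (Dom J u)) (P (Cod J u))" "p (Cod J u) \<cdot> k u = FAr F u \<cdot> p (Dom J u)"
    "q' (Cod J u) \<cdot> k u = FAr F u \<cdot> q' (Dom J u)" if u: "u \<in> Ar J" for u
  proof -
    have eq: "\<tau> (Cod J u) \<cdot> (FAr F u \<cdot> z) = FAr G u \<cdot> (\<tau> (Dom J u) \<cdot> z)"
      if "z \<in> Ar C" "Cod C z = FOb F (Dom J u)" for z
      using Comp_reassoc[OF is_nat_trans_natural[OF \<tau> u refl refl], of "FOb F (Dom J u)"
          "FOb F (Cod J u)" "FOb G (Cod J u)" z]
        that u by (simp add: Hom_iff)
    have "FAr F u \<cdot> p (Dom J u) \<in> Hom C (P (Dom J u)) (FOb F (Cod J u))"
      "FAr F u \<cdot> q' (Dom J u) \<in> Hom C (P (Dom J u)) (FOb F (Cod J u))"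
      "\<tau> (Cod J u) \<cdot> (FAr F u \<cdot> p (Dom J u)) = \<tau> (Cod J u) \<cdot> (FAr F u \<cdot> q' (Dom J u))"
      using u pb(3)[of "Dom J u"] by (simp_all add: Hom_iff eq)
    from pb_pair_simps[OF \<tau>_Hom \<tau>_Hom this] u show
      "k u \<in> Hom C (P (Dom J u)) (P (Cod J u))" "p (Cod J u) \<cdot> k u = FAr F u \<cdot> p (Dom J u)"
      "q' (Cod J u) \<cdot> k u = FAr F u \<cdot> q' (Dom J u)"
      by (simp_all add: k_def P_def p_def q'_def)
  qed
  then have [simp]: "k u \<in> Ar C" "Dom C (k u) = P (Dom J u)" "Cod C (k u) = P (Cod J u)" if
      "u \<in> Ar J" for u
    using that by (auto simp: Hom_iff)
  have k_ext: "z = z'" if "b \<in> Ob J" "z \<in> Hom C r (P b)" "z' \<in> Hom C r (P b)" "p b \<cdot> z = p b \<cdot> z'"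
      "q' b \<cdot> z = q' b \<cdot> z'"
    for b z z' r
    using that pb_ext[OF \<tau>_Hom[OF that(1)] \<tau>_Hom[OF that(1)], of z r z']
        by (simp add: P_def p_def q'_def)
  \<comment> \<open>Restriction makes \<open>K\<close> undefined outside \<open>J\<close>, as
    membership in the functor category demands.\<close>
  define K where "K = \<lparr>FOb = restrict P (Ob J), FAr = restrict k (Ar J)\<rparr>"
  have K: "is_functor J C K"
    unfolding is_functor_def
  proof (intro conjI ballI impI)
    fix b assume b: "b \<in> Ob J"
    have "k (Ident J b) = Ident C (P b)"
      using b k[of "Ident J b"] F by - (rule k_ext[OF b, of _
          "P b"]; auto simp: Hom_iff is_functor_def)
    then show "FAr K (Ident J b) = Ident C (FOb K b)" using b by (simp add: K_def)
  next
    fix u v assume uv: "u \<in> Ar J" "v \<in> Ar J" "Dom J v = Cod J u"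
    have Fvu: "FAr F (v \<cdot>\<^bsub>J\<^esub> u) = FAr F v \<cdot> FAr F u" using F uv by (simp add: is_functor_def)
    have "k (v \<cdot>\<^bsub>J\<^esub> u) = k v \<cdot> k u"
    proof (rule k_ext)
      show "Cod J v \<in> Ob J" using uv by simp
      show "k (v \<cdot>\<^bsub>J\<^esub> u) \<in> Hom C (P (Dom J u)) (P (Cod J v))"
          "k v \<cdot> k u \<in> Hom C (P (Dom J u)) (P (Cod J v))"
        using uv by (simp_all add: Hom_iff)
      show "p (Cod J v) \<cdot> k (v \<cdot>\<^bsub>J\<^esub> u) = p (Cod J v) \<cdot> (k v \<cdot> k u)"
        using k(2)[of "v \<cdot>\<^bsub>J\<^esub> u"] Comp_reassoc[OF k(2)[OF uv(2)] k(1)[OF uv(2)], of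
            "FOb F (Cod J v)" "k u"]
          k(2)[OF uv(1)] uv Fvu by (simp add: Hom_iff)
      show "q' (Cod J v) \<cdot> k (v \<cdot>\<^bsub>J\<^esub> u) = q' (Cod J v) \<cdot> (k v \<cdot> k u)"
        using k(3)[of "v \<cdot>\<^bsub>J\<^esub> u"] Comp_reassoc[OF k(3)[OF uv(2)] k(1)[OF uv(2)], of
            "FOb F (Cod J v)" "k u"]
          k(3)[OF uv(1)] uv Fvu by (simp add: Hom_iff)
    qed
    then show "FAr K (v \<cdot>\<^bsub>J\<^esub> u) = FAr K v \<cdot> FAr K u" using uv by (simp add: K_def)
  qed (auto simp: K_def Hom_iff)
  have KOb: "K \<in> Ob (functor_category J C)"
    using K by (simp add: Ob_functor_category K_def)
  have "(K, F, restrict p (Ob J)) \<in> Hom (functor_category J C) K F"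
    "(K, F, restrict q' (Ob J)) \<in> Hom (functor_category J C) K F"
    using KOb f k by (auto simp: Hom_functor_category is_nat_trans_def K_def Hom_iff[of _ C])
  moreover have "(F, G, \<tau>) \<cdot>\<^bsub>functor_category J C\<^esub> (K, F, restrict p (Ob J)) =
      (F, G, \<tau>) \<cdot>\<^bsub>functor_category J C\<^esub> (K, F, restrict q' (Ob J))"
    using pb(3) by (auto intro!: ext)
  moreover have "Dom (functor_category J C) (F, G, \<tau>) = F"
    by (simp add: functor_category_def Let_def)
  ultimately have "(K, F, restrict p (Ob J)) = (K, F, restrict q' (Ob J))"
    using monic unfolding monic_def by metis
  then have "restrict p (Ob J) a = restrict q' (Ob J) a" by simp
  then have pq: "p a = q' a" using a by simp
  note h = pb_pair_simps[OF \<tau>_Hom[OF a] \<tau>_Hom[OF a] xy]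
  show ?thesis
    using h(2,3) pq by (simp add: p_def q'_def)
qed

section \<open>Recognizing pullbacks by protomodularity\<close>

text \<open>The inverse of the comparison carries the universal property of the chosen pullback over
  to \<open>S\<close>.\<close>

lemma is_pullback_iso:
  assumes p: "p \<in> Hom C A B" and q: "q \<in> Hom C D B" and a: "a \<in> Hom C S A" and c: "c \<in> Hom C S D"
    and eq: "p \<cdot> a = q \<cdot> c" and iso: "iso_arr C (pb_pair C p q a c)"
  shows "is_pullback C p q S a c"
proof -
  note f = pb_pair_simps[OF p q a c eq] and P = pb_simps[OF p q]
  obtain g where g: "g \<in> Hom C (pb_ob C p q) S" "g \<cdot> pb_pair C p q a c = Ident C S"
    "pb_pair C p q a c \<cdot> g = Ident C (pb_ob C p q)"
    using iso f(1) by (rule iso_arrE)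
  have ag: "a \<cdot> g = pb_fst C p q" "c \<cdot> g = pb_snd C p q"
    using Comp_reassoc[OF f(2,1) P(1), of g] Comp_reassoc[OF f(3,1) P(2), of g] g P
        by (auto simp: Hom_iff)
  have "\<exists>!h. h \<in> Hom C Q S \<and> a \<cdot> h = x \<and> c \<cdot> h = y"
    if xy: "x \<in> Hom C Q A" "y \<in> Hom C Q D" "p \<cdot> x = q \<cdot> y" for Q x y
  proof (rule ex1I[of _ "g \<cdot> pb_pair C p q x y"])
    note h = pb_pair_simps[OF p q xy]
    show "g \<cdot> pb_pair C p q x y \<in> Hom C Q S \<and> a \<cdot> (g \<cdot> pb_pair C p q x y) = x \<and>
        c \<cdot> (g \<cdot> pb_pair C p q x y) = y"
      using Comp_reassoc[OF ag(1) g(1) a, of "pb_pair C p q x y"]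
        Comp_reassoc[OF ag(2) g(1) c, of "pb_pair C p q x y"] g(1) h by (auto simp: Hom_iff)
    fix z assume z: "z \<in> Hom C Q S \<and> a \<cdot> z = x \<and> c \<cdot> z = y"
    have "pb_pair C p q a c \<cdot> z = pb_pair C p q x y"
      using pb_pair_comp[OF p q a c eq, of z Q] z by simp
    then show "z = g \<cdot> pb_pair C p q x y"
      using Comp_reassoc[OF g(2) f(1) g(1), of z] z by (auto simp: Hom_iff)
  qed
  moreover have D: "Dom C p = A" "Dom C q = D" "p \<in> Ar C" "q \<in> Ar C" "Cod C p = Cod C q"
    using p q by (auto simp: Hom_iff)
  ultimately show ?thesis
    unfolding is_pullback_def D(1,2) using a c eq by blast
qed

text \<open>The comparison \<open>S \<rightarrow> A \<times>\<^sub>B D\<close> is a morphism of points over \<open>D\<close>, and its pullback along the section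
  \<open>t\<close> of \<open>q\<close> is the identity of \<open>A\<close>.\<close>

lemma protomodular_pullback:
  assumes proto: "protomodular C"
    and p: "p \<in> Hom C A B" and q: "q \<in> Hom C D B" and a: "a \<in> Hom C S A" and c: "c \<in> Hom C S D"
    and eq: "p \<cdot> a = q \<cdot> c"
    and jm: "\<And>Q x y. x \<in> Hom C Q S \<Longrightarrow> y \<in> Hom C Q S \<Longrightarrow> a \<cdot> x = a \<cdot> y \<Longrightarrow> c \<cdot> x = c \<cdot> y \<Longrightarrow> x = y"
    and t: "t \<in> Hom C B D" "q \<cdot> t = Ident C B"
    and e: "e \<in> Hom C D S" "c \<cdot> e = Ident C D"
    and e': "e' \<in> Hom C A S" "a \<cdot> e' = Ident C A" "c \<cdot> e' = t \<cdot> p"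
  shows "is_pullback C p q S a c"
proof (rule is_pullback_iso[OF p q a c eq])
  define f where "f = pb_pair C p q a c"
  note P = pb_simps[OF p q]
  note f = pb_pair_simps[OF p q a c eq, folded f_def]
  have [simp]: "p \<in> Ar C" "Dom C p = A" "Cod C p = B" "q \<in> Ar C" "Dom C q = D" "Cod C q = B"
    "a \<in> Ar C" "Dom C a = S" "Cod C a = A" "c \<in> Ar C" "Dom C c = S" "Cod C c = D"
    "t \<in> Ar C" "Dom C t = B" "Cod C t = D" "e \<in> Ar C" "Dom C e = D" "Cod C e = S"
    "e' \<in> Ar C" "Dom C e' = A" "Cod C e' = S" "f \<in> Ar C" "Dom C f = S" "Cod C f = pb_ob C p q"
    "pb_fst C p q \<in> Ar C" "Dom C (pb_fst C p q) = pb_ob C p q" "Cod C (pb_fst C p q) = A"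
    "pb_snd C p q \<in> Ar C" "Dom C (pb_snd C p q) = pb_ob C p q" "Cod C (pb_snd C p q) = D"
    using p q a c t e e' f P by (auto simp: Hom_iff)
  have A: "A \<in> Ob C" using Hom_Ob[OF p] by simp
  have fx [simp]: "pb_fst C p q \<cdot> (f \<cdot> x) = a \<cdot> x" "pb_snd C p q \<cdot> (f \<cdot> x) = c \<cdot> x"
    if "x \<in> Ar C" "Cod C x = S" for x
    using Comp_reassoc[OF f(2,1) P(1), of x] Comp_reassoc[OF f(3,1) P(2), of x] that by auto
  have e'x [simp]: "a \<cdot> (e' \<cdot> x) = x" "c \<cdot> (e' \<cdot> x) = t \<cdot> (p \<cdot> x)" if "x \<in> Ar C" "Cod C x = A" for x
    using Comp_reassoc[OF e'(2,1) a, of x] Comp_reassoc[OF e'(3,1) c, of x] that by auto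
  have qt [simp]: "q \<cdot> (t \<cdot> x) = x" if "x \<in> Ar C" "Cod C x = B" for x
    using Comp_reassoc[OF t(2,1) q, of x] that by auto
  \<comment> \<open>The pullback of \<open>c\<close> along \<open>t\<close> is \<open>A\<close>: an
    element \<open>x\<close> of \<open>S\<close> over the section is recovered from
    \<open>a \<cdot> x\<close> through \<open>e'\<close>. This is where joint monicity of
    \<open>a\<close> and \<open>c\<close> is used.\<close>
  have pbS: "is_pullback C c t A e' p"
    unfolding is_pullback_def
  proof (intro conjI allI ballI impI)
    fix Q x y assume xy: "x \<in> Hom C Q (Dom C c)" "y \<in> Hom C Q (Dom C t)" "c \<cdot> x = t \<cdot> y"
    have pax: "p \<cdot> (a \<cdot> x) = y"
      using Comp_reassoc[OF eq a p, of x] xy qt[of y] by (auto simp: Hom_iff)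
    have "e' \<cdot> (a \<cdot> x) = x"
      by (rule jm[of _ Q]) (use xy pax in \<open>auto simp: Hom_iff\<close>)
    then have "a \<cdot> x \<in> Hom C Q A \<and> e' \<cdot> (a \<cdot> x) = x \<and> p \<cdot> (a \<cdot> x) = y"
      using xy(1) pax by (simp add: Hom_iff)
    moreover have "h = a \<cdot> (e' \<cdot> h)" if "h \<in> Hom C Q A" for h
      using that by (simp add: Hom_iff)
    ultimately show "\<exists>!h. h \<in> Hom C Q A \<and> e' \<cdot> h = x \<and> p \<cdot> h = y"
      by metis
  qed (auto simp: e' Hom_iff)
  \<comment> \<open>The same identification for the chosen pullback, where \<open>pb_ext\<close>
    provides joint monicity.\<close>
  have pbP: "is_pullback C (pb_snd C p q) t A (f \<cdot> e') p"
    unfolding is_pullback_def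
  proof (intro conjI allI ballI impI)
    fix Q x y assume xy: "x \<in> Hom C Q (Dom C (pb_snd C p q))" "y \<in> Hom C Q (Dom C t)"
      "pb_snd C p q \<cdot> x = t \<cdot> y"
    have pax: "p \<cdot> (pb_fst C p q \<cdot> x) = y"
      using Comp_reassoc[OF P(3,1) p, of x] xy qt[of y] by (auto simp: Hom_iff)
    have "f \<cdot> (e' \<cdot> (pb_fst C p q \<cdot> x)) = x"
      by (rule pb_ext[OF p q, of _ Q]) (use xy pax in \<open>auto simp: Hom_iff\<close>)
    then have "pb_fst C p q \<cdot> x \<in> Hom C Q A \<and> f \<cdot> e' \<cdot> (pb_fst C p q \<cdot> x) = x \<and>
        p \<cdot> (pb_fst C p q \<cdot> x) = y"
      using xy(1) pax by (simp add: Hom_iff)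
    moreover have "h = pb_fst C p q \<cdot> (f \<cdot> e' \<cdot> h)" if "h \<in> Hom C Q A" for h
      using that by (simp add: Hom_iff)
    ultimately show "\<exists>!h. h \<in> Hom C Q A \<and> f \<cdot> e' \<cdot> h = x \<and> p \<cdot> h = y"
      by metis
  qed (auto simp: e' Hom_iff)
  \<comment> \<open>Protomodularity with \<open>v = t\<close>, for the morphism \<open>f\<close>
    from the point \<open>(c, e)\<close> to the point \<open>(pb_snd C p q, f \<cdot> e)\<close>.
    Both pullbacks along \<open>t\<close> have apex \<open>A\<close>, and the induced map between
    them is its identity.\<close>
  have "t \<in> Hom C B D \<and> is_point C D S c e \<and> is_point C D (pb_ob C p q) (pb_snd C p q) (f \<cdot> e) \<and>
    f \<in> Hom C S (pb_ob C p q) \<and> pb_snd C p q \<cdot> f = c \<and> f \<cdot> e = f \<cdot> e \<and>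
    is_pullback C c t A e' p \<and> is_pullback C (pb_snd C p q) t A (f \<cdot> e') p \<and>
    Ident C A \<in> Hom C A A \<and> (f \<cdot> e') \<cdot> Ident C A = f \<cdot> e' \<and> p \<cdot> Ident C A = p \<and>
        iso_arr C (Ident C A)"
    using t pbS pbP f e A iso_arr_Ident by (auto simp: is_point_def Hom_iff)
  then have "iso_arr C f"
    using proto unfolding protomodular_def by blast
  then show "iso_arr C (pb_pair C p q a c)" by (simp add: f_def)
qed

section \<open>Internal relations and the indiscrete simplicial object\<close>

text \<open>Equality of pairs is equality of both coordinates, which turns the subobject condition
  into the elementwise form in which relations are used below.\<close>

lemma monic_pow_pair_iff:
  assumes d: "d0 \<in> Hom C R A" "d1 \<in> Hom C R A"
  shows "monic C (pow_pair C A d0 d1) \<longleftrightarrow>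
    (\<forall>Q x y. x \<in> Hom C Q R \<longrightarrow> y \<in> Hom C Q R \<longrightarrow> d0 \<cdot> x = d0 \<cdot> y \<longrightarrow> d1 \<cdot> x = d1 \<cdot> y \<longrightarrow> x = y)"
proof -
  note p = pow_pair_simps[OF d]
  have A: "A \<in> Ob C" using Hom_Ob[OF d(1)] by simp
  have "pow_pair C A d0 d1 \<cdot> x = pow_pair C A d0 d1 \<cdot> y \<longleftrightarrow> d0 \<cdot> x = d0 \<cdot> y \<and> d1 \<cdot> x = d1 \<cdot> y"
    if "x \<in> Hom C Q R" "y \<in> Hom C Q R" for Q x y
  proof
    have *: "d0 \<cdot> z = pow_proj C A 2 0 \<cdot> (pow_pair C A d0 d1 \<cdot> z)"
      "d1 \<cdot> z = pow_proj C A 2 (Suc 0) \<cdot> (pow_pair C A d0 d1 \<cdot> z)" if "z \<in> Hom C Q R" for z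
      using Comp_reassoc[OF p(2,1) pow_proj_Hom[OF A], of z] that
        Comp_reassoc[OF p(3,1) pow_proj_Hom[OF A], of z] by (auto simp: Hom_iff)
    assume "pow_pair C A d0 d1 \<cdot> x = pow_pair C A d0 d1 \<cdot> y"
    then show "d0 \<cdot> x = d0 \<cdot> y \<and> d1 \<cdot> x = d1 \<cdot> y" using * that by metis
  next
    assume "d0 \<cdot> x = d0 \<cdot> y \<and> d1 \<cdot> x = d1 \<cdot> y"
    then show "pow_pair C A d0 d1 \<cdot> x = pow_pair C A d0 d1 \<cdot> y"
      using pow_pair_comp[OF d, of x Q] pow_pair_comp[OF d, of y Q] that by simp
  qed
  moreover have "Dom C (pow_pair C A d0 d1) = R" "pow_pair C A d0 d1 \<in> Ar C"
    using p(1) by (auto simp: Hom_iff)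
  ultimately show ?thesis
    by (auto simp: monic_def Ball_def)
qed

text \<open>In a relation two arrows with the same endpoints are equal. Every groupoid equation thus
  reduces to comparing sources and targets, and only identities, composites and inverses with the
  right endpoints have to be exhibited.\<close>

lemma internal_equivalence_relationI:
  assumes "G0 G \<in> Ob C" "G1 G \<in> Ob C"
    and d: "Gd0 G \<in> Hom C (G1 G) (G0 G)" "Gd1 G \<in> Hom C (G1 G) (G0 G)"
    and s: "Gs G \<in> Hom C (G0 G) (G1 G)" "Gd0 G \<cdot> Gs G = Ident C (G0 G)" "Gd1 G \<cdot> Gs G =
        Ident C (G0 G)"
    and m: "Gm G \<in> Hom C (pb_ob C (Gd0 G) (Gd1 G)) (G1 G)"
      "Gd1 G \<cdot> Gm G = Gd1 G \<cdot> pb_fst C (Gd0 G) (Gd1 G)" "Gd0 G \<cdot> Gm G =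
          Gd0 G \<cdot> pb_snd C (Gd0 G) (Gd1 G)"
    and i: "Gi G \<in> Hom C (G1 G) (G1 G)" "Gd1 G \<cdot> Gi G = Gd0 G" "Gd0 G \<cdot> Gi G = Gd1 G"
    and rel: "\<And>Q x y. x \<in> Hom C Q (G1 G) \<Longrightarrow> y \<in> Hom C Q (G1 G) \<Longrightarrow>
       Gd0 G \<cdot> x = Gd0 G \<cdot> y \<Longrightarrow> Gd1 G \<cdot> x = Gd1 G \<cdot> y \<Longrightarrow> x = y"
  shows "internal_equivalence_relation C G"
proof -
  have [simp]: "Gd0 G \<in> Ar C" "Dom C (Gd0 G) = G1 G" "Cod C (Gd0 G) = G0 G"
    "Gd1 G \<in> Ar C" "Dom C (Gd1 G) = G1 G" "Cod C (Gd1 G) = G0 G"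
    "Gs G \<in> Ar C" "Dom C (Gs G) = G0 G" "Cod C (Gs G) = G1 G"
    "Gi G \<in> Ar C" "Dom C (Gi G) = G1 G" "Cod C (Gi G) = G1 G"
    using d s i by (auto simp: Hom_iff)
  have gc: "gcomp C G x y \<in> Hom C Q (G1 G) \<and> Gd1 G \<cdot> gcomp C G x y = Gd1 G \<cdot> x \<and>
      Gd0 G \<cdot> gcomp C G x y = Gd0 G \<cdot> y"
    if xy: "x \<in> Hom C Q (G1 G)" "y \<in> Hom C Q (G1 G)" "Gd0 G \<cdot> x = Gd1 G \<cdot> y" for Q x y
    using pb_pair_simps[OF d xy] pb_simps[OF d] m(1) unfolding gcomp_def
      Comp_reassoc[OF m(2,1) d(2)] Comp_reassoc[OF m(3,1) d(1)]
    using Comp_reassoc[OF m(2,1) d(2), of "pb_pair C (Gd0 G) (Gd1 G) x y"]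
      Comp_reassoc[OF m(3,1) d(1), of "pb_pair C (Gd0 G) (Gd1 G) x y"] by (auto simp: Hom_iff)
  have ds: "Gd0 G \<cdot> (Gs G \<cdot> x) = x" "Gd1 G \<cdot> (Gs G \<cdot> x) = x" if "x \<in> Ar C" "Cod C x = G0 G" for x
    using Comp_reassoc[OF s(2,1) d(1), of x] Comp_reassoc[OF s(3,1) d(2), of x] that by auto
  have I: "Ident C (G1 G) \<in> Hom C (G1 G) (G1 G)" using assms(2) by (simp add: Hom_iff)
  have sd: "Gs G \<cdot> Gd0 G \<in> Hom C (G1 G) (G1 G)" "Gs G \<cdot> Gd1 G \<in> Hom C (G1 G) (G1 G)"
    by (simp_all add: Hom_iff)
  have "gcomp C G (Gs G \<cdot> Gd1 G) (Ident C (G1 G)) = Ident C (G1 G)"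
    using gc[OF sd(2) I] I by - (rule rel[of _ "G1 G"]; simp add: ds Hom_iff)
  moreover have "gcomp C G (Ident C (G1 G)) (Gs G \<cdot> Gd0 G) = Ident C (G1 G)"
    using gc[OF I sd(1)] I by - (rule rel[of _ "G1 G"]; simp add: ds Hom_iff)
  moreover have "gcomp C G (Ident C (G1 G)) (Gi G) = Gs G \<cdot> Gd1 G"
    using gc[OF I i(1)] sd i by - (rule rel[of _ "G1 G"]; simp add: ds Hom_iff)
  moreover have "gcomp C G (Gi G) (Ident C (G1 G)) = Gs G \<cdot> Gd0 G"
    using gc[OF i(1) I] sd i by - (rule rel[of _ "G1 G"]; simp add: ds Hom_iff)
  moreover have "gcomp C G (gcomp C G x y) z = gcomp C G x (gcomp C G y z)"
    if xyz: "x \<in> Hom C q (G1 G)" "y \<in> Hom C q (G1 G)" "z \<in> Hom C q (G1 G)"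
      "Gd0 G \<cdot> x = Gd1 G \<cdot> y" "Gd0 G \<cdot> y = Gd1 G \<cdot> z" for q x y z
  proof -
    note 1 = gc[OF xyz(1,2,4)] and 2 = gc[OF xyz(2,3,5)]
    show ?thesis
      using gc[of "gcomp C G x y" q z] gc[of x q "gcomp C G y z"] 1 2 xyz
      by - (rule rel[of _ q]; simp)
  qed
  ultimately have "internal_groupoid C G"
    unfolding internal_groupoid_def Let_def using assms by blast
  moreover have "monic C (pow_pair C (G0 G) (Gd0 G) (Gd1 G))"
    using rel by (simp add: monic_pow_pair_iff[OF d])
  ultimately show ?thesis
    by (simp add: internal_equivalence_relation_def)
qed

text \<open>The functor laws are tested on projections. The result makes the unit an arrow of
  \<open>Simp C\<close>, so that monicity can be asked of it.\<close>

lemma Ind_Ob: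
  assumes A: "A \<in> Ob C"
  shows "Ind C A \<in> Ob (Simp C)"
proof -
  have I: "FAr (Ind C A) (m, n, f) \<in> Hom C (pow_ob C A (Suc n)) (pow_ob C A (Suc m))"
    "k \<le> m \<Longrightarrow> pow_proj C A (Suc m) k \<cdot> FAr (Ind C A) (m, n, f) = pow_proj C A (Suc n) (f k)"
    if "(m, n, f) \<in> Ar Delta" for m n f k
  proof -
    have "pow_proj C A (Suc n) (f k) \<in> Hom C (pow_ob C A (Suc n)) A" if "k < Suc m" for k
      using \<open>(m, n, f) \<in> Ar Delta\<close> that A
      by (intro pow_proj_Hom) (auto simp: Ar_Delta PiE_iff less_Suc_eq_le)
    from pow_tuple_simps[OF A _ this, of "Suc m"] that A
    show "FAr (Ind C A) (m, n, f) \<in> Hom C (pow_ob C A (Suc n)) (pow_ob C A (Suc m))"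
      "k \<le> m \<Longrightarrow> pow_proj C A (Suc m) k \<cdot> FAr (Ind C A) (m, n, f) = pow_proj C A (Suc n) (f k)"
      by (simp_all add: Ind_def)
  qed
  have "is_functor (op_cat Delta) C (Ind C A)"
    unfolding is_functor_def
  proof (intro conjI ballI impI)
    fix n :: nat
    show "FOb (Ind C A) n \<in> Ob C" using A by (simp add: Ind_def)
    note 1 = I[OF Ident_Delta_Ar[of n]]
    have "FAr (Ind C A) (n, n, restrict (\<lambda>i. i) {..n}) = Ident C (pow_ob C A (Suc n))"
      using 1 A pow_proj_Hom[OF A, of _ "Suc n"]
      by - (rule pow_ext[OF A, of _ "pow_ob C A (Suc n)" "Suc n"]; auto simp: Hom_iff)
    then show "FAr (Ind C A) (Ident (op_cat Delta) n) = Ident C (FOb (Ind C A) n)"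
      by (simp add: Ind_def)
  next
    fix \<alpha> assume \<alpha>: "\<alpha> \<in> Ar (op_cat Delta)"
    obtain m n f where "\<alpha> = (m, n, f)" by (rule prod_cases3)
    then show "FAr (Ind C A) \<alpha> \<in> Hom C (FOb (Ind C A) (Dom (op_cat Delta) \<alpha>)) (FOb (Ind C A) (Cod
        (op_cat Delta) \<alpha>))"
      using \<alpha> I(1) by (simp add: Ind_def)
  next
    fix \<beta> \<alpha> assume \<beta>\<alpha>: "\<beta> \<in> Ar (op_cat Delta)" "\<alpha> \<in> Ar (op_cat Delta)"
      "Dom (op_cat Delta) \<alpha> = Cod (op_cat Delta) \<beta>"
    obtain l m f where lmf: "\<alpha> = (l, m, f)" by (rule prod_cases3)
    obtain m' n g where mng: "\<beta> = (m', n, g)" by (rule prod_cases3)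
    have "m' = m" using \<beta>\<alpha>(3) by (simp add: lmf mng)
    then have \<alpha>: "\<alpha> = (l, m, f)" "(l, m, f) \<in> Ar Delta" and \<beta>: "\<beta> = (m, n, g)"
        "(m, n, g) \<in> Ar Delta"
      using \<beta>\<alpha>(1,2) by (simp_all add: lmf mng)
    have \<gamma>: "(l, n, \<lambda>i\<in>{..l}. g (f i)) \<in> Ar Delta"
      using \<alpha>(2) \<beta>(2) by (auto simp: Ar_Delta mono_on_def PiE_iff Pi_iff)
    have f: "f k \<le> m" if "k \<le> l" for k using \<alpha>(2) that by (auto simp: Ar_Delta)
    note a = I[OF \<alpha>(2)] and b = I[OF \<beta>(2)] and c = I[OF \<gamma>]
    have "FAr (Ind C A) (l, n, \<lambda>i\<in>{..l}. g (f i)) =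
        FAr (Ind C A) (l, m, f) \<cdot> FAr (Ind C A) (m, n, g)"
    proof (rule pow_ext[OF A c(1) Comp_Hom[OF b(1) a(1)]])
      fix k assume k: "k < Suc l"
      show "pow_proj C A (Suc l) k \<cdot> FAr (Ind C A) (l, n, \<lambda>i\<in>{..l}. g (f i)) =
        pow_proj C A (Suc l) k \<cdot> (FAr (Ind C A) (l, m, f) \<cdot> FAr (Ind C A) (m, n, g))"
        using Comp_reassoc[OF a(2)[of k] a(1) pow_proj_Hom[OF A k], of "FAr (Ind C A) (m, n, g)"]
          b(1) b(2)[of "f k"] c(2)[of k] f[of k] k by (simp add: Hom_iff)
    qed
    then show "FAr (Ind C A) (\<alpha> \<cdot>\<^bsub>op_cat Delta\<^esub> \<beta>) = FAr (Ind C A) \<alpha> \<cdot> FAr (Ind C A) \<beta>"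
      by (simp add: \<alpha> \<beta>)
  qed
  then show ?thesis
    by (simp add: Ob_Simp Ind_def)
qed

end

section \<open>Simplicial operators and the unit on elements\<close>

locale simplicial_object_in = lex_category +
  fixes X
  assumes simplicial: "X \<in> Ob (Simp C)"
begin

text \<open>Keeps \<open>{..0}\<close> as it stands; once rewritten, the index set of operators in
  degree \<open>0\<close> would cease to match \<open>op 0 n\<close>.\<close>

declare atMost_0 [simp del]

abbreviation "op m n f \<equiv> FAr X (m, n, restrict f {..m})"

text \<open>Operators are indexed by plain functions, with conditions only on \<open>{..m}\<close>,
  and \<open>op\<close> adds the restriction. Composites can then be computed with ordinary
  functions.\<close>

definition monotone_map :: "nat \<Rightarrow> nat \<Rightarrow> (nat \<Rightarrow> nat) \<Rightarrow> bool" where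
  "monotone_map m n f \<longleftrightarrow> (\<forall>i\<le>m. f i \<le> n) \<and> (\<forall>i\<le>m. \<forall>j\<le>m. i \<le> j \<longrightarrow> f i \<le> f j)"

lemma monotone_map_Ar: "monotone_map m n f \<Longrightarrow> (m, n, restrict f {..m}) \<in> Ar Delta"
  by (auto simp: monotone_map_def Ar_Delta mono_on_def)

lemma is_functor_X: "is_functor (op_cat Delta) C X"
  using simplicial by (simp add: Ob_Simp)

lemma X_Ob [simp]: "FOb X n \<in> Ob C"
  using is_functor_simps(1)[OF is_functor_X, of n] by simp

lemma op_Hom: "monotone_map m n f \<Longrightarrow> op m n f \<in> Hom C (FOb X n) (FOb X m)"
  using is_functor_simps(2-4)[OF is_functor_X, of
      "(m, n, restrict f {..m})"] monotone_map_Ar[of m n f]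
  by (simp add: Hom_iff)

lemma op_simps [simp]:
  assumes "monotone_map m n f"
  shows "op m n f \<in> Ar C" "Dom C (op m n f) = FOb X n" "Cod C (op m n f) = FOb X m"
  using op_Hom[OF assms] by (auto simp: Hom_iff)

text \<open>Contravariance reverses the order: \<open>op n k g\<close> acts before
  \<open>op m n f\<close>. The separate \<open>h\<close> lets the composite map be given in
  simplified form, with agreement required on \<open>{..m}\<close> only.\<close>

lemma op_comp:
  assumes f: "monotone_map m n f" and g: "monotone_map n k g" and h: "\<And>i. i \<le> m \<Longrightarrow> g (f i) = h i"
  shows "op m n f \<cdot> op n k g = op m k h"
proof -
  have "FAr X ((m, n, restrict f {..m}) \<cdot>\<^bsub>op_cat Delta\<^esub> (n, k, restrict g {..n})) =
      op m n f \<cdot> op n k g"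
    using is_functor_X monotone_map_Ar[OF f] monotone_map_Ar[OF g] unfolding is_functor_def
    by (metis Delta_simps(2,3) op_cat_simps(2-4))
  then have "op m k (\<lambda>i. restrict g {..n} (restrict f {..m} i)) = op m n f \<cdot> op n k g"
    by (simp only: op_cat_simps Delta_simps)
  moreover have "restrict (\<lambda>i. restrict g {..n} (restrict f {..m} i)) {..m} = restrict h {..m}"
    using f h by (auto simp: monotone_map_def fun_eq_iff)
  ultimately show ?thesis by simp
qed

lemma op_comp_assoc:
  assumes "monotone_map m n f" "monotone_map n k g" "\<And>i. i \<le> m \<Longrightarrow> g (f i) = h i"
    and "x \<in> Ar C" "Cod C x = FOb X k"
  shows "op m n f \<cdot> (op n k g \<cdot> x) = op m k h \<cdot> x"
  by (rule Comp_reassoc[OF op_comp[OF assms(1-3)] op_Hom[OF assms(2)] op_Hom[OF assms(1)]])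
    (use assms(4,5) in auto)

lemma op_id:
  assumes "\<And>i. i \<le> n \<Longrightarrow> h i = i"
  shows "op n n h = Ident C (FOb X n)"
proof -
  have "restrict h {..n} = (\<lambda>i\<in>{..n}. i)" using assms by auto
  then show ?thesis
    using is_functor_X by (auto simp: is_functor_def)
qed

abbreviation "vt n k \<equiv> op 0 n (\<lambda>_. k)"
abbreviation "eg n k \<equiv> op 1 n (\<lambda>i. k + i)"

lemma monotone_mapI [simp]:
  "k \<le> n \<Longrightarrow> monotone_map m n (\<lambda>_. k)"
  "k + m \<le> n \<Longrightarrow> monotone_map m n (\<lambda>i. k + i)"
  "m \<le> n \<Longrightarrow> monotone_map m n (\<lambda>i. i)"
  by (auto simp: monotone_map_def)

definition "eta n = pow_tuple C (FOb X n) (FOb X 0) (Suc n) (\<lambda>k. FAr X (vertex n k))"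

lemma vertex_eq: "FAr X (vertex n k) = vt n k"
  by (simp add: vertex_def)

lemma eta_simps:
  "eta n \<in> Hom C (FOb X n) (pow_ob C (FOb X 0) (Suc n))"
  "k \<le> n \<Longrightarrow> pow_proj C (FOb X 0) (Suc n) k \<cdot> eta n = vt n k"
proof -
  have "FAr X (vertex n k) \<in> Hom C (FOb X n) (FOb X 0)" if "k < Suc n" for k
    using that op_Hom[of 0 n "\<lambda>_. k"] by (simp add: vertex_eq)
  note 1 = pow_tuple_simps[OF X_Ob X_Ob, of "Suc n" "\<lambda>k. FAr X (vertex n k)", OF this]
  show "eta n \<in> Hom C (FOb X n) (pow_ob C (FOb X 0) (Suc n))"
    "k \<le> n \<Longrightarrow> pow_proj C (FOb X 0) (Suc n) k \<cdot> eta n = vt n k"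
    using 1(1) 1(2)[of k] by (simp_all add: eta_def vertex_eq)
qed

text \<open>\<open>eta n\<close> is the tuple of all vertex maps, so projecting from the power
  reduces its effect to the vertices.\<close>

lemma eta_eq_iff:
  assumes x: "x \<in> Hom C Q (FOb X n)" and y: "y \<in> Hom C Q (FOb X n)"
  shows "eta n \<cdot> x = eta n \<cdot> y \<longleftrightarrow> (\<forall>k\<le>n. vt n k \<cdot> x = vt n k \<cdot> y)"
proof -
  have *: "pow_proj C (FOb X 0) (Suc n) k \<cdot> (eta n \<cdot> z) = vt n k \<cdot> z" if "k \<le> n"
      "z \<in> Hom C Q (FOb X n)" for k z
    using Comp_reassoc[OF eta_simps(2,1) pow_proj_Hom[OF X_Ob], of k n z] that
        by (simp add: Hom_iff)
  show ?thesis
  proof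
    assume "eta n \<cdot> x = eta n \<cdot> y"
    then show "\<forall>k\<le>n. vt n k \<cdot> x = vt n k \<cdot> y" using * x y by metis
  next
    assume "\<forall>k\<le>n. vt n k \<cdot> x = vt n k \<cdot> y"
    then show "eta n \<cdot> x = eta n \<cdot> y"
      using x y eta_simps(1)[of n] by - (rule pow_ext[OF X_Ob[of 0], of _ Q
          "Suc n"]; auto simp: * Hom_iff)
  qed
qed

text \<open>Vertex \<open>k\<close> of a simplex reindexed by \<open>f\<close> is vertex
  \<open>f k\<close>, and \<open>Ind\<close> selects coordinates by the same rule; this is
  naturality of the vertex tuple.\<close>

lemma unit_tr0_Hom: "unit_tr0 C X \<in> Hom (Simp C) X (Ind C (FOb X 0))"
proof -
  have "is_nat_trans (op_cat Delta) C X (Ind C (FOb X 0)) eta"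
    unfolding is_nat_trans_def
  proof (intro conjI ballI)
    fix n show "eta n \<in> Hom C (FOb X n) (FOb (Ind C (FOb X 0)) n)"
      using eta_simps(1)[of n] by (simp add: Ind_def)
  next
    fix \<alpha> assume \<alpha>: "\<alpha> \<in> Ar (op_cat Delta)"
    obtain m n f where \<alpha>_eq: "\<alpha> = (m, n, f)" by (rule prod_cases3)
    have f: "monotone_map m n f" "restrict f {..m} = f" "(m, n, f) \<in> Ar Delta"
      using \<alpha> by (auto simp: \<alpha>_eq Ar_Delta monotone_map_def mono_on_def PiE_iff Pi_iff
          extensional_restrict)
    have fk: "f k \<le> n" if "k \<le> m" for k using f(1) that by (auto simp: monotone_map_def)
    have X: "op m n f \<in> Hom C (FOb X n) (FOb X m)" by (rule op_Hom[OF f(1)])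
    let ?I = "FAr (Ind C (FOb X 0)) (m, n, f)"
    have proj: "pow_proj C (FOb X 0) (Suc n) (f k) \<in> Hom C (pow_ob C (FOb X 0) (Suc n)) (FOb X 0)"
        if "k < Suc m" for k
      using fk[of k] that by (intro pow_proj_Hom) auto
    note T = pow_tuple_simps[OF X_Ob pow_ob_Ob[OF X_Ob], of "Suc m", OF proj]
    have I: "?I \<in> Hom C (pow_ob C (FOb X 0) (Suc n)) (pow_ob C (FOb X 0) (Suc m))"
      "\<And>k. k < Suc m \<Longrightarrow> pow_proj C (FOb X 0) (Suc m) k \<cdot> ?I = pow_proj C (FOb X 0) (Suc n) (f k)"
      using T f(3) by (simp_all add: Ind_def)
    have "eta m \<cdot> op m n f = ?I \<cdot> eta n"
    proof (rule pow_ext[OF X_Ob Comp_Hom[OF X eta_simps(1)] Comp_Hom[OF eta_simps(1) I(1)]])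
      fix k assume k: "k < Suc m"
      have "pow_proj C (FOb X 0) (Suc m) k \<cdot> (eta m \<cdot> op m n f) = vt m k \<cdot> op m n f"
        using Comp_reassoc[OF eta_simps(2,1) pow_proj_Hom[OF X_Ob k], of "op m n f"] X k
            by (simp add: Hom_iff)
      also have "\<dots> = vt n (f k)"
        using f(1) k by (intro op_comp) auto
      also have "\<dots> = pow_proj C (FOb X 0) (Suc m) k \<cdot> (?I \<cdot> eta n)"
        using Comp_reassoc[OF I(2)[OF k] I(1) pow_proj_Hom[OF X_Ob k], of
            "eta n"] eta_simps(1)[of n]
          eta_simps(2)[of "f k" n] fk[of k] k by (simp add: Hom_iff)
      finally show "pow_proj C (FOb X 0) (Suc m) k \<cdot> (eta m \<cdot> op m n f) =
        pow_proj C (FOb X 0) (Suc m) k \<cdot> (?I \<cdot> eta n)" .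
    qed
    then show "eta (Cod (op_cat Delta) \<alpha>) \<cdot> FAr X \<alpha> =
        FAr (Ind C (FOb X 0)) \<alpha> \<cdot> eta (Dom (op_cat Delta) \<alpha>)"
      by (simp add: \<alpha>_eq f(2))
  qed
  then show ?thesis
    using simplicial Ind_Ob[OF X_Ob] by (auto simp: Hom_Simp unit_tr0_def eta_def[abs_def])
qed

lemma unit_tr0_eq: "unit_tr0 C X = (X, Ind C (FOb X 0), eta)"
  by (simp add: unit_tr0_def eta_def[abs_def])

lemma monic_unit_tr0I:
  assumes ext: "\<And>Q n x y. x \<in> Hom C Q (FOb X n) \<Longrightarrow> y \<in> Hom C Q (FOb X n) \<Longrightarrow>
    (\<And>k. k \<le> n \<Longrightarrow> vt n k \<cdot> x = vt n k \<cdot> y) \<Longrightarrow> x = y"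
  shows "monic (Simp C) (unit_tr0 C X)"
  unfolding monic_def
proof (intro conjI allI ballI impI)
  show "unit_tr0 C X \<in> Ar (Simp C)" using unit_tr0_Hom by (simp add: Hom_def)
  fix Q g h assume gh: "g \<in> Hom (Simp C) Q (Dom (Simp C) (unit_tr0 C X))"
    "h \<in> Hom (Simp C) Q (Dom (Simp C) (unit_tr0 C X))"
    "unit_tr0 C X \<cdot>\<^bsub>Simp C\<^esub> g = unit_tr0 C X \<cdot>\<^bsub>Simp C\<^esub> h"
  obtain \<sigma> \<tau> where \<sigma>: "g = (Q, X, \<sigma>)" "is_nat_trans (op_cat Delta) C Q X \<sigma>"
    and \<tau>: "h = (Q, X, \<tau>)" "is_nat_trans (op_cat Delta) C Q X \<tau>"
    using gh(1,2) by (auto simp: unit_tr0_eq Hom_Simp)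
  have "\<sigma> n = \<tau> n" for n
  proof -
    have *: "\<sigma> n \<in> Hom C (FOb Q n) (FOb X n)" "\<tau> n \<in> Hom C (FOb Q n) (FOb X n)"
      using is_nat_trans_simps[OF \<sigma>(2), of n] is_nat_trans_simps[OF \<tau>(2), of n]
          by (auto simp: Hom_iff)
    have "eta n \<cdot> \<sigma> n = eta n \<cdot> \<tau> n"
      using gh(3) by (simp add: \<sigma>(1) \<tau>(1) unit_tr0_eq fun_eq_iff)
    then show ?thesis
      using ext[OF *] by (simp add: eta_eq_iff[OF *])
  qed
  then show "g = h" by (simp add: \<sigma>(1) \<tau>(1) fun_eq_iff)
qed

text \<open>Monicity in \<open>Simp C\<close> is brought down to degree \<open>n\<close> by the
  kernel pair argument for functor categories.\<close>

lemma monic_unit_tr0D: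
  assumes "monic (Simp C) (unit_tr0 C X)" and x: "x \<in> Hom C Q (FOb X n)" and y:
      "y \<in> Hom C Q (FOb X n)"
    and eq: "\<And>k. k \<le> n \<Longrightarrow> vt n k \<cdot> x = vt n k \<cdot> y"
  shows "x = y"
proof (rule monic_functor_category)
  show "category (op_cat Delta)" by (rule category_op_cat[OF category_Delta])
  show "(X, Ind C (FOb X 0), eta) \<in> Hom (functor_category (op_cat Delta) C) X (Ind C (FOb X 0))"
    using unit_tr0_Hom by (simp add: unit_tr0_eq Simp_def)
  show "monic (functor_category (op_cat Delta) C) (X, Ind C (FOb X 0), eta)"
    using assms(1) by (simp add: unit_tr0_eq Simp_def)
  show "eta n \<cdot> x = eta n \<cdot> y"
    using eq by (simp add: eta_eq_iff[OF x y])
qed (use x y in auto)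

end

section \<open>Simplicial objects with monic unit\<close>

text \<open>The assumption \<open>vertex_ext\<close> is monicity of the unit expressed on elements,
  the form that uniqueness arguments call for.\<close>

locale separated_simplicial_object_in = simplicial_object_in +
  assumes protomodular: "protomodular C"
    and vertex_ext: "\<lbrakk>x \<in> Hom C Q (FOb X n); y \<in> Hom C Q (FOb X n);
      \<And>k. k \<le> n \<Longrightarrow> vt n k \<cdot> x = vt n k \<cdot> y\<rbrakk> \<Longrightarrow> x = y"
begin

text \<open>The square splits a simplex of dimension \<open>n + 1\<close> into the face on vertices
  \<open>0\<close> to \<open>n\<close> and the last edge, glued at vertex \<open>n\<close>. The two
  parts contain all vertices, hence are jointly monic; degeneracies provide the sections for
  \<open>protomodular_pullback\<close>.\<close>

lemma segal_pullback:
  "is_pullback C (vt n n) (vt 1 0) (FOb X (Suc n)) (op n (Suc n) (\<lambda>i. i)) (eg (Suc n) n)"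
proof (rule protomodular_pullback[OF protomodular])
  \<comment> \<open>\<open>?e\<close> collapses the vertices up to \<open>n\<close> to the source of
    an edge, giving a section of the last edge map. \<open>min i n\<close> repeats vertex
    \<open>n\<close>, giving a section of the face map whose last edge is degenerate.\<close>
  let ?e = "\<lambda>i::nat. if i \<le> n then 0 else 1::nat"
  have e [simp]: "monotone_map (Suc n) 1 ?e" and e' [simp]: "monotone_map (Suc n) n (\<lambda>i. min i n)"
    by (auto simp: monotone_map_def)
  show "vt n n \<in> Hom C (FOb X n) (FOb X 0)" "vt 1 0 \<in> Hom C (FOb X 1) (FOb X 0)"
    "op n (Suc n) (\<lambda>i. i) \<in> Hom C (FOb X (Suc n)) (FOb X n)"
    "eg (Suc n) n \<in> Hom C (FOb X (Suc n)) (FOb X 1)"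
    "op 1 0 (\<lambda>_. 0) \<in> Hom C (FOb X 0) (FOb X 1)"
    "op (Suc n) 1 ?e \<in> Hom C (FOb X 1) (FOb X (Suc n))"
    "op (Suc n) n (\<lambda>i. min i n) \<in> Hom C (FOb X n) (FOb X (Suc n))"
    by (rule op_Hom; auto simp: monotone_map_def)+
  show "vt n n \<cdot> op n (Suc n) (\<lambda>i. i) = vt 1 0 \<cdot> eg (Suc n) n"
    using op_comp[of 0 n "\<lambda>_. n" "Suc n" "\<lambda>i. i" "\<lambda>_. n"]
      op_comp[of 0 1 "\<lambda>_. 0" "Suc n" "\<lambda>i. n + i" "\<lambda>_. n"] by simp
  show "vt 1 0 \<cdot> op 1 0 (\<lambda>_. 0) = Ident C (FOb X 0)"
    using op_comp[of 0 1 "\<lambda>_. 0" 0 "\<lambda>_. 0" "\<lambda>_. 0"] op_id[of 0 "\<lambda>_. 0"] by simp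
  show "eg (Suc n) n \<cdot> op (Suc n) 1 ?e = Ident C (FOb X 1)"
  proof -
    have "eg (Suc n) n \<cdot> op (Suc n) 1 ?e = op 1 1 (\<lambda>i. i)"
      by (rule op_comp[OF _ e]) (auto simp: le_Suc_eq)
    then show ?thesis using op_id[of 1 "\<lambda>i. i"] by simp
  qed
  show "op n (Suc n) (\<lambda>i. i) \<cdot> op (Suc n) n (\<lambda>i. min i n) = Ident C (FOb X n)"
    using op_comp[OF _ e', of n "\<lambda>i. i" "\<lambda>i. i"] op_id[of n "\<lambda>i. i"] by simp
  show "eg (Suc n) n \<cdot> op (Suc n) n (\<lambda>i. min i n) = op 1 0 (\<lambda>_. 0) \<cdot> vt n n"
    using op_comp[OF _ e', of 1 "\<lambda>i. n + i" "\<lambda>_. n"] op_comp[of 1 0 "\<lambda>_. 0" n "\<lambda>_. n" "\<lambda>_. n"]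
        by simp
  fix Q x y assume xy: "x \<in> Hom C Q (FOb X (Suc n))" "y \<in> Hom C Q (FOb X (Suc n))"
    "op n (Suc n) (\<lambda>i. i) \<cdot> x = op n (Suc n) (\<lambda>i. i) \<cdot> y" "eg (Suc n) n \<cdot> x = eg (Suc n) n \<cdot> y"
  show "x = y"
  proof (rule vertex_ext[OF xy(1,2)])
    fix k assume k: "k \<le> Suc n"
    show "vt (Suc n) k \<cdot> x = vt (Suc n) k \<cdot> y"
    proof (cases "k \<le> n")
      case True
      then have "vt n k \<cdot> (op n (Suc n) (\<lambda>i. i) \<cdot> z) = vt (Suc n) k \<cdot> z" if
          "z \<in> Hom C Q (FOb X (Suc n))" for z
        using that by (intro op_comp_assoc) (auto simp: Hom_iff)
      then show ?thesis using xy by metis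
    next
      case False
      then have "k = n + 1" using k by simp
      then have "vt 1 1 \<cdot> (eg (Suc n) n \<cdot> z) = vt (Suc n) k \<cdot> z" if "z \<in> Hom C Q (FOb X (Suc n))"
          for z
        using that by (intro op_comp_assoc) (auto simp: Hom_iff)
      then show ?thesis using xy by metis
    qed
  qed
qed

lemma segal_lift:
  assumes "x \<in> Hom C Q (FOb X n)" "y \<in> Hom C Q (FOb X 1)" "vt n n \<cdot> x = vt 1 0 \<cdot> y"
  shows "\<exists>h. h \<in> Hom C Q (FOb X (Suc n)) \<and> op n (Suc n) (\<lambda>i. i) \<cdot> h = x \<and> eg (Suc n) n \<cdot> h = y"
proof -
  have "Dom C (vt n n) = FOb X n" "Dom C (vt 1 0) = FOb X 1" by simp_all
  then show ?thesis
    using segal_pullback[of n] assms unfolding is_pullback_def by metis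
qed

text \<open>Over the vertex \<open>0\<close>, a \<open>2\<close>-simplex is determined by its edges \<open>02\<close> and \<open>01\<close>, which are arbitrary;
  this is what makes arrows invertible.\<close>

lemma horn_pullback:
  "is_pullback C (vt 1 0) (vt 1 0) (FOb X 2) (op 1 2 (\<lambda>i. 2 * i)) (eg 2 0)"
proof (rule protomodular_pullback[OF protomodular])
  \<comment> \<open>\<open>min i 1\<close> repeats the target, so the edge \<open>01\<close> of the
    result is the given edge. \<open>i - 1\<close> repeats the source: truncated subtraction sends
    \<open>0\<close> and \<open>1\<close> to \<open>0\<close>, so \<open>01\<close> is degenerate
    and \<open>02\<close> is the given edge.\<close>
  have [simp]: "monotone_map (Suc 0) 2 (\<lambda>i. 2 * i)" "monotone_map 2 (Suc 0) (\<lambda>i. min i (Suc 0))"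
    "monotone_map 2 (Suc 0) (\<lambda>i. i - Suc 0)"
    by (auto simp: monotone_map_def)
  show "vt 1 0 \<in> Hom C (FOb X 1) (FOb X 0)" "vt 1 0 \<in> Hom C (FOb X 1) (FOb X 0)"
    "op 1 2 (\<lambda>i. 2 * i) \<in> Hom C (FOb X 2) (FOb X 1)" "eg 2 0 \<in> Hom C (FOb X 2) (FOb X 1)"
    "op 1 0 (\<lambda>_. 0) \<in> Hom C (FOb X 0) (FOb X 1)"
    "op 2 1 (\<lambda>i. min i 1) \<in> Hom C (FOb X 1) (FOb X 2)"
    "op 2 1 (\<lambda>i. i - 1) \<in> Hom C (FOb X 1) (FOb X 2)"
    by (rule op_Hom; auto simp: monotone_map_def)+
  show "vt 1 0 \<cdot> op 1 2 (\<lambda>i. 2 * i) = vt 1 0 \<cdot> eg 2 0"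
    using op_comp[of 0 1 "\<lambda>_. 0" 2 "\<lambda>i. 2 * i" "\<lambda>_. 0"]
      op_comp[of 0 1 "\<lambda>_. 0" 2 "\<lambda>i. 0 + i" "\<lambda>_. 0"] by simp
  show "vt 1 0 \<cdot> op 1 0 (\<lambda>_. 0) = Ident C (FOb X 0)"
    using op_comp[of 0 1 "\<lambda>_. 0" 0 "\<lambda>_. 0" "\<lambda>_. 0"] op_id[of 0 "\<lambda>_. 0"] by simp
  show "eg 2 0 \<cdot> op 2 1 (\<lambda>i. min i 1) = Ident C (FOb X 1)"
    using op_comp[of 1 2 "\<lambda>i. 0 + i" 1 "\<lambda>i. min i 1" "\<lambda>i. i"] op_id[of 1 "\<lambda>i. i"] by simp
  show "op 1 2 (\<lambda>i. 2 * i) \<cdot> op 2 1 (\<lambda>i. i - 1) = Ident C (FOb X 1)"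
  proof -
    have "op 1 2 (\<lambda>i. 2 * i) \<cdot> op 2 1 (\<lambda>i. i - 1) = op 1 1 (\<lambda>i. i)"
      by (rule op_comp) (auto simp: monotone_map_def)
    then show ?thesis using op_id[of 1 "\<lambda>i. i"] by simp
  qed
  show "eg 2 0 \<cdot> op 2 1 (\<lambda>i. i - 1) = op 1 0 (\<lambda>_. 0) \<cdot> vt 1 0"
    using op_comp[of 1 2 "\<lambda>i. 0 + i" 1 "\<lambda>i. i - 1" "\<lambda>_. 0"] op_comp[of 1 0 "\<lambda>_. 0" 1 "\<lambda>_. 0"
        "\<lambda>_. 0"] by simp
  fix Q x y assume xy: "x \<in> Hom C Q (FOb X 2)" "y \<in> Hom C Q (FOb X 2)"
    "op 1 2 (\<lambda>i. 2 * i) \<cdot> x = op 1 2 (\<lambda>i. 2 * i) \<cdot> y" "eg 2 0 \<cdot> x = eg 2 0 \<cdot> y"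
  show "x = y"
  proof (rule vertex_ext[OF xy(1,2)])
    fix k :: nat assume k: "k \<le> 2"
    show "vt 2 k \<cdot> x = vt 2 k \<cdot> y"
    proof (cases "k \<le> 1")
      case True
      then have "vt 1 k \<cdot> (eg 2 0 \<cdot> z) = vt 2 k \<cdot> z" if "z \<in> Hom C Q (FOb X 2)" for z
        using that by (intro op_comp_assoc) (auto simp: Hom_iff)
      then show ?thesis using xy by metis
    next
      case False
      then have "k = 2" using k by simp
      then have "vt 1 1 \<cdot> (op 1 2 (\<lambda>i. 2 * i) \<cdot> z) = vt 2 k \<cdot> z" if "z \<in> Hom C Q (FOb X 2)" for z
        using that by (intro op_comp_assoc) (auto simp: Hom_iff)
      then show ?thesis using xy by metis
    qed
  qed
qed

lemma horn_lift:
  assumes "x \<in> Hom C Q (FOb X 1)" "y \<in> Hom C Q (FOb X 1)" "vt 1 0 \<cdot> x = vt 1 0 \<cdot> y"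
  shows "\<exists>h. h \<in> Hom C Q (FOb X 2) \<and> op 1 2 (\<lambda>i. 2 * i) \<cdot> h = x \<and> eg 2 0 \<cdot> h = y"
proof -
  have "Dom C (vt 1 0) = FOb X 1" by simp
  then show ?thesis
    using horn_pullback assms unfolding is_pullback_def by metis
qed

lemma relation_ext:
  assumes "x \<in> Hom C Q (FOb X 1)" "y \<in> Hom C Q (FOb X 1)" "vt 1 1 \<cdot> x = vt 1 1 \<cdot> y" "vt 1 0 \<cdot> x =
      vt 1 0 \<cdot> y"
  shows "x = y"
  by (rule vertex_ext[OF assms(1,2)]) (use assms(3,4) in \<open>auto simp: le_Suc_eq\<close>)

lemma ex_equivalence_relation:
  obtains G where "internal_equivalence_relation C G" "G0 G = FOb X 0" "G1 G = FOb X 1"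
    "Gd0 G = vt 1 1" "Gd1 G = vt 1 0"
proof -
  let ?f = "op 1 2 (\<lambda>i. 2 * i)"
  have d: "vt 1 1 \<in> Hom C (FOb X 1) (FOb X 0)" "vt 1 0 \<in> Hom C (FOb X 1) (FOb X 0)"
    by (rule op_Hom; auto simp: monotone_map_def)+
  have s: "op 1 0 (\<lambda>_. 0) \<in> Hom C (FOb X 0) (FOb X 1)" by (rule op_Hom) simp
  have ds: "vt 1 k \<cdot> op 1 0 (\<lambda>_. 0) = Ident C (FOb X 0)" if "k \<le> 1" for k
    using that op_comp[of 0 1 "\<lambda>_. k" 0 "\<lambda>_. 0" "\<lambda>_. 0"] op_id[of 0 "\<lambda>_. 0"] by simp
  have X2: "?f \<in> Hom C (FOb X 2) (FOb X 1)" "eg 2 0 \<in> Hom C (FOb X 2) (FOb X 1)"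
    "eg 2 1 \<in> Hom C (FOb X 2) (FOb X 1)"
    by (rule op_Hom; auto simp: monotone_map_def)+
  have v: "vt 1 0 \<cdot> (?f \<cdot> z) = vt 2 0 \<cdot> z" "vt 1 1 \<cdot> (?f \<cdot> z) = vt 2 2 \<cdot> z"
    "vt 1 0 \<cdot> (eg 2 0 \<cdot> z) = vt 2 0 \<cdot> z" "vt 1 1 \<cdot> (eg 2 0 \<cdot> z) = vt 2 1 \<cdot> z"
    "vt 1 0 \<cdot> (eg 2 1 \<cdot> z) = vt 2 1 \<cdot> z" "vt 1 1 \<cdot> (eg 2 1 \<cdot> z) = vt 2 2 \<cdot> z"
    if "z \<in> Hom C Q (FOb X 2)" for z Q
    using that by (intro op_comp_assoc; auto simp: Hom_iff monotone_map_def)+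
  let ?P = "pb_ob C (vt 1 1) (vt 1 0)"
  note P = pb_simps[OF d]
  \<comment> \<open>The simplex over the generic composable pair; its edge \<open>02\<close> will be
    the composite.\<close>
  have "\<exists>h. h \<in> Hom C ?P (FOb X 2) \<and> eg 2 0 \<cdot> h = pb_fst C (vt 1 1) (vt 1 0) \<and>
      eg 2 1 \<cdot> h = pb_snd C (vt 1 1) (vt 1 0)"
    using segal_lift[of _ _ 1, OF P] by (simp add: numeral_2_eq_2)
  then obtain h where h: "h \<in> Hom C ?P (FOb X 2)" "eg 2 0 \<cdot> h = pb_fst C (vt 1 1) (vt 1 0)"
    "eg 2 1 \<cdot> h = pb_snd C (vt 1 1) (vt 1 0)" by blast
  \<comment> \<open>The horn for the inverse: \<open>01\<close> is the generic arrow and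
    \<open>02\<close> the degenerate edge at its source, so both start at the same vertex.\<close>
  have "vt 1 0 \<cdot> (op 1 0 (\<lambda>_. 0) \<cdot> vt 1 0) = vt 1 0 \<cdot> Ident C (FOb X 1)"
    using Comp_reassoc[OF ds[of 0] s d(2), of "vt 1 0"] d by (simp add: Hom_iff)
  moreover have "op 1 0 (\<lambda>_. 0) \<cdot> vt 1 0 \<in> Hom C (FOb X 1) (FOb X 1)"
      "Ident C (FOb X 1) \<in> Hom C (FOb X 1) (FOb X 1)"
    by (simp_all add: Hom_iff)
  ultimately have "\<exists>g. g \<in> Hom C (FOb X 1) (FOb X 2) \<and> ?f \<cdot> g = op 1 0 (\<lambda>_. 0) \<cdot> vt 1 0 \<and>
      eg 2 0 \<cdot> g = Ident C (FOb X 1)"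
    by (intro horn_lift) simp_all
  then obtain g where g: "g \<in> Hom C (FOb X 1) (FOb X 2)" "?f \<cdot> g = op 1 0 (\<lambda>_. 0) \<cdot> vt 1 0"
    "eg 2 0 \<cdot> g = Ident C (FOb X 1)" by blast
  \<comment> \<open>\<open>Gi\<close> is the edge \<open>12\<close> of the filled horn: it runs from
    vertex \<open>1\<close>, the target of the generic arrow, to vertex \<open>2\<close>, which is
    its source because \<open>02\<close> is degenerate.\<close>
  define G where "G = \<lparr>G0 = FOb X 0, G1 = FOb X 1, Gd0 = vt 1 1, Gd1 = vt 1 0, Gs = op 1 0 (\<lambda>_. 0),
    Gm = ?f \<cdot> h, Gi = eg 2 1 \<cdot> g\<rparr>"
  have "internal_equivalence_relation C G"
  proof (rule internal_equivalence_relationI)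
    show "Gm G \<in> Hom C (pb_ob C (Gd0 G) (Gd1 G)) (G1 G)"
      using Comp_Hom[OF h(1) X2(1)] by (simp add: G_def)
    show "Gd1 G \<cdot> Gm G = Gd1 G \<cdot> pb_fst C (Gd0 G) (Gd1 G)"
      "Gd0 G \<cdot> Gm G = Gd0 G \<cdot> pb_snd C (Gd0 G) (Gd1 G)"
      using v[OF h(1)] h(2,3) by (simp_all add: G_def)
    show "Gi G \<in> Hom C (G1 G) (G1 G)"
      using Comp_Hom[OF g(1) X2(3)] by (simp add: G_def)
    have "vt 1 1 \<cdot> (op 1 0 (\<lambda>_. 0) \<cdot> vt 1 0) = vt 1 0"
      using Comp_reassoc[OF ds[of 1] s d(1), of "vt 1 0"] d by (simp add: Hom_iff)
    then show "Gd1 G \<cdot> Gi G = Gd0 G" "Gd0 G \<cdot> Gi G = Gd1 G"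
      using v[OF g(1)] g(2,3) d by (simp_all add: G_def Hom_iff)
    show "x = y" if "x \<in> Hom C Q (G1 G)" "y \<in> Hom C Q (G1 G)" "Gd0 G \<cdot> x = Gd0 G \<cdot> y" "Gd1 G \<cdot> x =
        Gd1 G \<cdot> y" for Q x y
      using relation_ext that by (simp add: G_def)
  qed (use d s ds in \<open>auto simp: G_def\<close>)
  then show ?thesis
    by (rule that) (simp_all add: G_def)
qed

text \<open>Gluing edges one at a time with \<open>segal_lift\<close> produces a simplex over any
  string, and it is unique because its vertices are prescribed.\<close>

lemma string_object:
  assumes G: "internal_groupoid C G" "G0 G = FOb X 0" "G1 G = FOb X 1" "Gd0 G = vt 1 1" "Gd1 G =
      vt 1 0"
  shows "is_string_object C G n (FOb X n) (vt n) (eg n)"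
proof -
  have str: "is_string C G n (FOb X n) (vt n) (eg n)" for n
    unfolding is_string_def
  proof (intro conjI allI impI)
    fix k assume k: "k < n"
    show "Gd1 G \<cdot> eg n k = vt n k" "Gd0 G \<cdot> eg n k = vt n (Suc k)"
      unfolding G using k by (intro op_comp; simp)+
  qed (auto simp: G intro!: op_Hom)
  have ex: "\<exists>h. h \<in> Hom C Q (FOb X n) \<and> (\<forall>k\<le>n. vt n k \<cdot> h = v k) \<and> (\<forall>k<n. eg n k \<cdot> h = e k)"
    if "is_string C G n Q v e" for Q v e n
    using that
  proof (induction n)
    case 0
    then have "v 0 \<in> Hom C Q (FOb X 0)" by (simp add: is_string_def G)
    have "vt 0 0 = Ident C (FOb X 0)" by (rule op_id) simp
    then have "vt 0 0 \<cdot> v 0 = v 0"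
      using \<open>v 0 \<in> _\<close> by (simp add: Hom_iff)
    then show ?case
      using \<open>v 0 \<in> _\<close> by blast
  next
    case (Suc n)
    have 1: "v k \<in> Hom C Q (FOb X 0)" if "k \<le> Suc n" for k
      using Suc.prems that by (simp add: is_string_def G)
    have 2: "e k \<in> Hom C Q (FOb X 1)" "vt 1 0 \<cdot> e k = v k" "vt 1 1 \<cdot> e k = v (Suc k)" if
        "k < Suc n" for k
      using Suc.prems that by (simp_all add: is_string_def G)
    have "is_string C G n Q v e" using Suc.prems by (auto simp: is_string_def)
    from Suc.IH[OF this] obtain h where h: "h \<in> Hom C Q (FOb X n)" "\<And>k. k \<le> n \<Longrightarrow> vt n k \<cdot> h = v k"
      "\<And>k. k < n \<Longrightarrow> eg n k \<cdot> h = e k" by blast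
    have "vt n n \<cdot> h = vt 1 0 \<cdot> e n" using h(2)[of n] 2(2)[of n] by simp
    then obtain g where g: "g \<in> Hom C Q (FOb X (Suc n))" "op n (Suc n) (\<lambda>i. i) \<cdot> g = h"
        "eg (Suc n) n \<cdot> g = e n"
      using segal_lift[OF h(1) 2(1)[of n]] by blast
    have "vt (Suc n) k \<cdot> g = v k" if k: "k \<le> Suc n" for k
    proof (cases "k \<le> n")
      case True
      have "vt n k \<cdot> (op n (Suc n) (\<lambda>i. i) \<cdot> g) = vt (Suc n) k \<cdot> g"
        using True g(1) by (intro op_comp_assoc) (auto simp: Hom_iff)
      then show ?thesis using h(2)[OF True] g(2) by simp
    next
      case False
      then have k: "k = n + 1" using k by simp
      have "vt 1 1 \<cdot> (eg (Suc n) n \<cdot> g) = vt (Suc n) k \<cdot> g"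
        using k g(1) by (intro op_comp_assoc) (auto simp: Hom_iff)
      then show ?thesis using 2(3)[of n] g(3) k by simp
    qed
    moreover have "eg (Suc n) k \<cdot> g = e k" if k: "k < Suc n" for k
    proof (cases "k < n")
      case True
      have "eg n k \<cdot> (op n (Suc n) (\<lambda>i. i) \<cdot> g) = eg (Suc n) k \<cdot> g"
        using True g(1) by (intro op_comp_assoc) (auto simp: Hom_iff)
      then show ?thesis using h(3)[OF True] g(2) by simp
    next
      case False
      then show ?thesis using g(3) k by (simp add: less_Suc_eq)
    qed
    ultimately show ?case using g(1) by blast
  qed
  have "\<exists>!h. h \<in> Hom C Q (FOb X n) \<and> (\<forall>k\<le>n. vt n k \<cdot> h = v k) \<and> (\<forall>k<n. eg n k \<cdot> h = e k)"
    if Q: "is_string C G n Q v e" for Q v e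
  proof -
    obtain h where h: "h \<in> Hom C Q (FOb X n) \<and> (\<forall>k\<le>n. vt n k \<cdot> h = v k) \<and> (\<forall>k<n. eg n k \<cdot> h = e k)"
      using ex[OF Q] by blast
    show ?thesis
    proof (rule ex1I[of _ h])
      fix g assume g: "g \<in> Hom C Q (FOb X n) \<and> (\<forall>k\<le>n. vt n k \<cdot> g = v k) \<and> (\<forall>k<n. eg n k \<cdot> g = e k)"
      show "g = h" by (rule vertex_ext[of _ Q n]) (use g h in simp_all)
    qed (rule h)
  qed
  then show ?thesis
    using str unfolding is_string_object_def by blast
qed

text \<open>In each degree two string objects of one groupoid are compared by the maps matching
  vertices and edges. Naturality is checked on vertices alone, as these determine maps into
  \<open>X\<close>.\<close>

lemma nerve_iso:
  assumes G: "internal_groupoid C G" "G0 G = FOb X 0" "G1 G = FOb X 1" "Gd0 G = vt 1 1" "Gd1 G =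
      vt 1 0"
  obtains \<tau> where "(nerve_of C G, X, \<tau>) \<in> Hom (Simp C) (nerve_of C G) X"
    "iso_arr (Simp C) (nerve_of C G, X, \<tau>)"
proof -
  interpret G: groupoid_in C G by (rule groupoid_in[OF G(1)])
  note S = string_object[OF G]
  have "\<exists>h. h \<in> Hom C (nerve_ob C G n) (FOb X n) \<and> (\<forall>k\<le>n. vt n k \<cdot> h = nerve_vert C G n k) \<and>
      (\<forall>k<n. eg n k \<cdot> h = nerve_edge C G n k)" for n
    using S[of n] G.nerve_string[of n] unfolding is_string_object_def by blast
  then obtain \<tau> where \<tau>: "\<And>n. \<tau> n \<in> Hom C (nerve_ob C G n) (FOb X n)"
    "\<And>n k. k \<le> n \<Longrightarrow> vt n k \<cdot> \<tau> n = nerve_vert C G n k"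
    "\<And>n k. k < n \<Longrightarrow> eg n k \<cdot> \<tau> n = nerve_edge C G n k"
    by metis
  have iso: "iso_arr C (\<tau> n)" for n
  proof -
    have "is_string C G n (FOb X n) (vt n) (eg n)" using S[of n] by (simp add: is_string_object_def)
    note \<sigma> = G.nerve_tuple_simps[OF this]
    let ?\<sigma> = "nerve_tuple C G n (FOb X n) (vt n) (eg n)"
    show ?thesis
    proof (rule iso_arrI[OF \<tau>(1) \<sigma>(1)])
      show "?\<sigma> \<cdot> \<tau> n = Ident C (nerve_ob C G n)"
      proof (rule G.nerve_ext[OF Comp_Hom[OF \<tau>(1) \<sigma>(1)] Ident_Hom[OF G.nerve_simps(1)]])
        show "nerve_vert C G n k \<cdot> (?\<sigma> \<cdot> \<tau> n) = nerve_vert C G n k \<cdot> Ident C (nerve_ob C G n)" if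
            "k \<le> n" for k
          using Comp_reassoc[OF \<sigma>(2)[OF that] \<sigma>(1), of "G0 G" "\<tau> n"] that \<tau>(1)[of n] \<tau>(2)[OF that]
          by (simp add: Hom_iff)
        show "nerve_edge C G n k \<cdot> (?\<sigma> \<cdot> \<tau> n) = nerve_edge C G n k \<cdot> Ident C (nerve_ob C G n)" if
            "k < n" for k
          using Comp_reassoc[OF \<sigma>(3)[OF that] \<sigma>(1), of "G1 G" "\<tau> n"] that \<tau>(1)[of n] \<tau>(3)[OF that]
          by (simp add: Hom_iff)
      qed
      show "\<tau> n \<cdot> ?\<sigma> = Ident C (FOb X n)"
      proof (rule vertex_ext[OF Comp_Hom[OF \<sigma>(1) \<tau>(1)] Ident_Hom[OF X_Ob]])
        show "vt n k \<cdot> (\<tau> n \<cdot> ?\<sigma>) = vt n k \<cdot> Ident C (FOb X n)" if "k \<le> n" for k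
          using Comp_reassoc[OF \<tau>(2)[OF that] \<tau>(1) op_Hom, of ?\<sigma>] that \<sigma>(1) \<sigma>(2)[OF that]
          by (simp add: Hom_iff)
      qed
    qed
  qed
  have "\<tau> m \<cdot> FAr (nerve_of C G) (m, n, f) = FAr X (m, n, f) \<cdot> \<tau> n" if f: "(m, n, f) \<in> Ar Delta"
      for m n f
  proof -
    have f': "monotone_map m n f" "restrict f {..m} = f"
      using f by (auto simp: Ar_Delta monotone_map_def mono_on_def PiE_iff Pi_iff
          extensional_restrict)
    note N = G.nerve_of_map[OF f]
    have "\<tau> m \<cdot> FAr (nerve_of C G) (m, n, f) = op m n f \<cdot> \<tau> n"
    proof (rule vertex_ext[OF Comp_Hom[OF N(1) \<tau>(1)] Comp_Hom[OF \<tau>(1) op_Hom[OF f'(1)]]])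
      fix k assume k: "k \<le> m"
      then have fk: "f k \<le> n" using f'(1) by (simp add: monotone_map_def)
      have "vt m k \<cdot> (op m n f \<cdot> \<tau> n) = vt n (f k) \<cdot> \<tau> n"
        using f'(1) k \<tau>(1)[of n] by (intro op_comp_assoc) (auto simp: Hom_iff)
      then show "vt m k \<cdot> (\<tau> m \<cdot> FAr (nerve_of C G) (m, n, f)) = vt m k \<cdot> (op m n f \<cdot> \<tau> n)"
        using Comp_reassoc[OF \<tau>(2)[OF k] \<tau>(1) op_Hom, of
            "FAr (nerve_of C G) (m, n, f)"] k N(1) N(2)[OF k]
          \<tau>(2)[OF fk] by (simp add: Hom_iff)
    qed
    then show ?thesis by (simp add: f'(2))
  qed
  then have "\<tau> (Dom Delta \<alpha>) \<cdot> FAr (nerve_of C G) \<alpha> = FAr X \<alpha> \<cdot> \<tau> (Cod Delta \<alpha>)" if "\<alpha> \<in> Ar Delta"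
      for \<alpha>
    using that by (cases \<alpha> rule: prod_cases3) simp
  then have "is_nat_trans (op_cat Delta) C (nerve_of C G) X \<tau>"
    using \<tau>(1) by (simp add: is_nat_trans_def)
  then have "(nerve_of C G, X, \<tau>) \<in> Hom (Simp C) (nerve_of C G) X"
    using simplicial G.nerve_of_Ob by (simp add: Hom_Simp)
  moreover from this have "iso_arr (Simp C) (nerve_of C G, X, \<tau>)"
    unfolding Simp_def by (rule iso_arr_functor_category[OF category_op_cat[OF category_Delta]])
        (rule iso)
  ultimately show ?thesis by (rule that)
qed

end

section \<open>Nerves of equivalence relations and the two claims\<close>

context lex_category
begin

text \<open>A map into the nerve is determined by its vertices and edges, and in a relation an edge
  is determined by its endpoints, which are vertices again.\<close>

lemma monic_unit_nerve:
  assumes G: "internal_equivalence_relation C G"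
  shows "monic (Simp C) (unit_tr0 C (nerve_of C G))"
proof -
  have grpd: "internal_groupoid C G" using G by (simp add: internal_equivalence_relation_def)
  interpret G: groupoid_in C G by (rule groupoid_in[OF grpd])
  interpret simplicial_object_in C "nerve_of C G"
    by unfold_locales (rule G.nerve_of_Ob)
  have rel: "x = y" if "x \<in> Hom C Q (G1 G)" "y \<in> Hom C Q (G1 G)" "Gd0 G \<cdot> x = Gd0 G \<cdot> y"
      "Gd1 G \<cdot> x = Gd1 G \<cdot> y" for Q x y
    using G that unfolding internal_equivalence_relation_def monic_pow_pair_iff[OF G.G_Hom(1,2)]
        by blast
  show ?thesis
  proof (rule monic_unit_tr0I)
    fix Q n x y assume xy: "x \<in> Hom C Q (FOb (nerve_of C G) n)" "y \<in> Hom C Q (FOb (nerve_of C G) n)"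
      and eq: "\<And>k. k \<le> n \<Longrightarrow> vt n k \<cdot> x = vt n k \<cdot> y"
    have vert: "nerve_vert C G n k \<cdot> x = nerve_vert C G n k \<cdot> y" if k: "k \<le> n" for k
    proof -
      have "(0, n, restrict (\<lambda>_. k) {..0}) \<in> Ar Delta" using k by (auto simp: Ar_Delta mono_on_def)
      note N = G.nerve_of_map[OF this]
      have "nerve_vert C G 0 0 \<cdot> (vt n k \<cdot> z) = nerve_vert C G n k \<cdot> z" if
          "z \<in> Hom C Q (nerve_ob C G n)" for z
        using Comp_reassoc[OF N(2)[of 0] N(1), of "G0 G" z] that by (simp add: Hom_iff)
      then show ?thesis using eq[OF k] xy by (metis G.FOb_nerve_of)
    qed
    show "x = y"
    proof (rule G.nerve_ext)
      show "x \<in> Hom C Q (nerve_ob C G n)" "y \<in> Hom C Q (nerve_ob C G n)" using xy by simp_all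
      show "nerve_edge C G n k \<cdot> x = nerve_edge C G n k \<cdot> y" if k: "k < n" for k
      proof (rule rel)
        note S = G.nerve_stringD(3-5)[OF k]
        show "nerve_edge C G n k \<cdot> x \<in> Hom C Q (G1 G)" "nerve_edge C G n k \<cdot> y \<in> Hom C Q (G1 G)"
          using xy S(1) by (auto intro: Comp_Hom)
        show "Gd0 G \<cdot> (nerve_edge C G n k \<cdot> x) = Gd0 G \<cdot> (nerve_edge C G n k \<cdot> y)"
          using Comp_reassoc[OF S(3,1) G.G_Hom(1)] xy vert[of "Suc k"] k by (simp add: Hom_iff)
        show "Gd1 G \<cdot> (nerve_edge C G n k \<cdot> x) = Gd1 G \<cdot> (nerve_edge C G n k \<cdot> y)"
          using Comp_reassoc[OF S(2,1) G.G_Hom(2)] xy vert[of k] k by (simp add: Hom_iff)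
      qed
    qed (rule vert)
  qed
qed

lemma F_tr0_equivalent_Eq:
  assumes "protomodular C"
  shows "equivalent_categories (F_tr0 C) (Eq_cat C)"
proof (rule equivalent_categories_if_fully_faithful)
  show "category (F_tr0 C)" "category (Eq_cat C)"
    unfolding F_tr0_def Eq_cat_def
    by (intro category_full_subcategory category_Simp category_Grpd)+
  show "fully_faithful (Eq_cat C) (F_tr0 C) (nerve C)"
    unfolding F_tr0_def Eq_cat_def
    by (rule fully_faithful_full_subcategory[OF nerve_fully_faithful category_Grpd])
      (simp add: nerve_def monic_unit_nerve)
  fix X assume "X \<in> Ob (F_tr0 C)"
  then have X: "X \<in> Ob (Simp C)" "monic (Simp C) (unit_tr0 C X)" by (simp_all add: F_tr0_def)
  interpret simplicial_object_in C X by unfold_locales (rule X(1))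
  \<comment> \<open>The preceding interpretation makes \<open>monic_unit_tr0D\<close> available, and
    this discharges \<open>vertex_ext\<close>.\<close>
  interpret separated_simplicial_object_in C X
    by unfold_locales (fact assms, rule monic_unit_tr0D[OF X(2)])
  obtain G where G: "internal_equivalence_relation C G" "G0 G = FOb X 0" "G1 G = FOb X 1"
    "Gd0 G = vt 1 1" "Gd1 G = vt 1 0"
    by (rule ex_equivalence_relation)
  then have grpd: "internal_groupoid C G" by (simp add: internal_equivalence_relation_def)
  obtain \<tau> where \<tau>: "(nerve_of C G, X, \<tau>) \<in> Hom (Simp C) (nerve_of C G) X"
    "iso_arr (Simp C) (nerve_of C G, X, \<tau>)"
    by (rule nerve_iso[OF grpd G(2-5)])
  \<comment> \<open>The isomorphism of simplicial objects lies in \<open>F_tr0 C\<close> because its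
    source, the nerve of a relation, has a monic unit as well.\<close>
  have "(nerve_of C G, X, \<tau>) \<in> Hom (F_tr0 C) (nerve_of C G) X"
    using \<tau>(1) X(2) monic_unit_nerve[OF G(1)] by (simp add: F_tr0_def Hom_full_subcategory)
  moreover have "iso_arr (F_tr0 C) (nerve_of C G, X, \<tau>)"
    unfolding F_tr0_def using \<tau>(2) X(2) monic_unit_nerve[OF G(1)]
    by (intro iso_arr_full_subcategory) simp_all
  ultimately have "isomorphic (F_tr0 C) (FOb (nerve C) G) X"
    unfolding isomorphic_def by (simp add: nerve_def) blast
  moreover have "G \<in> Ob (Eq_cat C)" using G(1) grpd by (simp add: Eq_cat_def)
  ultimately show "\<exists>G \<in> Ob (Eq_cat C). isomorphic (F_tr0 C) (FOb (nerve C) G) X" by blast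
qed

end

text \<open>Containment of the abelian groups in the torsion part is expressed by a fully faithful
  functor, as the two categories have objects of different types: a group is sent to the nerve of
  its groupoid on the zero object.\<close>

theorem proposition5p7:
  fixes X :: "('o, 'm) cat"
  assumes "semi_abelian X"
  shows "equivalent_categories (F_tr0 X) (Eq_cat X) \<and>
    fully_faithful (Ab_cat X) (T_tr0 X) (comp_func (nerve X) (ab_groupoid X))"
proof -
  have "category X" "finitely_complete X" "pointed X" "protomodular X"
    using assms by (simp_all add: semi_abelian_def Barr_exact_def regular_category_def)
  then interpret pointed_lex_category X
    by (simp add: pointed_lex_category_def pointed_lex_category_axioms_def lex_category_def
        lex_category_axioms_def)
  show ?thesis
    using F_tr0_equivalent_Eq[OF \<open>protomodular X\<close>] fully_faithful_Ab_T_tr0 by simp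
qed

end
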